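(* Let $\Gamma$ be the cograph of an acyclic fibration $f\colon X\to Y$ of higher groupoids in $(\mathcal C,\mathcal T)$. Then $T\Gamma\to j(\Delta^1)$ is a Kan fibration.
   Context: A singleton Grothendieck pretopology $\mathcal T$ on a locally small category $\mathcal C$ is a class of morphisms (covers) containing isomorphisms, closed under composition, and such that pullbacks of covers along arbitrary morphisms exist and are covers. Here $\mathcal C$ is extensive (finite coproducts and $\mathcal C/A\times\mathcal C/B\simeq\mathcal C/(A\sqcup B)$ via coproduct), has a terminal object $\mathbf 1$, every $Z\to\mathbf 1$ is a cover, and a coproduct $f_1\sqcup f_2$ of two morphisms is a cover iff both $f_1,f_2$ are. For a degreewise finite simplicial set $S$ and a simplicial object $X$ in $\mathcal C$, $\mathrm{Hom}(S,X)$ is the presheaf $Z\mapsto\{\text{simplicial maps }S\to\mathcal C(Z,X_\bullet)\}$ on $\mathcal C$; $\mathrm{Hom}(R\to S,X\to Y)=\mathrm{Hom}(R,X)\times_{\mathrm{Hom}(R,Y)}\mathrm{Hom}(S,Y)$. A morphism $f\colon X\to Y$ satisfies $\mathrm{Kan}(m,k)$ (resp. $\mathrm{Kan!}(m,k)$) if $\mathrm{Hom}(\Lambda^m_k\to\Delta^m,X\to Y)$ is representable and the natural map from $X_m$ to it is a cover (resp. isomorphism); it is a Kan fibration if $\mathrm{Kan}(m,k)$ holds for all $m\ge1$, $0\le k\le m$. It is an acyclic fibration if for all $m\ge0$, $\mathrm{Hom}(\partial\Delta^m\to\Delta^m,X\to Y)$ is representable and the natural map from $X_m$ to it is a cover.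 A higher groupoid is an $n$-groupoid for some $0\le n\le\infty$: $X\to\mathbf 1$ is a Kan fibration satisfying $\mathrm{Kan!}(m,k)$ for all $m>n$, $0\le k\le m$. For a finite set $S$, $j(S)$ is the coproduct of $S$ copies of $\mathbf 1$; $j(\Delta^1)$ is the simplicial object obtained degreewise. An augmented bisimplicial object is a functor $\Delta_+^{op}\times\Delta_+^{op}\to\mathcal C$, $([i],[j])\mapsto\Gamma_{i,j}$, $i,j\ge-1$, where $\Delta_+$ is the category of finite (possibly empty) ordinals. If $\Gamma_{-1,-1}=\mathbf 1$, its total simplicial object is $(T\Gamma)_n=\bigsqcup_{i+j+1=n}\Gamma_{i,j}$ ($n\ge0$, $i,j\ge-1$), with the natural map to $j(\Delta^1)$ sending $\Gamma_{i,j}$ to the simplex of $\Delta^1$ with $i+1$ vertices $0$ followed by $j+1$ vertices $1$. The cograph of $f\colon X\to Y$ is the augmented bisimplicial object $\Gamma_{i,j}=X_i\times_{Y_i}Y_{i+j+1}$, where $Y_{i+j+1}\to Y_i$ restricts to the first $i+1$ vertices, with $X_{-1}=Y_{-1}=\mathbf 1$ (so $\Gamma_{i,-1}=X_i$, $\Gamma_{-1,j}=Y_j$), and structure maps induced by the ordinal sum $[i]\star[j]=[i+j+1]$ and those of $X$, $Y$. *)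

theory Defs
  imports "HOL-Library.FuncSet" "HOL-Library.Extended_Nat"
begin

section \<open>Categories, functors, equivalences\<close>

record ('o, 'a) cat =
  Obj :: "'o set"
  Arr :: "'a set"
  Dom :: "'a \<Rightarrow> 'o"
  Cod :: "'a \<Rightarrow> 'o"
  Idt :: "'o \<Rightarrow> 'a"
  Cmp :: "'a \<Rightarrow> 'a \<Rightarrow> 'a"  (infixl "\<cdot>\<index>" 70)

definition Hom :: "('o, 'a) cat \<Rightarrow> 'o \<Rightarrow> 'o \<Rightarrow> 'a set" where
  "Hom C x y = {f \<in> Arr C. Dom C f = x \<and> Cod C f = y}"

locale category =
  fixes C :: "('o, 'a) cat"  (structure)
  assumes Dom_in: "f \<in> Arr C \<Longrightarrow> Dom C f \<in> Obj C"
    and Cod_in: "f \<in> Arr C \<Longrightarrow> Cod C f \<in> Obj C"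
    and Idt_in: "x \<in> Obj C \<Longrightarrow> Idt C x \<in> Hom C x x"
    and Cmp_in: "f \<in> Hom C x y \<Longrightarrow> g \<in> Hom C y z \<Longrightarrow> g \<cdot> f \<in> Hom C x z"
    and Cmp_Idt: "f \<in> Hom C x y \<Longrightarrow> f \<cdot> Idt C x = f"
    and Idt_Cmp: "f \<in> Hom C x y \<Longrightarrow> Idt C y \<cdot> f = f"
    and Cmp_assoc: "f \<in> Hom C x y \<Longrightarrow> g \<in> Hom C y z \<Longrightarrow> h \<in> Hom C z w
                    \<Longrightarrow> (h \<cdot> g) \<cdot> f = h \<cdot> (g \<cdot> f)"

definition iso :: "('o, 'a) cat \<Rightarrow> 'a \<Rightarrow> bool" where
  "iso C f \<longleftrightarrow> f \<in> Arr C \<and>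
     (\<exists>g \<in> Hom C (Cod C f) (Dom C f).
        g \<cdot>\<^bsub>C\<^esub> f = Idt C (Dom C f) \<and> f \<cdot>\<^bsub>C\<^esub> g = Idt C (Cod C f))"

definition op_cat :: "('o, 'a) cat \<Rightarrow> ('o, 'a) cat" where
  "op_cat C = \<lparr>Obj = Obj C, Arr = Arr C, Dom = Cod C, Cod = Dom C, Idt = Idt C,
               Cmp = (\<lambda>g f. f \<cdot>\<^bsub>C\<^esub> g)\<rparr>"

definition prod_cat :: "('o, 'a) cat \<Rightarrow> ('p, 'b) cat \<Rightarrow> ('o \<times> 'p, 'a \<times> 'b) cat" where
  "prod_cat C D =
     \<lparr>Obj = Obj C \<times> Obj D, Arr = Arr C \<times> Arr D,
      Dom = map_prod (Dom C) (Dom D), Cod = map_prod (Cod C) (Cod D),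
      Idt = map_prod (Idt C) (Idt D),
      Cmp = (\<lambda>(g, g') (f, f'). (g \<cdot>\<^bsub>C\<^esub> f, g' \<cdot>\<^bsub>D\<^esub> f'))\<rparr>"

definition full_subcat :: "('o, 'a) cat \<Rightarrow> 'o set \<Rightarrow> ('o, 'a) cat" where
  "full_subcat C P =
     C\<lparr>Obj := Obj C \<inter> P, Arr := {f \<in> Arr C. Dom C f \<in> P \<and> Cod C f \<in> P}\<rparr>"

text \<open>An arrow of the slice over \<open>A\<close> from \<open>f\<close> to \<open>f'\<close> is a triple \<open>(f, h, f')\<close> where
  \<open>h\<close> goes from the domain of \<open>f\<close> to that of \<open>f'\<close> and \<open>f'\<close> after \<open>h\<close> is \<open>f\<close>.\<close>

definition slice :: "('o, 'a) cat \<Rightarrow> 'o \<Rightarrow> ('a, 'a \<times> 'a \<times> 'a) cat" where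
  "slice C A =
     \<lparr>Obj = {f \<in> Arr C. Cod C f = A},
      Arr = {(f, h, f'). f \<in> Arr C \<and> Cod C f = A \<and> f' \<in> Arr C \<and> Cod C f' = A \<and>
                         h \<in> Hom C (Dom C f) (Dom C f') \<and> f' \<cdot>\<^bsub>C\<^esub> h = f},
      Dom = (\<lambda>(f, h, f'). f), Cod = (\<lambda>(f, h, f'). f'),
      Idt = (\<lambda>f. (f, Idt C (Dom C f), f)),
      Cmp = (\<lambda>(_, h', f'') (f, h, _). (f, h' \<cdot>\<^bsub>C\<^esub> h, f''))\<rparr>"

record ('o, 'a, 'p, 'b) fctr =
  omap :: "'o \<Rightarrow> 'p"
  amap :: "'a \<Rightarrow> 'b"

definition is_fctr :: "('o, 'a) cat \<Rightarrow> ('p, 'b) cat \<Rightarrow> ('o, 'a, 'p, 'b) fctr \<Rightarrow> bool" where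
  "is_fctr C D F \<longleftrightarrow>
     (\<forall>x \<in> Obj C. omap F x \<in> Obj D) \<and>
     (\<forall>f \<in> Arr C. amap F f \<in> Hom D (omap F (Dom C f)) (omap F (Cod C f))) \<and>
     (\<forall>x \<in> Obj C. amap F (Idt C x) = Idt D (omap F x)) \<and>
     (\<forall>f \<in> Arr C. \<forall>g \<in> Arr C. Dom C g = Cod C f \<longrightarrow>
        amap F (g \<cdot>\<^bsub>C\<^esub> f) = amap F g \<cdot>\<^bsub>D\<^esub> amap F f)"

definition id_fctr :: "('o, 'a, 'o, 'a) fctr" where
  "id_fctr = \<lparr>omap = id, amap = id\<rparr>"

definition comp_fctr ::
    "('p, 'b, 'q, 'c) fctr \<Rightarrow> ('o, 'a, 'p, 'b) fctr \<Rightarrow> ('o, 'a, 'q, 'c) fctr" where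
  "comp_fctr G F = \<lparr>omap = omap G \<circ> omap F, amap = amap G \<circ> amap F\<rparr>"

definition const_fctr :: "('p, 'b) cat \<Rightarrow> 'p \<Rightarrow> ('o, 'a, 'p, 'b) fctr" where
  "const_fctr D x = \<lparr>omap = (\<lambda>_. x), amap = (\<lambda>_. Idt D x)\<rparr>"

definition nat_trans ::
    "('o, 'a) cat \<Rightarrow> ('p, 'b) cat \<Rightarrow> ('o, 'a, 'p, 'b) fctr \<Rightarrow> ('o, 'a, 'p, 'b) fctr
     \<Rightarrow> ('o \<Rightarrow> 'b) \<Rightarrow> bool" where
  "nat_trans C D F G t \<longleftrightarrow>
     (\<forall>x \<in> Obj C. t x \<in> Hom D (omap F x) (omap G x)) \<and>
     (\<forall>f \<in> Arr C. t (Cod C f) \<cdot>\<^bsub>D\<^esub> amap F f = amap G f \<cdot>\<^bsub>D\<^esub> t (Dom C f))"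

definition nat_isomorphic ::
    "('o, 'a) cat \<Rightarrow> ('p, 'b) cat \<Rightarrow> ('o, 'a, 'p, 'b) fctr \<Rightarrow> ('o, 'a, 'p, 'b) fctr \<Rightarrow> bool" where
  "nat_isomorphic C D F G \<longleftrightarrow> (\<exists>t. nat_trans C D F G t \<and> (\<forall>x \<in> Obj C. iso D (t x)))"

definition equivalence :: "('o, 'a) cat \<Rightarrow> ('p, 'b) cat \<Rightarrow> ('o, 'a, 'p, 'b) fctr \<Rightarrow> bool" where
  "equivalence C D F \<longleftrightarrow> is_fctr C D F \<and>
     (\<exists>G. is_fctr D C G \<and>
          nat_isomorphic C C (comp_fctr G F) id_fctr \<and>
          nat_isomorphic D D (comp_fctr F G) id_fctr)"


section \<open>Limits and colimits; extensive categories; pretopologies\<close>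

definition terminal :: "('o, 'a) cat \<Rightarrow> 'o \<Rightarrow> bool" where
  "terminal C one \<longleftrightarrow> one \<in> Obj C \<and> (\<forall>Z \<in> Obj C. \<exists>!h. h \<in> Hom C Z one)"

definition bang :: "('o, 'a) cat \<Rightarrow> 'o \<Rightarrow> 'o \<Rightarrow> 'a" where
  "bang C one Z = (THE h. h \<in> Hom C Z one)"

definition is_pullback ::
    "('o, 'a) cat \<Rightarrow> 'a \<Rightarrow> 'a \<Rightarrow> 'o \<Rightarrow> 'a \<Rightarrow> 'a \<Rightarrow> bool" where
  "is_pullback C f g P p q \<longleftrightarrow>
     f \<in> Arr C \<and> g \<in> Arr C \<and> Cod C f = Cod C g \<and> P \<in> Obj C \<and>
     p \<in> Hom C P (Dom C f) \<and> q \<in> Hom C P (Dom C g) \<and> f \<cdot>\<^bsub>C\<^esub> p = g \<cdot>\<^bsub>C\<^esub> q \<and>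
     (\<forall>Z \<in> Obj C. \<forall>u \<in> Hom C Z (Dom C f). \<forall>v \<in> Hom C Z (Dom C g).
        f \<cdot>\<^bsub>C\<^esub> u = g \<cdot>\<^bsub>C\<^esub> v \<longrightarrow> (\<exists>!h. h \<in> Hom C Z P \<and> p \<cdot>\<^bsub>C\<^esub> h = u \<and> q \<cdot>\<^bsub>C\<^esub> h = v))"

definition is_coproduct ::
    "('o, 'a) cat \<Rightarrow> 'i set \<Rightarrow> ('i \<Rightarrow> 'o) \<Rightarrow> 'o \<Rightarrow> ('i \<Rightarrow> 'a) \<Rightarrow> bool" where
  "is_coproduct C I A S inc \<longleftrightarrow>
     S \<in> Obj C \<and> (\<forall>i \<in> I. A i \<in> Obj C \<and> inc i \<in> Hom C (A i) S) \<and>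
     (\<forall>Z \<in> Obj C. \<forall>g. (\<forall>i \<in> I. g i \<in> Hom C (A i) Z) \<longrightarrow>
        (\<exists>!h. h \<in> Hom C S Z \<and> (\<forall>i \<in> I. h \<cdot>\<^bsub>C\<^esub> inc i = g i)))"

definition has_finite_coproducts :: "('o, 'a) cat \<Rightarrow> bool" where
  "has_finite_coproducts C \<longleftrightarrow>
     (\<forall>n::nat. \<forall>A. (\<forall>i<n. A i \<in> Obj C) \<longrightarrow> (\<exists>S inc. is_coproduct C {..<n} A S inc))"

text \<open>A choice of binary coproducts, as an object together with its two injections
  (\<open>False\<close> is the left summand).\<close>

definition bin_coprod :: "('o, 'a) cat \<Rightarrow> 'o \<Rightarrow> 'o \<Rightarrow> 'o \<times> (bool \<Rightarrow> 'a)" where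
  "bin_coprod C A B =
     (SOME (S, inc). is_coproduct C UNIV (\<lambda>b. if b then B else A) S inc)"

definition cop :: "('o, 'a) cat \<Rightarrow> 'o \<Rightarrow> 'o \<Rightarrow> 'o" where
  "cop C A B = fst (bin_coprod C A B)"

definition cinl :: "('o, 'a) cat \<Rightarrow> 'o \<Rightarrow> 'o \<Rightarrow> 'a" where
  "cinl C A B = snd (bin_coprod C A B) False"

definition cinr :: "('o, 'a) cat \<Rightarrow> 'o \<Rightarrow> 'o \<Rightarrow> 'a" where
  "cinr C A B = snd (bin_coprod C A B) True"

definition cop_arr :: "('o, 'a) cat \<Rightarrow> 'a \<Rightarrow> 'a \<Rightarrow> 'a" where
  "cop_arr C f g =
     (THE h. h \<in> Hom C (cop C (Dom C f) (Dom C g)) (cop C (Cod C f) (Cod C g)) \<and>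
        h \<cdot>\<^bsub>C\<^esub> cinl C (Dom C f) (Dom C g) = cinl C (Cod C f) (Cod C g) \<cdot>\<^bsub>C\<^esub> f \<and>
        h \<cdot>\<^bsub>C\<^esub> cinr C (Dom C f) (Dom C g) = cinr C (Cod C f) (Cod C g) \<cdot>\<^bsub>C\<^esub> g)"

definition slice_cop ::
    "('o, 'a) cat \<Rightarrow> ('a \<times> 'a, ('a \<times> 'a \<times> 'a) \<times> ('a \<times> 'a \<times> 'a), 'a, 'a \<times> 'a \<times> 'a) fctr" where
  "slice_cop C =
     \<lparr>omap = (\<lambda>(f, g). cop_arr C f g),
      amap = (\<lambda>((f, h, f'), (g, k, g')). (cop_arr C f g, cop_arr C h k, cop_arr C f' g'))\<rparr>"

definition extensive :: "('o, 'a) cat \<Rightarrow> bool" where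
  "extensive C \<longleftrightarrow> has_finite_coproducts C \<and>
     (\<forall>A \<in> Obj C. \<forall>B \<in> Obj C.
        equivalence (prod_cat (slice C A) (slice C B)) (slice C (cop C A B)) (slice_cop C))"

definition singleton_pretopology :: "('o, 'a) cat \<Rightarrow> 'a set \<Rightarrow> bool" where
  "singleton_pretopology C T \<longleftrightarrow>
     T \<subseteq> Arr C \<and>
     (\<forall>f. iso C f \<longrightarrow> f \<in> T) \<and>
     (\<forall>f \<in> T. \<forall>g \<in> T. Dom C g = Cod C f \<longrightarrow> g \<cdot>\<^bsub>C\<^esub> f \<in> T) \<and>
     (\<forall>f \<in> T. \<forall>g \<in> Arr C. Cod C g = Cod C f \<longrightarrow>
        (\<exists>P p q. is_pullback C f g P p q) \<and>
        (\<forall>P p q. is_pullback C f g P p q \<longrightarrow> q \<in> T))"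

locale extensive_site = category C for C :: "('o, 'a) cat"  (structure) +
  fixes T :: "'a set" and one :: 'o
  assumes pretopology: "singleton_pretopology C T"
    and extensive: "extensive C"
    and one_terminal: "terminal C one"
    and to_one_cover: "Z \<in> Obj C \<Longrightarrow> h \<in> Hom C Z one \<Longrightarrow> h \<in> T"
    and cop_arr_cover: "f \<in> Arr C \<Longrightarrow> g \<in> Arr C \<Longrightarrow> cop_arr C f g \<in> T \<longleftrightarrow> f \<in> T \<and> g \<in> T"


section \<open>Presheaves\<close>

record ('o, 'a, 'e) psh =
  elts :: "'o \<Rightarrow> 'e set"
  restr :: "'a \<Rightarrow> 'e \<Rightarrow> 'e"

definition yo :: "('o, 'a) cat \<Rightarrow> 'o \<Rightarrow> ('o, 'a, 'a) psh" where
  "yo C x = \<lparr>elts = (\<lambda>Z. Hom C Z x), restr = (\<lambda>h g. g \<cdot>\<^bsub>C\<^esub> h)\<rparr>"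

text \<open>Maps of presheaves are taken extensional, so that equality of maps is equality of HOL
  functions.\<close>

definition psh_maps ::
    "('o, 'a) cat \<Rightarrow> ('o, 'a, 'd) psh \<Rightarrow> ('o, 'a, 'e) psh \<Rightarrow> ('o \<Rightarrow> 'd \<Rightarrow> 'e) set" where
  "psh_maps C F G =
     {t \<in> (\<Pi>\<^sub>E x \<in> Obj C. elts F x \<rightarrow>\<^sub>E elts G x).
        \<forall>h \<in> Arr C. \<forall>s \<in> elts F (Cod C h).
          t (Dom C h) (restr F h s) = restr G h (t (Cod C h) s)}"

definition represents ::
    "('o, 'a) cat \<Rightarrow> ('o, 'a, 'e) psh \<Rightarrow> 'o \<Rightarrow> ('o \<Rightarrow> 'a \<Rightarrow> 'e) \<Rightarrow> bool" where
  "represents C F V e \<longleftrightarrow> V \<in> Obj C \<and> e \<in> psh_maps C (yo C V) F \<and>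
     (\<forall>Z \<in> Obj C. bij_betw (e Z) (Hom C Z V) (elts F Z))"


section \<open>The simplex category and simplicial objects\<close>

text \<open>Finite ordinals are indexed by their cardinality: the object \<open>n\<close> of \<open>Delta_plus\<close> is
  \<open>{..<n}\<close>, i.e. the ordinal usually written \<open>[n - 1]\<close>, and \<open>0\<close> is the empty ordinal.
  Hence the degree \<open>n\<close> part of a simplicial object \<open>X\<close> is \<open>omap X (Suc n)\<close>.
  An arrow from \<open>m\<close> to \<open>n\<close> is a triple \<open>(m, n, \<phi>)\<close> with \<open>\<phi>\<close> weakly monotone.\<close>

type_synonym darr = "nat \<times> nat \<times> (nat \<Rightarrow> nat)"

definition Delta_plus :: "(nat, darr) cat" where
  "Delta_plus =
     \<lparr>Obj = UNIV,
      Arr = {(m, n, \<phi>). \<phi> \<in> {..<m} \<rightarrow>\<^sub>E {..<n} \<and> mono_on {..<m} \<phi>},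
      Dom = (\<lambda>(m, n, \<phi>). m), Cod = (\<lambda>(m, n, \<phi>). n),
      Idt = (\<lambda>n. (n, n, \<lambda>x\<in>{..<n}. x)),
      Cmp = (\<lambda>(_, p, \<psi>) (m, _, \<phi>). (m, p, compose {..<m} \<psi> \<phi>))\<rparr>"

definition Delta :: "(nat, darr) cat" where
  "Delta = full_subcat Delta_plus {n. 0 < n}"

text \<open>The ordinal sum on arrows; on objects it is addition of cardinalities,
  \<open>[i] \<star> [j] = [i + j + 1]\<close>.\<close>

fun join :: "darr \<Rightarrow> darr \<Rightarrow> darr" where
  "join (a', a, \<alpha>) (b', b, \<beta>) =
     (a' + b', a + b, \<lambda>x\<in>{..<a' + b'}. if x < a' then \<alpha> x else a + \<beta> (x - a'))"

definition front :: "nat \<Rightarrow> nat \<Rightarrow> darr" where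
  "front a b = (a, a + b, \<lambda>x\<in>{..<a}. x)"

text \<open>Simplicial sets are presheaves on \<open>Delta\<close>; simplicial objects are functors out of its
  opposite, so for \<open>\<theta>\<close> from \<open>m\<close> to \<open>n\<close> the arrow \<open>amap X \<theta>\<close> goes from \<open>omap X n\<close> to
  \<open>omap X m\<close>.\<close>

type_synonym 's sset = "(nat, darr, 's) psh"
type_synonym ('o, 'a) sobj = "(nat, darr, 'o, 'a) fctr"

definition simplicial_object :: "('o, 'a) cat \<Rightarrow> ('o, 'a) sobj \<Rightarrow> bool" where
  "simplicial_object C X \<longleftrightarrow> is_fctr (op_cat Delta) C X"

definition simplicial_map ::
    "('o, 'a) cat \<Rightarrow> ('o, 'a) sobj \<Rightarrow> ('o, 'a) sobj \<Rightarrow> (nat \<Rightarrow> 'a) \<Rightarrow> bool" where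
  "simplicial_map C X Y f \<longleftrightarrow> nat_trans (op_cat Delta) C X Y f"

definition simplex :: "nat \<Rightarrow> darr sset" where
  "simplex m = yo Delta (Suc m)"

definition verts :: "darr \<Rightarrow> nat set" where
  "verts = (\<lambda>(n, _, \<phi>). \<phi> ` {..<n})"

definition bdry :: "nat \<Rightarrow> darr sset" where
  "bdry m = (simplex m)\<lparr>elts := (\<lambda>n. {s \<in> elts (simplex m) n. verts s \<noteq> {..m}})\<rparr>"

text \<open>The horn is the union of all facets except the one opposite to the vertex \<open>k\<close>.\<close>

definition horn :: "nat \<Rightarrow> nat \<Rightarrow> darr sset" where
  "horn m k = (simplex m)\<lparr>elts := (\<lambda>n. {s \<in> elts (simplex m) n. insert k (verts s) \<noteq> {..m}})\<rparr>"

definition sincl :: "'s sset \<Rightarrow> nat \<Rightarrow> 's \<Rightarrow> 's" where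
  "sincl R = (\<lambda>n\<in>Obj Delta. \<lambda>s\<in>elts R n. s)"


section \<open>Kan conditions\<close>

definition hom_sset :: "('o, 'a) cat \<Rightarrow> 'o \<Rightarrow> ('o, 'a) sobj \<Rightarrow> 'a sset" where
  "hom_sset C Z X =
     \<lparr>elts = (\<lambda>n. Hom C Z (omap X n)), restr = (\<lambda>\<theta> g. amap X \<theta> \<cdot>\<^bsub>C\<^esub> g)\<rparr>"

definition Hom_psh ::
    "('o, 'a) cat \<Rightarrow> 's sset \<Rightarrow> ('o, 'a) sobj \<Rightarrow> ('o, 'a, nat \<Rightarrow> 's \<Rightarrow> 'a) psh" where
  "Hom_psh C S X =
     \<lparr>elts = (\<lambda>Z. psh_maps Delta S (hom_sset C Z X)),
      restr = (\<lambda>h \<sigma>. \<lambda>n\<in>Obj Delta. \<lambda>s\<in>elts S n. \<sigma> n s \<cdot>\<^bsub>C\<^esub> h)\<rparr>"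

text \<open>The fibre product of \<open>Hom_psh C R X\<close> and \<open>Hom_psh C S Y\<close> over \<open>Hom_psh C R Y\<close>, for
  maps \<open>i\<close> from \<open>R\<close> to \<open>S\<close> and \<open>f\<close> from \<open>X\<close> to \<open>Y\<close>; the equation says that the two
  images in \<open>Hom_psh C R Y\<close> agree.\<close>

definition Hom_rel ::
    "('o, 'a) cat \<Rightarrow> 'r sset \<Rightarrow> 's sset \<Rightarrow> (nat \<Rightarrow> 'r \<Rightarrow> 's) \<Rightarrow>
     ('o, 'a) sobj \<Rightarrow> ('o, 'a) sobj \<Rightarrow> (nat \<Rightarrow> 'a) \<Rightarrow>
     ('o, 'a, (nat \<Rightarrow> 'r \<Rightarrow> 'a) \<times> (nat \<Rightarrow> 's \<Rightarrow> 'a)) psh" where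
  "Hom_rel C R S i X Y f =
     \<lparr>elts = (\<lambda>Z. {(\<rho>, \<sigma>). \<rho> \<in> elts (Hom_psh C R X) Z \<and> \<sigma> \<in> elts (Hom_psh C S Y) Z \<and>
                 (\<forall>n \<in> Obj Delta. \<forall>r \<in> elts R n. f n \<cdot>\<^bsub>C\<^esub> \<rho> n r = \<sigma> n (i n r))}),
      restr = (\<lambda>h (\<rho>, \<sigma>). (restr (Hom_psh C R X) h \<rho>, restr (Hom_psh C S Y) h \<sigma>))\<rparr>"

text \<open>The natural map from \<open>X\<^sub>m\<close> (the object \<open>Hom(\<Delta>\<^sup>m, X)\<close>), on the generalized point \<open>g\<close>
  of \<open>X\<^sub>m\<close>.\<close>

definition rel_point ::
    "('o, 'a) cat \<Rightarrow> darr sset \<Rightarrow> nat \<Rightarrow> ('o, 'a) sobj \<Rightarrow> ('o, 'a) sobj \<Rightarrow> (nat \<Rightarrow> 'a) \<Rightarrow>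
     'a \<Rightarrow> (nat \<Rightarrow> darr \<Rightarrow> 'a) \<times> (nat \<Rightarrow> darr \<Rightarrow> 'a)" where
  "rel_point C R m X Y f g =
     (\<lambda>n\<in>Obj Delta. \<lambda>r\<in>elts R n. amap X r \<cdot>\<^bsub>C\<^esub> g,
      \<lambda>n\<in>Obj Delta. \<lambda>s\<in>elts (simplex m) n. amap Y s \<cdot>\<^bsub>C\<^esub> (f (Suc m) \<cdot>\<^bsub>C\<^esub> g))"

text \<open>For a subcomplex \<open>R\<close> of \<open>\<Delta>\<^sup>m\<close>: \<open>Hom(R \<rightarrow> \<Delta>\<^sup>m, X \<rightarrow> Y)\<close> is representable and the arrow
  \<open>c\<close> inducing the natural map from \<open>X\<^sub>m\<close> to the representing object has property \<open>P\<close>.\<close>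

definition rel_cond ::
    "('o, 'a) cat \<Rightarrow> ('a \<Rightarrow> bool) \<Rightarrow> darr sset \<Rightarrow> nat \<Rightarrow>
     ('o, 'a) sobj \<Rightarrow> ('o, 'a) sobj \<Rightarrow> (nat \<Rightarrow> 'a) \<Rightarrow> bool" where
  "rel_cond C P R m X Y f \<longleftrightarrow>
     (\<exists>V e. represents C (Hom_rel C R (simplex m) (sincl R) X Y f) V e \<and>
        (\<exists>c \<in> Hom C (omap X (Suc m)) V. P c \<and>
           (\<forall>Z \<in> Obj C. \<forall>g \<in> Hom C Z (omap X (Suc m)).
              e Z (c \<cdot>\<^bsub>C\<^esub> g) = rel_point C R m X Y f g)))"

definition Kan ::
    "('o, 'a) cat \<Rightarrow> 'a set \<Rightarrow> ('o, 'a) sobj \<Rightarrow> ('o, 'a) sobj \<Rightarrow> (nat \<Rightarrow> 'a) \<Rightarrow>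
     nat \<Rightarrow> nat \<Rightarrow> bool" where
  "Kan C T X Y f m k \<longleftrightarrow> rel_cond C (\<lambda>c. c \<in> T) (horn m k) m X Y f"

definition strict_Kan ::
    "('o, 'a) cat \<Rightarrow> ('o, 'a) sobj \<Rightarrow> ('o, 'a) sobj \<Rightarrow> (nat \<Rightarrow> 'a) \<Rightarrow>
     nat \<Rightarrow> nat \<Rightarrow> bool" where
  "strict_Kan C X Y f m k \<longleftrightarrow> rel_cond C (iso C) (horn m k) m X Y f"

definition Kan_fibration ::
    "('o, 'a) cat \<Rightarrow> 'a set \<Rightarrow> ('o, 'a) sobj \<Rightarrow> ('o, 'a) sobj \<Rightarrow> (nat \<Rightarrow> 'a) \<Rightarrow> bool" where
  "Kan_fibration C T X Y f \<longleftrightarrow>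
     simplicial_map C X Y f \<and> (\<forall>m k. 1 \<le> m \<and> k \<le> m \<longrightarrow> Kan C T X Y f m k)"

definition acyclic_fibration ::
    "('o, 'a) cat \<Rightarrow> 'a set \<Rightarrow> ('o, 'a) sobj \<Rightarrow> ('o, 'a) sobj \<Rightarrow> (nat \<Rightarrow> 'a) \<Rightarrow> bool" where
  "acyclic_fibration C T X Y f \<longleftrightarrow>
     simplicial_map C X Y f \<and> (\<forall>m. rel_cond C (\<lambda>c. c \<in> T) (bdry m) m X Y f)"

definition n_groupoid ::
    "('o, 'a) cat \<Rightarrow> 'a set \<Rightarrow> 'o \<Rightarrow> enat \<Rightarrow> ('o, 'a) sobj \<Rightarrow> bool" where
  "n_groupoid C T one n X \<longleftrightarrow>
     simplicial_object C X \<and>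
     Kan_fibration C T X (const_fctr C one) (\<lambda>p. bang C one (omap X p)) \<and>
     (\<forall>m k. n < enat m \<and> k \<le> m \<longrightarrow>
        strict_Kan C X (const_fctr C one) (\<lambda>p. bang C one (omap X p)) m k)"

definition higher_groupoid ::
    "('o, 'a) cat \<Rightarrow> 'a set \<Rightarrow> 'o \<Rightarrow> ('o, 'a) sobj \<Rightarrow> bool" where
  "higher_groupoid C T one X \<longleftrightarrow> (\<exists>n. n_groupoid C T one n X)"


section \<open>Augmented bisimplicial objects, total objects, cographs\<close>

text \<open>The objects below are determined by universal properties only up to unique isomorphism;
  the predicates allow any choice of the coproducts and pullbacks involved.\<close>

type_synonym ('o, 'a) bisobj = "(nat \<times> nat, darr \<times> darr, 'o, 'a) fctr"

definition aug_bisimplicial_object :: "('o, 'a) cat \<Rightarrow> ('o, 'a) bisobj \<Rightarrow> bool" where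
  "aug_bisimplicial_object C \<Gamma> \<longleftrightarrow>
     is_fctr (prod_cat (op_cat Delta_plus) (op_cat Delta_plus)) C \<Gamma>"

definition is_j ::
    "('o, 'a) cat \<Rightarrow> 'o \<Rightarrow> 's sset \<Rightarrow> ('o, 'a) sobj \<Rightarrow> (nat \<Rightarrow> 's \<Rightarrow> 'a) \<Rightarrow> bool" where
  "is_j C one S J \<iota> \<longleftrightarrow>
     simplicial_object C J \<and>
     (\<forall>n \<in> Obj Delta. is_coproduct C (elts S n) (\<lambda>_. one) (omap J n) (\<iota> n)) \<and>
     (\<forall>\<theta> \<in> Arr Delta. \<forall>s \<in> elts S (Cod Delta \<theta>).
        amap J \<theta> \<cdot>\<^bsub>C\<^esub> \<iota> (Cod Delta \<theta>) s = \<iota> (Dom Delta \<theta>) (restr S \<theta> s))"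

text \<open>Every arrow of \<open>Delta\<close> into \<open>a + b\<close> is \<open>join \<alpha> \<beta>\<close> for unique \<open>\<alpha>\<close> into \<open>a\<close> and
  \<open>\<beta>\<close> into \<open>b\<close>, so the last condition determines the structure maps of the total object.\<close>

definition is_total ::
    "('o, 'a) cat \<Rightarrow> ('o, 'a) bisobj \<Rightarrow> ('o, 'a) sobj \<Rightarrow> (nat \<times> nat \<Rightarrow> 'a) \<Rightarrow> bool" where
  "is_total C \<Gamma> W inc \<longleftrightarrow>
     aug_bisimplicial_object C \<Gamma> \<and> terminal C (omap \<Gamma> (0, 0)) \<and>
     simplicial_object C W \<and>
     (\<forall>n \<in> Obj Delta. is_coproduct C {(a, b). a + b = n} (omap \<Gamma>) (omap W n) inc) \<and>
     (\<forall>\<alpha> \<in> Arr Delta_plus. \<forall>\<beta> \<in> Arr Delta_plus. join \<alpha> \<beta> \<in> Arr Delta \<longrightarrow>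
        amap W (join \<alpha> \<beta>) \<cdot>\<^bsub>C\<^esub> inc (Cod Delta_plus \<alpha>, Cod Delta_plus \<beta>) =
        inc (Dom Delta_plus \<alpha>, Dom Delta_plus \<beta>) \<cdot>\<^bsub>C\<^esub> amap \<Gamma> (\<alpha>, \<beta>))"

text \<open>The simplex of \<open>\<Delta>\<^sup>1\<close> with \<open>a\<close> vertices \<open>0\<close> followed by \<open>b\<close> vertices \<open>1\<close>.\<close>

definition cut :: "nat \<Rightarrow> nat \<Rightarrow> darr" where
  "cut a b = (a + b, 2, \<lambda>x\<in>{..<a + b}. if x < a then 0 else 1)"

definition is_total_proj ::
    "('o, 'a) cat \<Rightarrow> 'o \<Rightarrow> ('o, 'a) bisobj \<Rightarrow> ('o, 'a) sobj \<Rightarrow> (nat \<times> nat \<Rightarrow> 'a) \<Rightarrow>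
     ('o, 'a) sobj \<Rightarrow> (nat \<Rightarrow> darr \<Rightarrow> 'a) \<Rightarrow> (nat \<Rightarrow> 'a) \<Rightarrow> bool" where
  "is_total_proj C one \<Gamma> W inc J \<iota> \<pi> \<longleftrightarrow>
     simplicial_map C W J \<pi> \<and>
     (\<forall>a b. 0 < a + b \<longrightarrow>
        \<pi> (a + b) \<cdot>\<^bsub>C\<^esub> inc (a, b) = \<iota> (a + b) (cut a b) \<cdot>\<^bsub>C\<^esub> bang C one (omap \<Gamma> (a, b)))"

definition augment :: "('o, 'a) cat \<Rightarrow> 'o \<Rightarrow> ('o, 'a) sobj \<Rightarrow> ('o, 'a) sobj" where
  "augment C one X =
     (let obj = (\<lambda>n. if n = 0 then one else omap X n) in
      \<lparr>omap = obj,
       amap = (\<lambda>\<theta>. if Dom Delta_plus \<theta> = 0 then bang C one (obj (Cod Delta_plus \<theta>))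
                   else amap X \<theta>)\<rparr>)"

definition augment_map :: "('o, 'a) cat \<Rightarrow> 'o \<Rightarrow> (nat \<Rightarrow> 'a) \<Rightarrow> nat \<Rightarrow> 'a" where
  "augment_map C one f n = (if n = 0 then Idt C one else f n)"

definition is_cograph ::
    "('o, 'a) cat \<Rightarrow> 'o \<Rightarrow> ('o, 'a) sobj \<Rightarrow> ('o, 'a) sobj \<Rightarrow> (nat \<Rightarrow> 'a) \<Rightarrow>
     ('o, 'a) bisobj \<Rightarrow> bool" where
  "is_cograph C one X Y f \<Gamma> \<longleftrightarrow>
     aug_bisimplicial_object C \<Gamma> \<and>
     (\<exists>p q.
        (\<forall>a b. is_pullback C (augment_map C one f a) (amap (augment C one Y) (front a b))
                 (omap \<Gamma> (a, b)) (p a b) (q a b)) \<and>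
        (\<forall>\<alpha> \<in> Arr Delta_plus. \<forall>\<beta> \<in> Arr Delta_plus.
           let a' = Dom Delta_plus \<alpha>; a = Cod Delta_plus \<alpha>;
               b' = Dom Delta_plus \<beta>; b = Cod Delta_plus \<beta> in
           p a' b' \<cdot>\<^bsub>C\<^esub> amap \<Gamma> (\<alpha>, \<beta>) = amap (augment C one X) \<alpha> \<cdot>\<^bsub>C\<^esub> p a b \<and>
           q a' b' \<cdot>\<^bsub>C\<^esub> amap \<Gamma> (\<alpha>, \<beta>) = amap (augment C one Y) (join \<alpha> \<beta>) \<cdot>\<^bsub>C\<^esub> q a b))"

end

theory Submission
  imports Defs
begin

text \<open>
  Let \<open>L\<close> be a horn of \<open>\<Delta>\<^sup>m\<close>. A simplex of \<open>\<Delta>\<^sup>1\<close> on \<open>m + 1\<close> vertices has \<open>a\<close> vertices 0 followed by \<open>b\<close>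
  vertices 1, where \<open>a + b = m + 1\<close>, so a point of the degree \<open>m\<close> part of \<open>j(\<Delta>\<^sup>1)\<close> cuts its source into
  finitely many pieces, on each of which it is one such simplex. By extensivity the filling problem
  for \<open>T\<Gamma> \<rightarrow> j(\<Delta>\<^sup>1)\<close> and \<open>L\<close> is therefore the coproduct of its fibres over these simplices, and it is
  enough to treat the fibres (\<open>cover_map_glue\<close>).

  Fix \<open>a\<close> and \<open>b\<close> and let \<open>\<Delta>\<^sup>A\<close> be the face on the first \<open>a\<close> vertices. Because \<open>\<Gamma>\<close> in bidegree \<open>(i, j)\<close> is
  the pullback over \<open>Y\<^sub>i\<close> of \<open>X\<^sub>i\<close> and \<open>Y\<close> in degree \<open>i + j + 1\<close>, a map from a subcomplex \<open>K\<close> to \<open>T\<Gamma>\<close> over this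
  simplex is a pair of maps \<open>K \<inter> \<Delta>\<^sup>A \<rightarrow> X\<close> and \<open>K \<rightarrow> Y\<close> that agree where both are defined
  (\<open>to_Pairs_nat_bij\<close>). The filling problem has become
  \<open>Hom(\<Delta>\<^sup>A \<rightarrow> \<Delta>\<^sup>m, X \<rightarrow> Y) \<rightarrow> Hom(L \<inter> \<Delta>\<^sup>A \<rightarrow> L, X \<rightarrow> Y)\<close>, with source represented by \<open>\<Gamma>\<close> itself.
  This map factors through \<open>Hom(L \<inter> \<Delta>\<^sup>A \<rightarrow> \<Delta>\<^sup>m, X \<rightarrow> Y)\<close>. The first factor is a composite of pullbacks
  of \<open>X\<^sub>n \<rightarrow> Hom(\<partial>\<Delta>\<^sup>n \<rightarrow> \<Delta>\<^sup>n, X \<rightarrow> Y)\<close>, one for every face of \<open>\<Delta>\<^sup>A\<close> missing from \<open>L\<close>, and these are covers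
  since \<open>f\<close> is acyclic (\<open>attach_subcomplex\<close>); the second is a pullback of \<open>Y\<^sub>m \<rightarrow> Hom(L, Y)\<close>, a cover since
  \<open>Y\<close> is Kan (\<open>relative_horn_cover\<close>). Attaching the faces of \<open>L \<inter> \<Delta>\<^sup>A\<close> to the empty complex in the same
  way shows that the target is representable.

  Representability and being a cover are carried along together: \<open>cover_map\<close> says of a natural map of
  presheaves that both sides are representable and that the induced arrow is a cover. This notion is
  closed under composition and pullback, and the horn and boundary conditions for covers are instances
  of it (\<open>rel_cond_iff_cover_map\<close>).
\<close>

section \<open>Universal elements of presheaves and representable covers\<close>

lemma psh_maps_natural:
  assumes "t \<in> psh_maps C F G" "h \<in> Arr C" "s \<in> elts F (Cod C h)"
  shows "t (Dom C h) (restr F h s) = restr G h (t (Cod C h) s)"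
proof -
  have "\<forall>h \<in> Arr C. \<forall>s \<in> elts F (Cod C h). t (Dom C h) (restr F h s) = restr G h (t (Cod C h) s)"
    using assms(1) unfolding psh_maps_def by (elim CollectE conjE)
  thus ?thesis using assms(2,3) by simp
qed

lemma psh_maps_PiE: "t \<in> psh_maps C F G \<Longrightarrow> t \<in> (\<Pi>\<^sub>E x \<in> Obj C. elts F x \<rightarrow>\<^sub>E elts G x)"
  unfolding psh_maps_def by (elim CollectE conjE)

context category begin

lemma HomD:
  assumes "f \<in> Hom C x y"
  shows "f \<in> Arr C" "Dom C f = x" "Cod C f = y" "x \<in> Obj C" "y \<in> Obj C"
  using assms Dom_in Cod_in by (auto simp: Hom_def)

lemma Hom_ArrI: "f \<in> Arr C \<Longrightarrow> f \<in> Hom C (Dom C f) (Cod C f)"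
  by (simp add: Hom_def)

lemma isoI:
  assumes "f \<in> Hom C x y" "g \<in> Hom C y x" "g \<cdot> f = Idt C x" "f \<cdot> g = Idt C y"
  shows "iso C f"
  using assms unfolding iso_def Hom_def by auto

lemma isoE:
  assumes "iso C f" "f \<in> Hom C x y"
  obtains g where "g \<in> Hom C y x" "g \<cdot> f = Idt C x" "f \<cdot> g = Idt C y"
  using assms unfolding iso_def Hom_def by auto

lemma iso_Idt: "x \<in> Obj C \<Longrightarrow> iso C (Idt C x)"
  by (rule isoI[where g="Idt C x"]) (auto intro: Idt_in Idt_Cmp)

lemma pullback_arrow_eqI:
  assumes pb: "is_pullback C f g P p q" and "h \<in> Hom C Z P" "h' \<in> Hom C Z P"
    and "p \<cdot> h = p \<cdot> h'" "q \<cdot> h = q \<cdot> h'"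
  shows "h = h'"
proof -
  have p: "p \<in> Hom C P (Dom C f)" and q: "q \<in> Hom C P (Dom C g)"
    and f: "f \<in> Hom C (Dom C f) (Cod C f)" and g: "g \<in> Hom C (Dom C g) (Cod C f)"
    and sq: "f \<cdot> p = g \<cdot> q"
    using pb unfolding is_pullback_def Hom_def by auto
  have Z: "Z \<in> Obj C" using assms(2) HomD by blast
  have ph: "p \<cdot> h' \<in> Hom C Z (Dom C f)" and qh: "q \<cdot> h' \<in> Hom C Z (Dom C g)"
    using p q assms(3) Cmp_in by blast+
  have "f \<cdot> (p \<cdot> h') = g \<cdot> (q \<cdot> h')"
    using sq Cmp_assoc[OF assms(3) p f] Cmp_assoc[OF assms(3) q g] by simp
  with pb ph qh Z have "\<exists>!k. k \<in> Hom C Z P \<and> p \<cdot> k = p \<cdot> h' \<and> q \<cdot> k = q \<cdot> h'"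
    unfolding is_pullback_def by blast
  thus ?thesis using assms by blast
qed

lemma pullback_arrow_ex:
  assumes pb: "is_pullback C f g P p q" and "u \<in> Hom C Z (Dom C f)" "v \<in> Hom C Z (Dom C g)"
    and "f \<cdot> u = g \<cdot> v"
  obtains h where "h \<in> Hom C Z P" "p \<cdot> h = u" "q \<cdot> h = v"
proof -
  have "Z \<in> Obj C" using assms(2) HomD by blast
  thus ?thesis using assms that unfolding is_pullback_def by blast
qed

definition presheaf :: "('o, 'a, 'e) psh \<Rightarrow> bool" where
  "presheaf F \<longleftrightarrow>
     (\<forall>Z Z' h x. h \<in> Hom C Z' Z \<longrightarrow> x \<in> elts F Z \<longrightarrow> restr F h x \<in> elts F Z') \<and>
     (\<forall>Z Z' Z'' h k x. h \<in> Hom C Z' Z \<longrightarrow> k \<in> Hom C Z'' Z' \<longrightarrow> x \<in> elts F Z \<longrightarrow>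
        restr F (h \<cdot> k) x = restr F k (restr F h x)) \<and>
     (\<forall>Z \<in> Obj C. \<forall>x \<in> elts F Z. restr F (Idt C Z) x = x)"

lemma presheafI:
  assumes "\<And>Z Z' h x. h \<in> Hom C Z' Z \<Longrightarrow> x \<in> elts F Z \<Longrightarrow> restr F h x \<in> elts F Z'"
    and "\<And>Z Z' Z'' h k x. h \<in> Hom C Z' Z \<Longrightarrow> k \<in> Hom C Z'' Z' \<Longrightarrow> x \<in> elts F Z \<Longrightarrow>
        restr F (h \<cdot> k) x = restr F k (restr F h x)"
    and "\<And>Z x. Z \<in> Obj C \<Longrightarrow> x \<in> elts F Z \<Longrightarrow> restr F (Idt C Z) x = x"
  shows "presheaf F"
  using assms unfolding presheaf_def by blast

lemma presheafD:
  assumes "presheaf F"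
  shows "h \<in> Hom C Z' Z \<Longrightarrow> x \<in> elts F Z \<Longrightarrow> restr F h x \<in> elts F Z'"
    and "h \<in> Hom C Z' Z \<Longrightarrow> k \<in> Hom C Z'' Z' \<Longrightarrow> x \<in> elts F Z \<Longrightarrow>
        restr F (h \<cdot> k) x = restr F k (restr F h x)"
    and "Z \<in> Obj C \<Longrightarrow> x \<in> elts F Z \<Longrightarrow> restr F (Idt C Z) x = x"
  using assms unfolding presheaf_def by blast+

definition natural ::
    "('o, 'a, 'd) psh \<Rightarrow> ('o, 'a, 'e) psh \<Rightarrow> ('o \<Rightarrow> 'd \<Rightarrow> 'e) \<Rightarrow> bool" where
  "natural F G t \<longleftrightarrow>
     (\<forall>Z \<in> Obj C. \<forall>x \<in> elts F Z. t Z x \<in> elts G Z) \<and>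
     (\<forall>Z Z' h x. h \<in> Hom C Z' Z \<longrightarrow> x \<in> elts F Z \<longrightarrow>
        t Z' (restr F h x) = restr G h (t Z x))"

lemma naturalI:
  assumes "\<And>Z x. Z \<in> Obj C \<Longrightarrow> x \<in> elts F Z \<Longrightarrow> t Z x \<in> elts G Z"
    and "\<And>Z Z' h x. h \<in> Hom C Z' Z \<Longrightarrow> x \<in> elts F Z \<Longrightarrow>
        t Z' (restr F h x) = restr G h (t Z x)"
  shows "natural F G t"
  using assms unfolding natural_def by blast

lemma naturalD:
  assumes "natural F G t"
  shows "Z \<in> Obj C \<Longrightarrow> x \<in> elts F Z \<Longrightarrow> t Z x \<in> elts G Z"
    and "h \<in> Hom C Z' Z \<Longrightarrow> x \<in> elts F Z \<Longrightarrow> t Z' (restr F h x) = restr G h (t Z x)"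
  using assms unfolding natural_def by blast+

text \<open>By Yoneda a universal element carries the same information as a representing natural
  isomorphism; elements are easier to restrict and to glue than isomorphisms.\<close>

definition universal :: "('o, 'a, 'e) psh \<Rightarrow> 'o \<Rightarrow> 'e \<Rightarrow> bool" where
  "universal F V v \<longleftrightarrow> V \<in> Obj C \<and> v \<in> elts F V \<and>
     (\<forall>Z \<in> Obj C. \<forall>x \<in> elts F Z. \<exists>!h. h \<in> Hom C Z V \<and> restr F h v = x)"

definition representable :: "('o, 'a, 'e) psh \<Rightarrow> bool" where
  "representable F \<longleftrightarrow> (\<exists>V v. universal F V v)"

lemma universalD:
  assumes "universal F V v"
  shows "V \<in> Obj C" "v \<in> elts F V"
    and "Z \<in> Obj C \<Longrightarrow> x \<in> elts F Z \<Longrightarrow> \<exists>h. h \<in> Hom C Z V \<and> restr F h v = x"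
  using assms unfolding universal_def by blast+

lemma universal_eqI:
  assumes "universal F V v" "presheaf F" "h \<in> Hom C Z V" "k \<in> Hom C Z V"
    "restr F h v = restr F k v"
  shows "h = k"
proof -
  have "Z \<in> Obj C" using assms HomD by blast
  moreover have "restr F k v \<in> elts F Z" 
    using presheafD(1)[OF assms(2,4) universalD(2)[OF assms(1)]] .
  ultimately show ?thesis using assms unfolding universal_def by metis
qed

lemma represents_universal:
  assumes "represents C F V e"
  shows "universal F V (e V (Idt C V))"
    and "h \<in> Hom C Z V \<Longrightarrow> e Z h = restr F h (e V (Idt C V))"
proof -
  have V: "V \<in> Obj C" and e: "e \<in> psh_maps C (yo C V) F"
    and bij: "\<And>Z. Z \<in> Obj C \<Longrightarrow> bij_betw (e Z) (Hom C Z V) (elts F Z)"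
    using assms unfolding represents_def by auto
  have val: "e Z h = restr F h (e V (Idt C V))" if "h \<in> Hom C Z V" for Z h
  proof -
    have "e (Dom C h) (restr (yo C V) h (Idt C V)) = restr F h (e (Cod C h) (Idt C V))"
    proof -
      have "Idt C V \<in> elts (yo C V) (Cod C h)"
        using Idt_in[OF V] HomD[OF that] by (simp add: yo_def)
      thus ?thesis by (rule psh_maps_natural[OF e HomD(1)[OF that]])
    qed
    thus ?thesis using that HomD[OF that] by (simp add: yo_def Idt_Cmp)
  qed
  show "e Z h = restr F h (e V (Idt C V))" if "h \<in> Hom C Z V"
    using val that by blast
  show "universal F V (e V (Idt C V))"
    unfolding universal_def
  proof (intro conjI ballI V)
    show "e V (Idt C V) \<in> elts F V"
      using bij_betw_apply[OF bij[OF V] Idt_in[OF V]] .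
    fix Z x assume Z: "Z \<in> Obj C" and x: "x \<in> elts F Z"
    have "x \<in> e Z ` Hom C Z V" using x bij_betw_imp_surj_on[OF bij[OF Z]] by simp
    then obtain h where h: "h \<in> Hom C Z V" "e Z h = x" by (elim imageE) simp
    show "\<exists>!h. h \<in> Hom C Z V \<and> restr F h (e V (Idt C V)) = x"
    proof (rule ex1I[of _ h])
      show "h \<in> Hom C Z V \<and> restr F h (e V (Idt C V)) = x" using h val[OF h(1)] by simp
      fix k assume k: "k \<in> Hom C Z V \<and> restr F k (e V (Idt C V)) = x"
      hence "e Z k = e Z h" using val h by simp
      thus "k = h" using inj_onD[OF bij_betw_imp_inj_on[OF bij[OF Z]]] k h by simp
    qed
  qed
qed

lemma universal_represents:
  assumes F: "presheaf F" and u: "universal F V v"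
  shows "represents C F V (\<lambda>Z\<in>Obj C. \<lambda>h\<in>Hom C Z V. restr F h v)"
  unfolding represents_def
proof (intro conjI ballI)
  have V: "V \<in> Obj C" and v: "v \<in> elts F V" using universalD[OF u] by blast+
  show "V \<in> Obj C" by (rule V)
  show "(\<lambda>Z\<in>Obj C. \<lambda>h\<in>Hom C Z V. restr F h v) \<in> psh_maps C (yo C V) F"
    unfolding psh_maps_def
  proof (intro CollectI conjI ballI)
    show "(\<lambda>Z\<in>Obj C. \<lambda>h\<in>Hom C Z V. restr F h v) \<in> (\<Pi>\<^sub>E x\<in>Obj C. elts (yo C V) x \<rightarrow>\<^sub>E elts F x)"
      using presheafD(1)[OF F] v by (auto simp: yo_def)
    fix h s assume h: "h \<in> Arr C" and s: "s \<in> elts (yo C V) (Cod C h)"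
    have hh: "h \<in> Hom C (Dom C h) (Cod C h)" using h by (rule Hom_ArrI)
    have ss: "s \<in> Hom C (Cod C h) V" using s by (simp add: yo_def)
    show "(\<lambda>Z\<in>Obj C. \<lambda>h\<in>Hom C Z V. restr F h v) (Dom C h) (restr (yo C V) h s) =
        restr F h ((\<lambda>Z\<in>Obj C. \<lambda>h\<in>Hom C Z V. restr F h v) (Cod C h) s)"
      using HomD[OF hh] ss Cmp_in[OF hh ss] presheafD(2)[OF F ss hh v] by (simp add: yo_def)
  qed
  fix Z assume Z: "Z \<in> Obj C"
  show "bij_betw ((\<lambda>Z\<in>Obj C. \<lambda>h\<in>Hom C Z V. restr F h v) Z) (Hom C Z V) (elts F Z)"
    unfolding bij_betw_def
  proof
    show "inj_on ((\<lambda>Z\<in>Obj C. \<lambda>h\<in>Hom C Z V. restr F h v) Z) (Hom C Z V)"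
      using Z universal_eqI[OF u F] by (auto simp: inj_on_def)
    show "(\<lambda>Z\<in>Obj C. \<lambda>h\<in>Hom C Z V. restr F h v) Z ` Hom C Z V = elts F Z"
      using Z presheafD(1)[OF F _ v] universalD(3)[OF u Z] by (auto simp: image_iff) metis+
  qed
qed

lemma yo_presheaf: "presheaf (yo C A)"
  by (rule presheafI) (auto simp: yo_def Cmp_in Cmp_assoc Cmp_Idt)

lemma yo_universal: "A \<in> Obj C \<Longrightarrow> universal (yo C A) A (Idt C A)"
  unfolding universal_def by (auto simp: yo_def Idt_in Idt_Cmp)

definition nat_bij ::
    "('o, 'a, 'd) psh \<Rightarrow> ('o, 'a, 'e) psh \<Rightarrow> ('o \<Rightarrow> 'd \<Rightarrow> 'e) \<Rightarrow> bool" where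
  "nat_bij F G t \<longleftrightarrow> natural F G t \<and> (\<forall>Z \<in> Obj C. bij_betw (t Z) (elts F Z) (elts G Z))"

lemma nat_bijI:
  assumes "natural F G t"
    and "\<And>Z x x'. Z \<in> Obj C \<Longrightarrow> x \<in> elts F Z \<Longrightarrow> x' \<in> elts F Z \<Longrightarrow> t Z x = t Z x' \<Longrightarrow> x = x'"
    and "\<And>Z y. Z \<in> Obj C \<Longrightarrow> y \<in> elts G Z \<Longrightarrow> \<exists>x \<in> elts F Z. t Z x = y"
  shows "nat_bij F G t"
  unfolding nat_bij_def
proof (intro conjI ballI assms(1))
  fix Z assume "Z \<in> Obj C"
  thus "bij_betw (t Z) (elts F Z) (elts G Z)"
    by (intro bij_betw_imageI inj_onI)
      (use assms(2,3) naturalD(1)[OF assms(1)] in \<open>auto simp: image_iff\<close>, metis)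
qed

lemma nat_bij_natural: "nat_bij F G t \<Longrightarrow> natural F G t"
  unfolding nat_bij_def by blast

lemma nat_bij_inj:
  assumes "nat_bij F G t" "Z \<in> Obj C" "x \<in> elts F Z" "x' \<in> elts F Z" "t Z x = t Z x'"
  shows "x = x'"
proof -
  have "bij_betw (t Z) (elts F Z) (elts G Z)" using assms(1,2) unfolding nat_bij_def by simp
  thus ?thesis using inj_onD[OF bij_betw_imp_inj_on] assms by metis
qed

lemma nat_bij_surj:
  assumes "nat_bij F G t" "Z \<in> Obj C" "y \<in> elts G Z"
  obtains x where "x \<in> elts F Z" "t Z x = y"
proof -
  have "bij_betw (t Z) (elts F Z) (elts G Z)" using assms(1,2) unfolding nat_bij_def by simp
  hence "y \<in> t Z ` elts F Z" using assms(3) bij_betw_imp_surj_on by metis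
  thus ?thesis using that by (elim imageE) simp
qed

lemma universal_nat_bij:
  assumes t: "nat_bij F G t" and F: "presheaf F" and u: "universal F V v"
  shows "universal G V (t V v)"
  unfolding universal_def
proof (intro conjI ballI)
  show V: "V \<in> Obj C" using universalD[OF u] by blast
  have v: "v \<in> elts F V" using universalD[OF u] by blast
  note n = nat_bij_natural[OF t]
  show "t V v \<in> elts G V" using naturalD(1)[OF n V v] .
  fix Z y assume Z: "Z \<in> Obj C" and y: "y \<in> elts G Z"
  obtain x where x: "x \<in> elts F Z" "t Z x = y" using nat_bij_surj[OF t Z y] .
  then obtain h where h: "h \<in> Hom C Z V" "restr F h v = x" using universalD(3)[OF u Z] by blast
  show "\<exists>!h. h \<in> Hom C Z V \<and> restr G h (t V v) = y"
  proof (rule ex1I[of _ h])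
    show "h \<in> Hom C Z V \<and> restr G h (t V v) = y" using h x naturalD(2)[OF n h(1) v] by simp
    fix k assume k: "k \<in> Hom C Z V \<and> restr G k (t V v) = y"
    hence "t Z (restr F k v) = t Z x" using naturalD(2)[OF n _ v] x by metis
    hence "restr F k v = x" using nat_bij_inj[OF t Z _ x(1)] presheafD(1)[OF F _ v] k by blast
    thus "k = h" using universal_eqI[OF u F] k h by metis
  qed
qed

lemma universal_nat_bij_rev:
  assumes t: "nat_bij F G t" and F: "presheaf F" and G: "presheaf G" and u: "universal G V v"
  obtains w where "universal F V w" "t V w = v"
proof -
  note n = nat_bij_natural[OF t]
  have V: "V \<in> Obj C" and v: "v \<in> elts G V" using universalD[OF u] by blast+
  obtain w where w: "w \<in> elts F V" "t V w = v" using nat_bij_surj[OF t V v] .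
  have "universal F V w"
    unfolding universal_def
  proof (intro conjI ballI V w)
    fix Z x assume Z: "Z \<in> Obj C" and x: "x \<in> elts F Z"
    then obtain h where h: "h \<in> Hom C Z V" "restr G h v = t Z x"
      using universalD(3)[OF u Z] naturalD(1)[OF n] by blast
    show "\<exists>!h. h \<in> Hom C Z V \<and> restr F h w = x"
    proof (rule ex1I[of _ h])
      have "t Z (restr F h w) = t Z x" using naturalD(2)[OF n h(1) w(1)] h w by simp
      thus "h \<in> Hom C Z V \<and> restr F h w = x"
        using nat_bij_inj[OF t Z _ x] presheafD(1)[OF F h(1) w(1)] h by blast
      fix k assume k: "k \<in> Hom C Z V \<and> restr F k w = x"
      hence "restr G k v = restr G h v" using naturalD(2)[OF n _ w(1)] w h by metis
      thus "k = h" using universal_eqI[OF u G] k h by metis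
    qed
  qed
  thus ?thesis using w that by blast
qed

end


context extensive_site begin

lemma iso_T: "iso C f \<Longrightarrow> f \<in> T"
  and Cmp_T: "f \<in> T \<Longrightarrow> g \<in> T \<Longrightarrow> Dom C g = Cod C f \<Longrightarrow> g \<cdot> f \<in> T"
  and pullback_T_ex: "f \<in> T \<Longrightarrow> g \<in> Arr C \<Longrightarrow> Cod C g = Cod C f \<Longrightarrow> \<exists>P p q. is_pullback C f g P p q"
  and pullback_T: "f \<in> T \<Longrightarrow> g \<in> Arr C \<Longrightarrow> Cod C g = Cod C f \<Longrightarrow> is_pullback C f g P p q \<Longrightarrow> q \<in> T"
proof -
  note p = pretopology[unfolded singleton_pretopology_def]
  have p2: "\<forall>f. iso C f \<longrightarrow> f \<in> T"
    and p3: "\<forall>f \<in> T. \<forall>g \<in> T. Dom C g = Cod C f \<longrightarrow> g \<cdot> f \<in> T"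
    and p4: "\<forall>f \<in> T. \<forall>g \<in> Arr C. Cod C g = Cod C f \<longrightarrow>
        (\<exists>P p q. is_pullback C f g P p q) \<and> (\<forall>P p q. is_pullback C f g P p q \<longrightarrow> q \<in> T)"
    using p by - (elim conjE, assumption)+
  show "iso C f \<Longrightarrow> f \<in> T" using p2 by simp
  show "f \<in> T \<Longrightarrow> g \<in> T \<Longrightarrow> Dom C g = Cod C f \<Longrightarrow> g \<cdot> f \<in> T" using p3 by simp
  assume "f \<in> T" "g \<in> Arr C" "Cod C g = Cod C f"
  note p4[rule_format, OF this]
  thus "\<exists>P p q. is_pullback C f g P p q" "is_pullback C f g P p q \<Longrightarrow> q \<in> T" by simp_all
qed

text \<open>The Kan conditions speak of arrows between representing objects. Formulated for natural maps
  of presheaves, they can be composed and pulled back without naming these objects.\<close>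

definition cover_map ::
    "('o, 'a, 'd) psh \<Rightarrow> ('o, 'a, 'e) psh \<Rightarrow> ('o \<Rightarrow> 'd \<Rightarrow> 'e) \<Rightarrow> bool" where
  "cover_map F G t \<longleftrightarrow> presheaf F \<and> presheaf G \<and> natural F G t \<and>
     (\<exists>U u V v c. universal F U u \<and> universal G V v \<and> c \<in> Hom C U V \<and> c \<in> T \<and>
        restr G c v = t U u)"

lemma cover_mapD:
  assumes "cover_map F G t"
  shows "presheaf F" "presheaf G" "natural F G t" "representable F" "representable G"
  using assms unfolding cover_map_def representable_def by blast+

lemma universal_unique_iso:
  assumes F: "presheaf F" and u: "universal F V v" and u': "universal F V' v'"
  obtains k where "k \<in> Hom C V' V" "iso C k" "restr F k v = v'"
proof -
  have V: "V \<in> Obj C" "V' \<in> Obj C" "v \<in> elts F V" "v' \<in> elts F V'"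
    using universalD(1,2)[OF u] universalD(1,2)[OF u'] by auto
  obtain k where k: "k \<in> Hom C V' V" "restr F k v = v'" using universalD(3)[OF u V(2,4)] by blast
  obtain l where l: "l \<in> Hom C V V'" "restr F l v' = v" using universalD(3)[OF u' V(1,3)] by blast
  have "k \<cdot> l = Idt C V"
    using universal_eqI[OF u F Cmp_in[OF l(1) k(1)] Idt_in[OF V(1)]] k l V
    by (simp add: presheafD(2)[OF F k(1) l(1)] presheafD(3)[OF F])
  moreover have "l \<cdot> k = Idt C V'"
    using universal_eqI[OF u' F Cmp_in[OF k(1) l(1)] Idt_in[OF V(2)]] k l V
    by (simp add: presheafD(2)[OF F l(1) k(1)] presheafD(3)[OF F])
  ultimately show ?thesis using that k l isoI by blast
qed

text \<open>Since isomorphisms are covers, whether the induced arrow is a cover does not depend on the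
  chosen universal elements.\<close>

lemma cover_map_classifying:
  assumes cm: "cover_map F G t" and u: "universal F U u" and v: "universal G V v"
  obtains c where "c \<in> Hom C U V" "c \<in> T" "restr G c v = t U u"
proof -
  have F: "presheaf F" and G: "presheaf G" and n: "natural F G t"
    using cover_mapD[OF cm] by blast+
  obtain U' u' V' v' c where u': "universal F U' u'" and v': "universal G V' v'"
    and c: "c \<in> Hom C U' V'" "c \<in> T" "restr G c v' = t U' u'"
    using cm unfolding cover_map_def by blast
  obtain k where k: "k \<in> Hom C U U'" "iso C k" "restr F k u' = u"
    using universal_unique_iso[OF F u' u] .
  obtain l where l: "l \<in> Hom C V' V" "iso C l" "restr G l v = v'"
    using universal_unique_iso[OF G v v'] .
  have kc: "c \<cdot> k \<in> Hom C U V'" using Cmp_in k c by blast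
  have "c \<cdot> k \<in> T" using Cmp_T[OF iso_T[OF k(2)] c(2)] HomD[OF k(1)] HomD[OF c(1)] by simp
  hence "l \<cdot> (c \<cdot> k) \<in> T" using Cmp_T[OF _ iso_T[OF l(2)]] HomD[OF kc] HomD[OF l(1)] by simp
  moreover have "restr G (l \<cdot> (c \<cdot> k)) v = t U u"
  proof -
    have "restr G (l \<cdot> (c \<cdot> k)) v = restr G (c \<cdot> k) v'"
      using presheafD(2)[OF G l(1) kc] universalD(2)[OF v] l by simp
    also have "\<dots> = restr G k (t U' u')"
      using presheafD(2)[OF G c(1) k(1)] universalD(2)[OF v'] c by simp
    also have "\<dots> = t U u" using naturalD(2)[OF n k(1) universalD(2)[OF u']] k(3) by simp
    finally show ?thesis .
  qed
  ultimately show ?thesis using that Cmp_in[OF kc l(1)] by blast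
qed

lemma cover_map_comp:
  assumes a: "cover_map F G t" and b: "cover_map G H s"
  shows "cover_map F H (\<lambda>Z x. s Z (t Z x))"
proof -
  obtain U u V v where u: "universal F U u" and v: "universal G V v"
    using cover_mapD[OF a] unfolding representable_def by blast
  obtain W w where w: "universal H W w" using cover_mapD[OF b] unfolding representable_def by blast
  obtain c where c: "c \<in> Hom C U V" "c \<in> T" "restr G c v = t U u"
    using cover_map_classifying[OF a u v] .
  obtain d where d: "d \<in> Hom C V W" "d \<in> T" "restr H d w = s V v"
    using cover_map_classifying[OF b v w] .
  note n = cover_mapD(3)[OF a] and m = cover_mapD(3)[OF b] and H = cover_mapD(2)[OF b]
  have "natural F H (\<lambda>Z x. s Z (t Z x))"
  proof (rule naturalI)
    fix Z x assume "Z \<in> Obj C" "x \<in> elts F Z"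
    thus "s Z (t Z x) \<in> elts H Z" using naturalD(1)[OF n] naturalD(1)[OF m] by blast
  next
    fix Z Z' h x assume hx: "h \<in> Hom C Z' Z" "x \<in> elts F Z"
    hence "Z \<in> Obj C" using HomD by blast
    thus "s Z' (t Z' (restr F h x)) = restr H h (s Z (t Z x))"
      using hx naturalD[OF n] naturalD[OF m] by metis
  qed
  moreover have "d \<cdot> c \<in> T" using Cmp_T[OF c(2) d(2)] HomD[OF c(1)] HomD[OF d(1)] by simp
  moreover have "restr H (d \<cdot> c) w = s U (t U u)"
    using presheafD(2)[OF H d(1) c(1)] universalD(2)[OF w] d(3)
      naturalD(2)[OF m c(1) universalD(2)[OF v]] c(3) by simp
  ultimately show ?thesis
    unfolding cover_map_def using cover_mapD(1)[OF a] H u w Cmp_in[OF c(1) d(1)] by blast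
qed

lemma cover_map_cong:
  assumes a: "cover_map F G t" and eq: "\<And>Z x. Z \<in> Obj C \<Longrightarrow> x \<in> elts F Z \<Longrightarrow> s Z x = t Z x"
  shows "cover_map F G s"
proof -
  have n: "natural F G t" and F: "presheaf F" using cover_mapD[OF a] by blast+
  have "natural F G s"
  proof (rule naturalI)
    show "s Z x \<in> elts G Z" if "Z \<in> Obj C" "x \<in> elts F Z" for Z x
      using naturalD(1)[OF n that] eq that by simp
    fix Z Z' h x assume h: "h \<in> Hom C Z' Z" "x \<in> elts F Z"
    have "Z \<in> Obj C" "Z' \<in> Obj C" using HomD[OF h(1)] by blast+
    thus "s Z' (restr F h x) = restr G h (s Z x)"
      using naturalD(2)[OF n h] eq h presheafD(1)[OF F h] by simp
  qed
  thus ?thesis using a eq unfolding cover_map_def by (metis universalD(1) universalD(2))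
qed

lemma nat_bij_cover_map:
  assumes t: "nat_bij F G t" and F: "presheaf F" and G: "presheaf G"
    and r: "representable F \<or> representable G"
  shows "cover_map F G t"
proof -
  obtain V v where v: "universal F V v"
    using r universal_nat_bij_rev[OF t F G] unfolding representable_def by blast
  have w: "universal G V (t V v)" using universal_nat_bij[OF t F v] .
  have "V \<in> Obj C" using universalD[OF v] by blast
  thus ?thesis unfolding cover_map_def
    using F G nat_bij_natural[OF t] v w Idt_in iso_T[OF iso_Idt] presheafD(3)[OF G]
      universalD(2)[OF w] by metis
qed

lemma cover_map_nat_bij_cancel:
  assumes a: "cover_map F H (\<lambda>Z x. s Z (t Z x))" and s: "nat_bij G H s"
    and G: "presheaf G" and t: "natural F G t"
  shows "cover_map F G t"
proof -
  have F: "presheaf F" and H: "presheaf H" using cover_mapD[OF a] by blast+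
  obtain U u W w where u: "universal F U u" and w: "universal H W w"
    using cover_mapD[OF a] unfolding representable_def by blast
  obtain v where v: "universal G W v" "s W v = w" using universal_nat_bij_rev[OF s G H w] .
  obtain c where c: "c \<in> Hom C U W" "c \<in> T" "restr H c w = s U (t U u)"
    using cover_map_classifying[OF a u w] .
  have U: "U \<in> Obj C" "u \<in> elts F U" using universalD[OF u] by blast+
  have "s U (restr G c v) = s U (t U u)"
    using naturalD(2)[OF nat_bij_natural[OF s] c(1) universalD(2)[OF v(1)]] v c by simp
  hence "restr G c v = t U u"
    using nat_bij_inj[OF s U(1)] presheafD(1)[OF G c(1) universalD(2)[OF v(1)]]
      naturalD(1)[OF t U] by blast
  thus ?thesis unfolding cover_map_def using F G t u v c by blast
qed

text \<open>Covers are stable under pullback. Pointwise \<open>F'\<close> is the fibre product of \<open>F\<close> and \<open>H\<close> over \<open>G\<close>, so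
  the pullback of the arrows between objects representing \<open>F\<close>, \<open>G\<close> and \<open>H\<close>, which exists because one of
  them is a cover, represents \<open>F'\<close>.\<close>

lemma cover_map_pullback:
  assumes a: "cover_map F G t" and F': "presheaf F'" and H: "presheaf H" "representable H"
    and s: "natural H G s" and t': "natural F' H t'" and s': "natural F' F s'"
    and sq: "\<And>Z x. Z \<in> Obj C \<Longrightarrow> x \<in> elts F' Z \<Longrightarrow> t Z (s' Z x) = s Z (t' Z x)"
    and inj: "\<And>Z x y. Z \<in> Obj C \<Longrightarrow> x \<in> elts F' Z \<Longrightarrow> y \<in> elts F' Z \<Longrightarrow>
        s' Z x = s' Z y \<Longrightarrow> t' Z x = t' Z y \<Longrightarrow> x = y"
    and surj: "\<And>Z x y. Z \<in> Obj C \<Longrightarrow> x \<in> elts F Z \<Longrightarrow> y \<in> elts H Z \<Longrightarrow> t Z x = s Z y \<Longrightarrow>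
        \<exists>z \<in> elts F' Z. s' Z z = x \<and> t' Z z = y"
  shows "cover_map F' H t'"
proof -
  have F: "presheaf F" and G: "presheaf G" and t: "natural F G t" using cover_mapD[OF a] by blast+
  obtain U u V v where u: "universal F U u" and v: "universal G V v"
    using cover_mapD[OF a] unfolding representable_def by blast
  obtain W w where w: "universal H W w" using H unfolding representable_def by blast
  obtain c where c: "c \<in> Hom C U V" "c \<in> T" "restr G c v = t U u"
    using cover_map_classifying[OF a u v] .
  note uu = universalD(1,2)[OF u] and vv = universalD(1,2)[OF v] and ww = universalD(1,2)[OF w]
  obtain d where d: "d \<in> Hom C W V" "restr G d v = s W w"
    using universalD(3)[OF v ww(1)] naturalD(1)[OF s ww] by blast
  (* the element of F' over the pullback object with components u and w is the universal one *)
  obtain P p q where pb: "is_pullback C c d P p q"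
    using pullback_T_ex[OF c(2)] HomD[OF c(1)] HomD[OF d(1)] by metis
  have q: "q \<in> T" using pullback_T[OF c(2) _ _ pb] HomD[OF c(1)] HomD[OF d(1)] by simp
  have P: "P \<in> Obj C" and pH: "p \<in> Hom C P U" and qH: "q \<in> Hom C P W" and pq: "c \<cdot> p = d \<cdot> q"
    using pb HomD[OF c(1)] HomD[OF d(1)] unfolding is_pullback_def by auto
  have "t P (restr F p u) = restr G (c \<cdot> p) v"
    using naturalD(2)[OF t pH uu(2)] c presheafD(2)[OF G c(1) pH vv(2)] by simp
  moreover have "s P (restr H q w) = restr G (d \<cdot> q) v"
    using naturalD(2)[OF s qH ww(2)] d presheafD(2)[OF G d(1) qH vv(2)] by simp
  ultimately obtain z where z: "z \<in> elts F' P" "s' P z = restr F p u" "t' P z = restr H q w"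
    using surj[OF P presheafD(1)[OF F pH uu(2)] presheafD(1)[OF H(1) qH ww(2)]] pq by auto
  have "universal F' P z"
    unfolding universal_def
  proof (intro conjI ballI P z(1))
    fix Z x assume Z: "Z \<in> Obj C" and x: "x \<in> elts F' Z"
    have sx: "s' Z x \<in> elts F Z" and tx: "t' Z x \<in> elts H Z"
      using naturalD(1)[OF s' Z x] naturalD(1)[OF t' Z x] .
    obtain i where i: "i \<in> Hom C Z U" "restr F i u = s' Z x" using universalD(3)[OF u Z sx] by blast
    obtain j where j: "j \<in> Hom C Z W" "restr H j w = t' Z x" using universalD(3)[OF w Z tx] by blast
    have "restr G (c \<cdot> i) v = restr G (d \<cdot> j) v"
      using presheafD(2)[OF G c(1) i(1) vv(2)] presheafD(2)[OF G d(1) j(1) vv(2)] c d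
        naturalD(2)[OF t i(1) uu(2)] naturalD(2)[OF s j(1) ww(2)] i j sq[OF Z x] by simp
    hence cd: "c \<cdot> i = d \<cdot> j" using universal_eqI[OF v G Cmp_in Cmp_in] c d i j by metis
    obtain h where h: "h \<in> Hom C Z P" "p \<cdot> h = i" "q \<cdot> h = j"
      using pullback_arrow_ex[OF pb _ _ cd] i j HomD[OF c(1)] HomD[OF d(1)] by metis
    show "\<exists>!h. h \<in> Hom C Z P \<and> restr F' h z = x"
    proof (rule ex1I[of _ h])
      have "s' Z (restr F' h z) = s' Z x"
        using naturalD(2)[OF s' h(1) z(1)] z presheafD(2)[OF F pH h(1) uu(2)] h i by simp
      moreover have "t' Z (restr F' h z) = t' Z x"
        using naturalD(2)[OF t' h(1) z(1)] z presheafD(2)[OF H(1) qH h(1) ww(2)] h j by simp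
      ultimately show "h \<in> Hom C Z P \<and> restr F' h z = x"
        using inj[OF Z presheafD(1)[OF F' h(1) z(1)] x] h by blast
      fix k assume k: "k \<in> Hom C Z P \<and> restr F' k z = x"
      hence kP: "k \<in> Hom C Z P" by blast
      have "restr F (p \<cdot> k) u = restr F i u"
        using naturalD(2)[OF s' kP z(1)] z presheafD(2)[OF F pH kP uu(2)] k i by simp
      hence "p \<cdot> k = p \<cdot> h" using universal_eqI[OF u F Cmp_in[OF kP pH] i(1)] h by simp
      moreover have "restr H (q \<cdot> k) w = restr H j w"
        using naturalD(2)[OF t' kP z(1)] z presheafD(2)[OF H(1) qH kP ww(2)] k j by simp
      hence "q \<cdot> k = q \<cdot> h" using universal_eqI[OF w H(1) Cmp_in[OF kP qH] j(1)] h by simp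
      ultimately show "k = h" using pullback_arrow_eqI[OF pb kP h(1)] by blast
    qed
  qed
  thus ?thesis unfolding cover_map_def using F' H(1) t' w qH q z by metis
qed

text \<open>The right-hand side is the shape of the representability conditions on simplicial objects, where
  the source is always an object \<open>X\<^sub>m\<close>.\<close>

lemma cover_map_yo_iff:
  assumes F: "presheaf F" and A: "A \<in> Obj C" and n: "natural (yo C A) F \<phi>"
  shows "cover_map (yo C A) F \<phi> \<longleftrightarrow>
    (\<exists>V e. represents C F V e \<and> (\<exists>c \<in> Hom C A V. c \<in> T \<and>
       (\<forall>Z \<in> Obj C. \<forall>g \<in> Hom C Z A. e Z (c \<cdot> g) = \<phi> Z g)))" (is "?L \<longleftrightarrow> ?R")
proof
  have nat: "\<phi> Z g = restr F g (\<phi> A (Idt C A))" if "g \<in> Hom C Z A" for Z g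
  proof -
    have "Idt C A \<in> elts (yo C A) A" using Idt_in[OF A] by (simp add: yo_def)
    from naturalD(2)[OF n that this] that show ?thesis by (simp add: yo_def Idt_Cmp)
  qed
  have y: "\<phi> A (Idt C A) \<in> elts F A" using naturalD(1)[OF n A] Idt_in[OF A] by (simp add: yo_def)
  {
    assume ?L
    then obtain V v where v: "universal F V v" using cover_mapD unfolding representable_def by blast
    obtain c where c: "c \<in> Hom C A V" "c \<in> T" "restr F c v = \<phi> A (Idt C A)"
      using cover_map_classifying[OF \<open>?L\<close> yo_universal[OF A] v] .
    have "(\<lambda>Z\<in>Obj C. \<lambda>h\<in>Hom C Z V. restr F h v) Z (c \<cdot> g) = \<phi> Z g"
      if "Z \<in> Obj C" "g \<in> Hom C Z A" for Z g
      using that Cmp_in[OF that(2) c(1)] c nat presheafD(2)[OF F c(1) that(2) universalD(2)[OF v]]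
      by simp
    thus ?R using universal_represents[OF F v] c by blast
  next
    assume ?R
    then obtain V e c where e: "represents C F V e" and c: "c \<in> Hom C A V" "c \<in> T"
      and ev: "\<And>Z g. Z \<in> Obj C \<Longrightarrow> g \<in> Hom C Z A \<Longrightarrow> e Z (c \<cdot> g) = \<phi> Z g" by blast
    have "restr F c (e V (Idt C V)) = \<phi> A (Idt C A)"
      using ev[OF A Idt_in[OF A]] represents_universal(2)[OF e c(1)] Cmp_Idt[OF c(1)] by simp
    thus ?L unfolding cover_map_def
      using F n yo_presheaf yo_universal[OF A] represents_universal(1)[OF e] c by blast
  }
qed

end

section \<open>Monotone maps of finite ordinals\<close>

abbreviation dapp :: "darr \<Rightarrow> nat \<Rightarrow> nat" where "dapp \<theta> \<equiv> snd (snd \<theta>)"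

lemma Delta_sel [simp]:
  "Obj Delta_plus = UNIV" "Dom Delta_plus \<theta> = fst \<theta>" "Cod Delta_plus \<theta> = fst (snd \<theta>)"
  "Obj Delta = {0<..}" "Dom Delta \<theta> = fst \<theta>" "Cod Delta \<theta> = fst (snd \<theta>)"
  "Idt Delta = Idt Delta_plus" "Cmp Delta = Cmp Delta_plus"
  by (auto simp: Delta_def Delta_plus_def full_subcat_def split: prod.splits)

lemma Hom_Delta_plus_iff:
  "\<theta> \<in> Hom Delta_plus n M \<longleftrightarrow> fst \<theta> = n \<and> fst (snd \<theta>) = M \<and>
     dapp \<theta> \<in> {..<n} \<rightarrow>\<^sub>E {..<M} \<and> mono_on {..<n} (dapp \<theta>)"
  by (cases \<theta>) (auto simp: Hom_def Delta_plus_def)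

lemma Hom_Delta_iff: "\<theta> \<in> Hom Delta n M \<longleftrightarrow> \<theta> \<in> Hom Delta_plus n M \<and> 0 < n \<and> 0 < M"
  by (cases \<theta>) (auto simp: Hom_def Delta_def Delta_plus_def full_subcat_def)

lemma Arr_Delta_Hom: "\<theta> \<in> Arr Delta \<longleftrightarrow> \<theta> \<in> Hom Delta (fst \<theta>) (fst (snd \<theta>))"
  by (simp add: Hom_def)

lemma Hom_Delta_pos: "\<theta> \<in> Hom Delta_plus n M \<Longrightarrow> 0 < n \<Longrightarrow> \<theta> \<in> Hom Delta n M"
  unfolding Hom_Delta_iff Hom_Delta_plus_iff by (auto simp: PiE_def Pi_def)

lemma dapp_less: "\<theta> \<in> Hom Delta_plus n M \<Longrightarrow> i < n \<Longrightarrow> dapp \<theta> i < M"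
  unfolding Hom_Delta_plus_iff by (auto simp: PiE_def Pi_def)

lemma dapp_mono: "\<theta> \<in> Hom Delta_plus n M \<Longrightarrow> i \<le> j \<Longrightarrow> j < n \<Longrightarrow> dapp \<theta> i \<le> dapp \<theta> j"
  unfolding Hom_Delta_plus_iff mono_on_def by auto

lemma darr_eqI:
  assumes "\<theta> \<in> Hom Delta_plus n M" "\<theta>' \<in> Hom Delta_plus n M" "\<And>i. i < n \<Longrightarrow> dapp \<theta> i = dapp \<theta>' i"
  shows "\<theta> = \<theta>'"
proof -
  have "dapp \<theta> = dapp \<theta>'"
    using assms unfolding Hom_Delta_plus_iff by (intro PiE_ext[of _ "{..<n}" "\<lambda>_. {..<M}"]) auto
  thus ?thesis using assms unfolding Hom_Delta_plus_iff by (simp add: prod_eq_iff)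
qed

lemma darrI:
  assumes "\<And>i. i < n \<Longrightarrow> g i < M" "\<And>i j. i \<le> j \<Longrightarrow> j < n \<Longrightarrow> g i \<le> g j"
  shows "(n, M, \<lambda>i\<in>{..<n}. g i) \<in> Hom Delta_plus n M"
  using assms by (auto simp: Hom_Delta_plus_iff mono_on_def)

lemma dapp_Idt: "Idt Delta_plus n = (n, n, \<lambda>i\<in>{..<n}. i)"
  by (simp add: Delta_plus_def)

lemma dapp_Idt_app: "i < n \<Longrightarrow> dapp (Idt Delta_plus n) i = i"
  by (simp add: dapp_Idt)

lemma Idt_Delta_plus: "Idt Delta_plus n \<in> Hom Delta_plus n n"
  unfolding dapp_Idt by (rule darrI) auto

lemma Cmp_Delta_eq: "Cmp Delta_plus \<theta> \<phi> = (fst \<phi>, fst (snd \<theta>), compose {..<fst \<phi>} (dapp \<theta>) (dapp \<phi>))"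
  by (simp add: Delta_plus_def split: prod.splits)

lemma fst_Cmp_Delta [simp]:
  "fst (Cmp Delta_plus \<theta> \<phi>) = fst \<phi>" "fst (snd (Cmp Delta_plus \<theta> \<phi>)) = fst (snd \<theta>)"
  by (simp_all add: Cmp_Delta_eq)

lemma dapp_Cmp: "i < fst \<phi> \<Longrightarrow> dapp (Cmp Delta_plus \<theta> \<phi>) i = dapp \<theta> (dapp \<phi> i)"
  by (simp add: Cmp_Delta_eq compose_def)

lemma Cmp_Delta_plus:
  assumes "\<phi> \<in> Hom Delta_plus k n" "\<theta> \<in> Hom Delta_plus n M"
  shows "Cmp Delta_plus \<theta> \<phi> \<in> Hom Delta_plus k M"
proof -
  have "fst \<phi> = k" "fst (snd \<theta>) = M" using assms unfolding Hom_Delta_plus_iff by auto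
  moreover have "(k, M, \<lambda>i\<in>{..<k}. dapp \<theta> (dapp \<phi> i)) \<in> Hom Delta_plus k M"
    using assms by (intro darrI) (auto intro: dapp_less dapp_mono)
  ultimately show ?thesis by (simp add: Cmp_Delta_eq compose_def)
qed

lemma Hom_Delta_plusD: "\<theta> \<in> Hom Delta_plus n M \<Longrightarrow> fst \<theta> = n \<and> fst (snd \<theta>) = M"
  unfolding Hom_Delta_plus_iff by blast

lemma Hom_DeltaD:
  assumes "\<theta> \<in> Hom Delta n M"
  shows "fst \<theta> = n" "fst (snd \<theta>) = M" "0 < n" "0 < M" "\<theta> \<in> Hom Delta_plus n M" "\<theta> \<in> Arr Delta"
proof -
  show "\<theta> \<in> Arr Delta" using assms unfolding Hom_def by simp
qed (use assms in \<open>auto simp: Hom_Delta_iff dest: Hom_Delta_plusD\<close>)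

interpretation Delta_plus: category Delta_plus
proof
  fix f g h :: darr and x y z w
  show "f \<in> Hom Delta_plus x y \<Longrightarrow> g \<in> Hom Delta_plus y z \<Longrightarrow> Cmp Delta_plus g f \<in> Hom Delta_plus x z"
    by (rule Cmp_Delta_plus)
  show "f \<in> Hom Delta_plus x y \<Longrightarrow> Cmp Delta_plus f (Idt Delta_plus x) = f"
    by (rule darr_eqI[OF Cmp_Delta_plus[OF Idt_Delta_plus]])
      (auto simp: dapp_Cmp dapp_Idt Hom_Delta_plus_iff)
  show "Cmp Delta_plus (Idt Delta_plus y) f = f" if f: "f \<in> Hom Delta_plus x y"
  proof -
    show ?thesis
    proof (rule darr_eqI[OF Cmp_Delta_plus[OF f Idt_Delta_plus] f])
      fix i assume i: "i < x"
      hence "dapp (Cmp Delta_plus (Idt Delta_plus y) f) i = dapp (Idt Delta_plus y) (dapp f i)"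
        using Hom_Delta_plusD[OF f] by (intro dapp_Cmp) simp
      thus "dapp (Cmp Delta_plus (Idt Delta_plus y) f) i = dapp f i"
        using dapp_Idt_app[OF dapp_less[OF f i]] by simp
    qed
  qed
  assume f: "f \<in> Hom Delta_plus x y" and g: "g \<in> Hom Delta_plus y z" and h: "h \<in> Hom Delta_plus z w"
  show "Cmp Delta_plus (Cmp Delta_plus h g) f = Cmp Delta_plus h (Cmp Delta_plus g f)"
  proof (rule darr_eqI[OF Cmp_Delta_plus[OF f Cmp_Delta_plus[OF g h]]
          Cmp_Delta_plus[OF Cmp_Delta_plus[OF f g] h]])
    fix i assume i: "i < x"
    have "i < fst f" "dapp f i < fst g"
      using i dapp_less[OF f i] Hom_Delta_plusD[OF f] Hom_Delta_plusD[OF g] by auto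
    thus "dapp (Cmp Delta_plus (Cmp Delta_plus h g) f) i =
        dapp (Cmp Delta_plus h (Cmp Delta_plus g f)) i"
      by (simp add: dapp_Cmp)
  qed
qed (auto simp: Idt_Delta_plus)

interpretation Delta: category Delta
proof
  fix f g h :: darr and x y z w :: nat
  show "f \<in> Arr Delta \<Longrightarrow> Dom Delta f \<in> Obj Delta" "f \<in> Arr Delta \<Longrightarrow> Cod Delta f \<in> Obj Delta"
    by (auto simp: Arr_Delta_Hom Hom_Delta_iff)
qed (auto simp: Hom_Delta_iff Idt_Delta_plus Cmp_Delta_plus Delta_plus.Cmp_Idt Delta_plus.Idt_Cmp
        Delta_plus.Cmp_assoc)

lemma verts_eq: "\<theta> \<in> Hom Delta_plus n M \<Longrightarrow> verts \<theta> = dapp \<theta> ` {..<n}"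
  by (cases \<theta>) (auto simp: verts_def Hom_Delta_plus_iff)

lemma verts_subset: "\<theta> \<in> Hom Delta_plus n M \<Longrightarrow> verts \<theta> \<subseteq> {..<M}"
  by (auto simp: verts_eq dapp_less)

lemma verts_Cmp:
  assumes "\<phi> \<in> Hom Delta_plus k n" "\<theta> \<in> Hom Delta_plus n M"
  shows "verts (Cmp Delta_plus \<theta> \<phi>) = dapp \<theta> ` verts \<phi>"
  unfolding verts_eq[OF Cmp_Delta_plus[OF assms]] verts_eq[OF assms(1)] image_image
  by (intro image_cong refl dapp_Cmp) (use Hom_Delta_plusD[OF assms(1)] in auto)

lemma verts_Cmp_subset:
  assumes "\<phi> \<in> Hom Delta_plus k n" "\<theta> \<in> Hom Delta_plus n M"
  shows "verts (Cmp Delta_plus \<theta> \<phi>) \<subseteq> verts \<theta>"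
  unfolding verts_Cmp[OF assms] verts_eq[OF assms(2)] using verts_subset[OF assms(1)] by blast

lemma verts_Idt: "verts (Idt Delta_plus n) = {..<n}"
  using verts_eq[OF Idt_Delta_plus] by (auto simp: dapp_Idt)

lemma face_cancel:
  assumes e: "e \<in> Hom Delta_plus n M" "inj_on (dapp e) {..<n}"
    and "\<theta> \<in> Hom Delta_plus k n" "\<theta>' \<in> Hom Delta_plus k n"
    and eq: "Cmp Delta_plus e \<theta> = Cmp Delta_plus e \<theta>'"
  shows "\<theta> = \<theta>'"
proof (rule darr_eqI[OF assms(3,4)])
  fix i assume i: "i < k"
  have "dapp e (dapp \<theta> i) = dapp e (dapp \<theta>' i)"
    using dapp_Cmp[of i \<theta> e] dapp_Cmp[of i \<theta>' e] i eq Hom_Delta_plusD[OF assms(3)]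
      Hom_Delta_plusD[OF assms(4)] by simp
  thus "dapp \<theta> i = dapp \<theta>' i" using inj_onD[OF e(2)] dapp_less[OF assms(3) i] dapp_less[OF assms(4) i]
    by simp
qed

text \<open>The factorization is found vertex by vertex; it is monotone because an injective monotone map
  reflects the order.\<close>

lemma face_factor:
  assumes e: "e \<in> Hom Delta_plus n M" "inj_on (dapp e) {..<n}"
    and \<theta>: "\<theta> \<in> Hom Delta_plus k M" "verts \<theta> \<subseteq> verts e"
  obtains \<phi> where "\<phi> \<in> Hom Delta_plus k n" "Cmp Delta_plus e \<phi> = \<theta>"
proof -
  have "\<exists>j. j < n \<and> dapp e j = dapp \<theta> i" if "i < k" for i
  proof -
    have "dapp \<theta> i \<in> dapp e ` {..<n}" using \<theta> that unfolding verts_eq[OF \<theta>(1)] verts_eq[OF e(1)] by blast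
    thus ?thesis by auto
  qed
  then obtain g where g: "\<And>i. i < k \<Longrightarrow> g i < n \<and> dapp e (g i) = dapp \<theta> i" by metis
  define \<phi> :: darr where "\<phi> = (k, n, \<lambda>i\<in>{..<k}. g i)"
  have \<phi>: "\<phi> \<in> Hom Delta_plus k n"
    unfolding \<phi>_def
  proof (rule darrI)
    show "g i < n" if "i < k" for i using g that by blast
    fix i j assume ij: "i \<le> j" "j < (k::nat)"
    show "g i \<le> g j"
    proof (rule ccontr)
      assume "\<not> g i \<le> g j"
      hence "dapp e (g j) \<le> dapp e (g i)" using dapp_mono[OF e(1)] g ij by (meson le_less_trans nat_le_linear)
      hence "dapp e (g j) = dapp e (g i)" using dapp_mono[OF \<theta>(1) ij] g ij by (metis le_antisym le_less_trans)
      hence "g j = g i" using inj_onD[OF e(2)] g ij by (metis lessThan_iff le_less_trans)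
      thus False using \<open>\<not> g i \<le> g j\<close> by simp
    qed
  qed
  have "Cmp Delta_plus e \<phi> = \<theta>"
    by (rule darr_eqI[OF Cmp_Delta_plus[OF \<phi> e(1)] \<theta>(1)]) (use g in \<open>simp add: dapp_Cmp \<phi>_def\<close>)
  thus ?thesis using that \<phi> by blast
qed

lemma face_exists:
  assumes N: "N \<subseteq> {..<M}"
  obtains e where "e \<in> Hom Delta_plus (card N) M" "inj_on (dapp e) {..<card N}" "verts e = N"
proof -
  have fin: "finite N" using N finite_subset by blast
  obtain h where h: "bij_betw h {..<card N} N" "strict_mono_on {..<card N} h"
    using ex_bij_betw_strict_mono_card[OF fin] .
  define e :: darr where "e = (card N, M, \<lambda>i\<in>{..<card N}. h i)"
  have e: "e \<in> Hom Delta_plus (card N) M"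
    unfolding e_def
  proof (rule darrI)
    show "h i < M" if "i < card N" for i using bij_betw_apply[OF h(1)] that N by auto
    show "h i \<le> h j" if "i \<le> j" "j < card N" for i j
      using strict_mono_onD[OF h(2), of i j] that by (cases "i = j") auto
  qed
  moreover have "inj_on (dapp e) {..<card N}"
    using bij_betw_imp_inj_on[OF h(1)] by (auto simp: e_def inj_on_def)
  moreover have "verts e = N" using bij_betw_imp_surj_on[OF h(1)] by (auto simp: e_def verts_def)
  ultimately show ?thesis using that by blast
qed

lemma join_dapp:
  "i < fst \<alpha> + fst \<beta> \<Longrightarrow>
    dapp (join \<alpha> \<beta>) i = (if i < fst \<alpha> then dapp \<alpha> i else fst (snd \<alpha>) + dapp \<beta> (i - fst \<alpha>))"
  by (cases \<alpha>; cases \<beta>) simp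

lemma join_eq:
  "join \<alpha> \<beta> = (fst \<alpha> + fst \<beta>, fst (snd \<alpha>) + fst (snd \<beta>), \<lambda>i\<in>{..<fst \<alpha> + fst \<beta>}.
     if i < fst \<alpha> then dapp \<alpha> i else fst (snd \<alpha>) + dapp \<beta> (i - fst \<alpha>))"
  by (cases \<alpha>; cases \<beta>) (simp cong: if_cong)

lemma join_sel [simp]:
  "fst (join \<alpha> \<beta>) = fst \<alpha> + fst \<beta>" "fst (snd (join \<alpha> \<beta>)) = fst (snd \<alpha>) + fst (snd \<beta>)"
  by (cases \<alpha>; cases \<beta>; simp)+

lemma join_Hom:
  assumes \<alpha>: "\<alpha> \<in> Hom Delta_plus a' a" and \<beta>: "\<beta> \<in> Hom Delta_plus b' b"
  shows "join \<alpha> \<beta> \<in> Hom Delta_plus (a' + b') (a + b)"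
proof -
  let ?g = "\<lambda>i. if i < a' then dapp \<alpha> i else a + dapp \<beta> (i - a')"
  have "(a' + b', a + b, \<lambda>i\<in>{..<a' + b'}. ?g i) \<in> Hom Delta_plus (a' + b') (a + b)"
  proof (rule darrI)
    fix i assume "i < a' + b'"
    thus "?g i < a + b" using dapp_less[OF \<alpha>, of i] dapp_less[OF \<beta>, of "i - a'"] by auto
  next
    fix i j assume ij: "i \<le> j" "j < a' + b'"
    show "?g i \<le> ?g j"
      using dapp_mono[OF \<alpha>, of i j] dapp_mono[OF \<beta>, of "i - a'" "j - a'"] dapp_less[OF \<alpha>, of i] ij
      by auto
  qed
  thus ?thesis using Hom_Delta_plusD[OF \<alpha>] Hom_Delta_plusD[OF \<beta>] unfolding join_eq by (simp cong: if_cong)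
qed

lemma join_Cmp:
  assumes \<alpha>: "\<alpha> \<in> Hom Delta_plus a' a" and \<beta>: "\<beta> \<in> Hom Delta_plus b' b"
    and \<alpha>': "\<alpha>' \<in> Hom Delta_plus a'' a'" and \<beta>': "\<beta>' \<in> Hom Delta_plus b'' b'"
  shows "Cmp Delta_plus (join \<alpha> \<beta>) (join \<alpha>' \<beta>') =
    join (Cmp Delta_plus \<alpha> \<alpha>') (Cmp Delta_plus \<beta> \<beta>')"
proof (rule darr_eqI)
  show "Cmp Delta_plus (join \<alpha> \<beta>) (join \<alpha>' \<beta>') \<in> Hom Delta_plus (a'' + b'') (a + b)"
    by (rule Cmp_Delta_plus[OF join_Hom[OF \<alpha>' \<beta>'] join_Hom[OF \<alpha> \<beta>]])
  show "join (Cmp Delta_plus \<alpha> \<alpha>') (Cmp Delta_plus \<beta> \<beta>') \<in> Hom Delta_plus (a'' + b'') (a + b)"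
    by (intro join_Hom Cmp_Delta_plus[OF \<alpha>' \<alpha>] Cmp_Delta_plus[OF \<beta>' \<beta>])
  fix i assume i: "i < a'' + b''"
  show "dapp (Cmp Delta_plus (join \<alpha> \<beta>) (join \<alpha>' \<beta>')) i =
      dapp (join (Cmp Delta_plus \<alpha> \<alpha>') (Cmp Delta_plus \<beta> \<beta>')) i"
    using i Hom_Delta_plusD[OF \<alpha>] Hom_Delta_plusD[OF \<beta>] Hom_Delta_plusD[OF \<alpha>'] Hom_Delta_plusD[OF \<beta>']
      dapp_less[OF \<alpha>', of i] dapp_less[OF \<beta>', of "i - a''"]
    by (auto simp: dapp_Cmp join_dapp)
qed

lemma monotone_threshold:
  assumes "\<theta> \<in> Hom Delta_plus n M"
  obtains a' where "a' \<le> n" "\<And>i. i < n \<Longrightarrow> dapp \<theta> i < a \<longleftrightarrow> i < a'"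
proof -
  define a' where "a' = (LEAST i. i = n \<or> a \<le> dapp \<theta> i)"
  have P: "a' = n \<or> a \<le> dapp \<theta> a'" unfolding a'_def by (rule LeastI[of _ n]) simp
  have L: "a' \<le> i" if "i = n \<or> a \<le> dapp \<theta> i" for i unfolding a'_def using that by (rule Least_le)
  have le: "a' \<le> n" using L by simp
  moreover have "dapp \<theta> i < a \<longleftrightarrow> i < a'" if i: "i < n" for i
  proof
    assume "dapp \<theta> i < a"
    show "i < a'"
    proof (rule ccontr)
      assume "\<not> i < a'"
      hence "dapp \<theta> a' \<le> dapp \<theta> i" "a' \<noteq> n" using dapp_mono[OF assms _ i] i by auto
      thus False using P \<open>dapp \<theta> i < a\<close> by simp
    qed
  next
    assume "i < a'"
    thus "dapp \<theta> i < a" using L[of i] by (meson leD leI)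
  qed
  ultimately show ?thesis using that by blast
qed

text \<open>The indices sent into the first summand form an initial segment, so a monotone map into an
  ordinal sum is itself an ordinal sum.\<close>

lemma join_split:
  assumes \<theta>: "\<theta> \<in> Hom Delta_plus n (a + b)"
  obtains a' b' \<alpha> \<beta> where "n = a' + b'" "\<alpha> \<in> Hom Delta_plus a' a" "\<beta> \<in> Hom Delta_plus b' b"
    "\<theta> = join \<alpha> \<beta>"
proof -
  obtain a' where le: "a' \<le> n" and lt: "\<And>i. i < n \<Longrightarrow> dapp \<theta> i < a \<longleftrightarrow> i < a'"
    using monotone_threshold[OF \<theta>, of a] by metis
  define b' where "b' = n - a'"
  define \<alpha> :: darr where "\<alpha> = (a', a, \<lambda>i\<in>{..<a'}. dapp \<theta> i)"
  define \<beta> :: darr where "\<beta> = (b', b, \<lambda>i\<in>{..<b'}. dapp \<theta> (a' + i) - a)"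
  have n: "n = a' + b'" using le by (simp add: b'_def)
  have ge: "a \<le> dapp \<theta> i" if "i < n" "a' \<le> i" for i using lt[OF that(1)] that(2) by (meson leD leI)
  have \<alpha>: "\<alpha> \<in> Hom Delta_plus a' a"
    unfolding \<alpha>_def using lt le dapp_mono[OF \<theta>] by (intro darrI) auto
  have \<beta>: "\<beta> \<in> Hom Delta_plus b' b"
    unfolding \<beta>_def
  proof (rule darrI)
    fix i assume "i < b'"
    hence "a' + i < n" using n by simp
    thus "dapp \<theta> (a' + i) - a < b" using dapp_less[OF \<theta>, of "a' + i"] ge[of "a' + i"] by simp
  next
    fix i j assume "i \<le> j" "j < b'"
    thus "dapp \<theta> (a' + i) - a \<le> dapp \<theta> (a' + j) - a"
      using dapp_mono[OF \<theta>, of "a' + i" "a' + j"] n by (simp add: diff_le_mono)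
  qed
  have "\<theta> = join \<alpha> \<beta>"
    by (rule darr_eqI[OF \<theta>[unfolded n] join_Hom[OF \<alpha> \<beta>]])
      (use ge n in \<open>auto simp: join_dapp \<alpha>_def \<beta>_def\<close>)
  thus ?thesis using that n \<alpha> \<beta> by blast
qed

text \<open>For a monotone map into an ordinal sum with first summand \<open>a\<close> this is the place of the cut: it
  tells in which summand of the total object a simplex lies.\<close>

definition low_count :: "nat \<Rightarrow> darr \<Rightarrow> nat" where
  "low_count a \<theta> = card {i. i < fst \<theta> \<and> dapp \<theta> i < a}"

lemma low_count_join:
  assumes \<alpha>: "\<alpha> \<in> Hom Delta_plus a' a" and \<beta>: "\<beta> \<in> Hom Delta_plus b' b"
  shows "low_count a (join \<alpha> \<beta>) = a'"
proof -
  have "{i. i < fst (join \<alpha> \<beta>) \<and> dapp (join \<alpha> \<beta>) i < a} = {..<a'}"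
    using Hom_Delta_plusD[OF \<alpha>] Hom_Delta_plusD[OF \<beta>] dapp_less[OF \<alpha>]
    by (auto simp: join_dapp split: if_splits)
  thus ?thesis by (simp add: low_count_def)
qed

lemma verts_join_subset_iff:
  assumes \<alpha>: "\<alpha> \<in> Hom Delta_plus a' a" and \<beta>: "\<beta> \<in> Hom Delta_plus b' b"
  shows "verts (join \<alpha> \<beta>) \<subseteq> {..<a} \<longleftrightarrow> b' = 0"
proof
  have *: "dapp (join \<alpha> \<beta>) i = (if i < a' then dapp \<alpha> i else a + dapp \<beta> (i - a'))" if "i < a' + b'" for i
    using join_dapp[of i \<alpha> \<beta>] that Hom_Delta_plusD[OF \<alpha>] Hom_Delta_plusD[OF \<beta>] by simp
  assume v: "verts (join \<alpha> \<beta>) \<subseteq> {..<a}"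
  show "b' = 0"
  proof (rule ccontr)
    assume "b' \<noteq> 0"
    hence "dapp (join \<alpha> \<beta>) a' \<in> verts (join \<alpha> \<beta>)" unfolding verts_eq[OF join_Hom[OF \<alpha> \<beta>]] by auto
    thus False using v *[of a'] \<open>b' \<noteq> 0\<close> by auto
  qed
next
  assume "b' = 0"
  thus "verts (join \<alpha> \<beta>) \<subseteq> {..<a}"
    unfolding verts_eq[OF join_Hom[OF \<alpha> \<beta>]]
    using Hom_Delta_plusD[OF \<alpha>] Hom_Delta_plusD[OF \<beta>] dapp_less[OF \<alpha>] by (auto simp: join_dapp)
qed

definition from_empty :: "nat \<Rightarrow> darr" where
  "from_empty b = (0, b, \<lambda>i\<in>{..<0}. i)"

lemma from_empty_Hom: "from_empty b \<in> Hom Delta_plus 0 b"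
  unfolding from_empty_def by (rule darrI) auto

lemma front_Hom: "front a b \<in> Hom Delta_plus a (a + b)"
  unfolding front_def by (rule darrI) auto

lemma front_eq_join: "front a b = join (Idt Delta_plus a) (from_empty b)"
  by (rule darr_eqI[OF front_Hom join_Hom[OF Idt_Delta_plus from_empty_Hom, unfolded add_0_right]])
    (simp add: join_dapp front_def dapp_Idt from_empty_def)

lemma front_0: "front a 0 = Idt Delta_plus a"
  unfolding front_def dapp_Idt by simp

lemma join_front:
  assumes \<alpha>: "\<alpha> \<in> Hom Delta_plus a' a" and \<beta>: "\<beta> \<in> Hom Delta_plus b' b"
  shows "Cmp Delta_plus (join \<alpha> \<beta>) (front a' b') = Cmp Delta_plus (front a b) \<alpha>"
proof (rule darr_eqI)
  show "Cmp Delta_plus (join \<alpha> \<beta>) (front a' b') \<in> Hom Delta_plus a' (a + b)"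
    by (rule Cmp_Delta_plus[OF front_Hom join_Hom[OF \<alpha> \<beta>]])
  show "Cmp Delta_plus (front a b) \<alpha> \<in> Hom Delta_plus a' (a + b)"
    by (rule Cmp_Delta_plus[OF \<alpha> front_Hom])
  fix i assume i: "i < a'"
  have "fst (front a' b') = a'" "dapp (front a' b') i = i" "dapp (front a b) (dapp \<alpha> i) = dapp \<alpha> i"
    using i dapp_less[OF \<alpha> i] by (simp_all add: front_def)
  thus "dapp (Cmp Delta_plus (join \<alpha> \<beta>) (front a' b')) i = dapp (Cmp Delta_plus (front a b) \<alpha>) i"
    using i Hom_Delta_plusD[OF \<alpha>] Hom_Delta_plusD[OF \<beta>] by (simp add: dapp_Cmp join_dapp)
qed

lemma cut_Hom: "cut a b \<in> Hom Delta_plus (a + b) 2"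
  unfolding cut_def by (rule darrI) auto

lemma cut_join:
  assumes \<alpha>: "\<alpha> \<in> Hom Delta_plus a' a" and \<beta>: "\<beta> \<in> Hom Delta_plus b' b"
  shows "Cmp Delta_plus (cut a b) (join \<alpha> \<beta>) = cut a' b'"
proof (rule darr_eqI[OF Cmp_Delta_plus[OF join_Hom[OF \<alpha> \<beta>] cut_Hom] cut_Hom])
  fix i assume i: "i < a' + b'"
  show "dapp (Cmp Delta_plus (cut a b) (join \<alpha> \<beta>)) i = dapp (cut a' b') i"
    using i Hom_Delta_plusD[OF \<alpha>] Hom_Delta_plusD[OF \<beta>] dapp_less[OF \<alpha>, of i]
      dapp_less[OF \<beta>, of "i - a'"]
    by (auto simp: dapp_Cmp join_dapp cut_def)
qed

lemma cut_bij:
  assumes "0 < n"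
  shows "bij_betw (\<lambda>(a, b). cut a b) {(a, b). a + b = n} (elts (simplex 1) n)"
proof -
  have el: "elts (simplex 1) n = Hom Delta n 2" by (simp add: simplex_def yo_def numeral_2_eq_2)
  have cnt: "low_count 1 (cut a b) = a" for a b
  proof -
    have "{i. i < fst (cut a b) \<and> dapp (cut a b) i < 1} = {..<a}"
      by (auto simp: cut_def split: if_splits)
    thus ?thesis by (simp add: low_count_def)
  qed
  show ?thesis
    unfolding el
  proof (rule bij_betw_imageI)
    show "inj_on (\<lambda>(a, b). cut a b) {(a, b). a + b = n}"
    proof (rule inj_onI, clarify)
      fix a b c d assume eq: "cut a b = cut c d" and s: "c + d = a + b"
      have "a = c" using arg_cong[OF eq, of "low_count 1"] unfolding cnt .
      thus "a = c \<and> b = d" using s by simp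
    qed
    show "(\<lambda>(a, b). cut a b) ` {(a, b). a + b = n} = Hom Delta n 2"
    proof (intro equalityI subsetI)
      fix \<theta> assume "\<theta> \<in> Hom Delta n 2"
      hence \<theta>: "\<theta> \<in> Hom Delta_plus n 2" by (simp add: Hom_Delta_iff)
      obtain a where a: "a \<le> n" "\<And>i. i < n \<Longrightarrow> dapp \<theta> i < 1 \<longleftrightarrow> i < a"
        using monotone_threshold[OF \<theta>, of 1] by metis
      have "cut a (n - a) \<in> Hom Delta_plus n 2" using cut_Hom[of a "n - a"] a by simp
      hence "\<theta> = cut a (n - a)"
      proof (rule darr_eqI[OF \<theta>])
        fix i assume i: "i < n"
        show "dapp \<theta> i = dapp (cut a (n - a)) i"
          using i a(1) a(2)[OF i] dapp_less[OF \<theta> i] by (auto simp: cut_def)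
      qed
      thus "\<theta> \<in> (\<lambda>(a, b). cut a b) ` {(a, b). a + b = n}" using a by (intro rev_image_eqI[of "(a, n - a)"]) auto
    next
      fix \<theta> assume "\<theta> \<in> (\<lambda>(a, b). cut a b) ` {(a, b). a + b = n}"
      then obtain a b where "\<theta> = cut a b" "a + b = n" by auto
      thus "\<theta> \<in> Hom Delta n 2" using cut_Hom[of a b] Hom_Delta_pos assms by simp
    qed
  qed
qed

section \<open>Families of points indexed by the simplices of a subcomplex\<close>

text \<open>A subcomplex of the simplex on the vertices \<open>{..<M}\<close> is given by the set of the vertex sets of
  its faces, the empty face included so that the empty subcomplex is \<open>{{}}\<close>.\<close>

definition complex :: "nat \<Rightarrow> nat set set \<Rightarrow> bool" where
  "complex M K \<longleftrightarrow> K \<subseteq> Pow {..<M} \<and> {} \<in> K \<and> (\<forall>v \<in> K. \<forall>w. w \<subseteq> v \<longrightarrow> w \<in> K)"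

definition simplices :: "nat \<Rightarrow> nat set set \<Rightarrow> darr set" where
  "simplices M K = {\<theta> \<in> Arr Delta. fst (snd \<theta>) = M \<and> verts \<theta> \<in> K}"

definition subc :: "nat \<Rightarrow> nat set set \<Rightarrow> darr sset" where
  "subc m K = (simplex m)\<lparr>elts := (\<lambda>n. {s \<in> elts (simplex m) n. verts s \<in> K})\<rparr>"

lemma complexD:
  assumes "complex M K"
  shows "v \<in> K \<Longrightarrow> v \<subseteq> {..<M}" "{} \<in> K" "v \<in> K \<Longrightarrow> w \<subseteq> v \<Longrightarrow> w \<in> K" "finite K"
proof -
  show "v \<in> K \<Longrightarrow> v \<subseteq> {..<M}" "{} \<in> K" "v \<in> K \<Longrightarrow> w \<subseteq> v \<Longrightarrow> w \<in> K"
    using assms unfolding complex_def by auto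
  have "K \<subseteq> Pow {..<M}" using assms unfolding complex_def by simp
  thus "finite K" by (rule finite_subset) simp
qed

lemma simplices_iff: "\<theta> \<in> simplices M K \<longleftrightarrow> \<theta> \<in> Hom Delta (fst \<theta>) M \<and> verts \<theta> \<in> K"
  unfolding simplices_def Hom_def by auto

lemma simplicesD:
  assumes "\<theta> \<in> simplices M K"
  shows "\<theta> \<in> Hom Delta (fst \<theta>) M" "verts \<theta> \<in> K" "0 < fst \<theta>" "verts \<theta> \<subseteq> {..<M}"
proof -
  show h: "\<theta> \<in> Hom Delta (fst \<theta>) M" "verts \<theta> \<in> K" using assms by (auto simp: simplices_iff)
  show "0 < fst \<theta>" using Hom_DeltaD(3)[OF h(1)] .
  show "verts \<theta> \<subseteq> {..<M}" using verts_subset[OF Hom_DeltaD(5)[OF h(1)]] .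
qed

lemma simplices_mono: "K \<subseteq> K' \<Longrightarrow> simplices M K \<subseteq> simplices M K'"
  unfolding simplices_def by blast

lemma simplices_Cmp:
  assumes "complex M K" "\<theta> \<in> simplices M K" "\<phi> \<in> Hom Delta k (fst \<theta>)"
  shows "Cmp Delta_plus \<theta> \<phi> \<in> simplices M K"
proof -
  have \<theta>: "\<theta> \<in> Hom Delta (fst \<theta>) M" "verts \<theta> \<in> K" using assms(2) by (auto simp: simplices_iff)
  have "Cmp Delta_plus \<theta> \<phi> \<in> Hom Delta k M" using Delta.Cmp_in[OF assms(3) \<theta>(1)] by simp
  moreover have "verts (Cmp Delta_plus \<theta> \<phi>) \<in> K"
    using verts_Cmp_subset[OF Hom_DeltaD(5)[OF assms(3)] Hom_DeltaD(5)[OF \<theta>(1)]] assms(1) \<theta>(2)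
    unfolding complex_def by blast
  ultimately show ?thesis using Hom_DeltaD(1)[OF assms(3)] by (simp add: simplices_iff)
qed

lemma complex_Pow: "complex M (Pow {..<M})"
  unfolding complex_def by blast

lemma complex_Int: "complex M K \<Longrightarrow> complex M L \<Longrightarrow> complex M (K \<inter> L)"
  unfolding complex_def by (metis Int_iff le_infI1)

lemma complex_subset_Pow: "complex M K \<Longrightarrow> K \<subseteq> Pow {..<M}"
  unfolding complex_def by blast

lemma complex_face: "A \<subseteq> {..<M} \<Longrightarrow> complex M (Pow A)"
  unfolding complex_def by auto

lemma complex_boundary: "complex (Suc m) {v. v \<subset> {..m}}"
  unfolding complex_def lessThan_Suc_atMost by auto

lemma complex_horn:
  assumes "1 \<le> m" "k \<le> m"
  shows "complex (Suc m) {v. v \<subseteq> {..m} \<and> insert k v \<noteq> {..m}}"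
proof -
  have "{k} \<noteq> {..m}"
  proof
    assume "{k} = {..m}"
    hence "0 \<in> {k}" "m \<in> {k}" by auto
    thus False using assms by auto
  qed
  moreover have "insert k w \<noteq> {..m}" if v: "v \<subseteq> {..m}" "insert k v \<noteq> {..m}" and w: "w \<subseteq> v" for v w
  proof
    assume "insert k w = {..m}"
    hence "{..m} \<subseteq> insert k v" using w by blast
    moreover have "insert k v \<subseteq> {..m}" using v(1) assms(2) by simp
    ultimately show False using v(2) by blast
  qed
  ultimately show ?thesis unfolding complex_def lessThan_Suc_atMost by blast
qed

lemma complex_empty: "complex M {{}}"
  unfolding complex_def by blast

lemma simplices_empty: "simplices M {{}} = {}"
proof -
  have False if "\<theta> \<in> Hom Delta (fst \<theta>) M" "verts \<theta> = {}" for \<theta>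
  proof -
    have "0 \<in> {..<fst \<theta>}" using Hom_DeltaD(3)[OF that(1)] by simp
    thus False using that verts_eq[OF Hom_DeltaD(5)[OF that(1)]] by blast
  qed
  thus ?thesis by (auto simp: simplices_iff)
qed

lemma Idt_simplices: "0 < M \<Longrightarrow> {..<M} \<in> K \<Longrightarrow> Idt Delta_plus M \<in> simplices M K"
  unfolding simplices_iff using Idt_Delta_plus[of M] Hom_Delta_pos[OF Idt_Delta_plus, of M]
    Hom_Delta_plusD[OF Idt_Delta_plus, of M] by (simp add: verts_Idt)

lemma elts_simplex: "elts (simplex m) n = Hom Delta n (Suc m)"
  by (simp add: simplex_def yo_def)

lemma restr_simplex: "restr (simplex m) \<theta> s = Cmp Delta_plus s \<theta>"
  by (simp add: simplex_def yo_def)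

lemma subc_sel:
  "elts (subc m K) n = {s \<in> Hom Delta n (Suc m). verts s \<in> K}"
  "restr (subc m K) \<theta> s = Cmp Delta_plus s \<theta>"
  by (simp_all add: subc_def elts_simplex restr_simplex)

lemma verts_simplex: "s \<in> elts (simplex m) n \<Longrightarrow> verts s \<subseteq> {..m}"
  using verts_subset Hom_DeltaD(5) unfolding elts_simplex lessThan_Suc_atMost[symmetric] by blast

lemma simplex_eq_subc: "simplex m = subc m (Pow {..<Suc m})"
proof -
  have "(\<lambda>n. {s \<in> elts (simplex m) n. verts s \<in> Pow {..<Suc m}}) = elts (simplex m)"
    using verts_simplex unfolding lessThan_Suc_atMost by blast
  thus ?thesis unfolding subc_def by simp
qed

lemma bdry_eq_subc: "bdry m = subc m {v. v \<subset> {..m}}"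
proof -
  have "(\<lambda>n. {s \<in> elts (simplex m) n. verts s \<in> {v. v \<subset> {..m}}}) =
      (\<lambda>n. {s \<in> elts (simplex m) n. verts s \<noteq> {..m}})"
    using verts_simplex by blast
  thus ?thesis unfolding subc_def bdry_def by simp
qed

lemma horn_eq_subc: "horn m k = subc m {v. v \<subseteq> {..m} \<and> insert k v \<noteq> {..m}}"
proof -
  have "(\<lambda>n. {s \<in> elts (simplex m) n. verts s \<in> {v. v \<subseteq> {..m} \<and> insert k v \<noteq> {..m}}}) =
      (\<lambda>n. {s \<in> elts (simplex m) n. insert k (verts s) \<noteq> {..m}})"
    using verts_simplex by blast
  thus ?thesis unfolding subc_def horn_def by simp
qed

context category begin

lemma sobj_Obj: "simplicial_object C X \<Longrightarrow> 0 < n \<Longrightarrow> omap X n \<in> Obj C"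
  unfolding simplicial_object_def is_fctr_def op_cat_def by simp

lemma sobj_amap:
  assumes "simplicial_object C X" "\<phi> \<in> Hom Delta k n"
  shows "amap X \<phi> \<in> Hom C (omap X n) (omap X k)"
  using assms unfolding simplicial_object_def is_fctr_def op_cat_def Hom_def by auto

lemma sobj_Idt: "simplicial_object C X \<Longrightarrow> 0 < n \<Longrightarrow> amap X (Idt Delta_plus n) = Idt C (omap X n)"
  unfolding simplicial_object_def is_fctr_def op_cat_def by simp

lemma sobj_Cmp:
  assumes "simplicial_object C X" "\<phi> \<in> Hom Delta k n" "\<theta> \<in> Hom Delta n M"
  shows "amap X (Cmp Delta_plus \<theta> \<phi>) = amap X \<phi> \<cdot> amap X \<theta>"
  using assms(1) Hom_DeltaD[OF assms(2)] Hom_DeltaD[OF assms(3)]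
  unfolding simplicial_object_def is_fctr_def op_cat_def by simp

lemma smap_Hom: "simplicial_map C X Y f \<Longrightarrow> 0 < n \<Longrightarrow> f n \<in> Hom C (omap X n) (omap Y n)"
  unfolding simplicial_map_def nat_trans_def op_cat_def by simp

lemma smap_natural:
  assumes "simplicial_map C X Y f" "\<phi> \<in> Hom Delta k n"
  shows "f k \<cdot> amap X \<phi> = amap Y \<phi> \<cdot> f n"
proof -
  have "\<forall>\<phi> \<in> Arr Delta. f (fst \<phi>) \<cdot> amap X \<phi> = amap Y \<phi> \<cdot> f (fst (snd \<phi>))"
    using assms(1) unfolding simplicial_map_def nat_trans_def op_cat_def by simp
  from bspec[OF this Hom_DeltaD(6)[OF assms(2)]] show ?thesis
    using Hom_DeltaD(1,2)[OF assms(2)] by simp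
qed

definition fam :: "('o, 'a) sobj \<Rightarrow> nat \<Rightarrow> nat set set \<Rightarrow> 'o \<Rightarrow> (darr \<Rightarrow> 'a) set" where
  "fam X M K Z = {\<rho> \<in> extensional (simplices M K).
     (\<forall>\<theta> \<in> simplices M K. \<rho> \<theta> \<in> Hom C Z (omap X (fst \<theta>))) \<and>
     (\<forall>\<theta> \<in> simplices M K. \<forall>k. \<forall>\<phi> \<in> Hom Delta k (fst \<theta>).
        \<rho> (Cmp Delta_plus \<theta> \<phi>) = amap X \<phi> \<cdot> \<rho> \<theta>)}"

lemma famI:
  assumes "\<rho> \<in> extensional (simplices M K)"
    and "\<And>\<theta>. \<theta> \<in> simplices M K \<Longrightarrow> \<rho> \<theta> \<in> Hom C Z (omap X (fst \<theta>))"
    and "\<And>\<theta> k \<phi>. \<theta> \<in> simplices M K \<Longrightarrow> \<phi> \<in> Hom Delta k (fst \<theta>) \<Longrightarrow>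
        \<rho> (Cmp Delta_plus \<theta> \<phi>) = amap X \<phi> \<cdot> \<rho> \<theta>"
  shows "\<rho> \<in> fam X M K Z"
  using assms unfolding fam_def by simp

lemma famD:
  assumes "\<rho> \<in> fam X M K Z"
  shows "\<rho> \<in> extensional (simplices M K)"
    and "\<theta> \<in> simplices M K \<Longrightarrow> \<rho> \<theta> \<in> Hom C Z (omap X (fst \<theta>))"
    and "\<theta> \<in> simplices M K \<Longrightarrow> \<phi> \<in> Hom Delta k (fst \<theta>) \<Longrightarrow>
        \<rho> (Cmp Delta_plus \<theta> \<phi>) = amap X \<phi> \<cdot> \<rho> \<theta>"
  using assms unfolding fam_def by simp_all

lemma fam_eqI:
  assumes "\<rho> \<in> fam X M K Z" "\<rho>' \<in> fam X M K Z'" "\<And>\<theta>. \<theta> \<in> simplices M K \<Longrightarrow> \<rho> \<theta> = \<rho>' \<theta>"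
  shows "\<rho> = \<rho>'"
  using extensionalityI[OF famD(1)[OF assms(1)] famD(1)[OF assms(2)]] assms(3) by blast

lemma fam_restr:
  assumes X: "simplicial_object C X" and K: "complex M K" and \<rho>: "\<rho> \<in> fam X M K Z"
    and h: "h \<in> Hom C Z' Z"
  shows "(\<lambda>\<theta>\<in>simplices M K. \<rho> \<theta> \<cdot> h) \<in> fam X M K Z'"
proof (rule famI)
  fix \<theta> assume \<theta>: "\<theta> \<in> simplices M K"
  show "(\<lambda>\<theta>\<in>simplices M K. \<rho> \<theta> \<cdot> h) \<theta> \<in> Hom C Z' (omap X (fst \<theta>))"
    using \<theta> Cmp_in[OF h famD(2)[OF \<rho> \<theta>]] by simp
  fix k \<phi> assume \<phi>: "\<phi> \<in> Hom Delta k (fst \<theta>)"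
  show "(\<lambda>\<theta>\<in>simplices M K. \<rho> \<theta> \<cdot> h) (Cmp Delta_plus \<theta> \<phi>) =
      amap X \<phi> \<cdot> (\<lambda>\<theta>\<in>simplices M K. \<rho> \<theta> \<cdot> h) \<theta>"
    using \<theta> simplices_Cmp[OF K \<theta> \<phi>] famD(3)[OF \<rho> \<theta> \<phi>]
      Cmp_assoc[OF h famD(2)[OF \<rho> \<theta>] sobj_amap[OF X \<phi>]] by simp
qed simp

lemma fam_sub:
  assumes K: "complex M K" and sub: "K \<subseteq> K'" and \<rho>: "\<rho> \<in> fam X M K' Z"
  shows "restrict \<rho> (simplices M K) \<in> fam X M K Z"
proof (rule famI)
  fix \<theta> assume \<theta>: "\<theta> \<in> simplices M K"
  hence \<theta>': "\<theta> \<in> simplices M K'" using simplices_mono[OF sub] by blast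
  show "restrict \<rho> (simplices M K) \<theta> \<in> Hom C Z (omap X (fst \<theta>))" using \<theta> famD(2)[OF \<rho> \<theta>'] by simp
  fix k \<phi> assume \<phi>: "\<phi> \<in> Hom Delta k (fst \<theta>)"
  show "restrict \<rho> (simplices M K) (Cmp Delta_plus \<theta> \<phi>) =
      amap X \<phi> \<cdot> restrict \<rho> (simplices M K) \<theta>"
    using \<theta> simplices_Cmp[OF K \<theta> \<phi>] famD(3)[OF \<rho> \<theta>' \<phi>] by simp
qed simp

lemma fam_point:
  assumes X: "simplicial_object C X" and K: "complex M K" and g: "g \<in> Hom C Z (omap X M)"
  shows "(\<lambda>\<theta>\<in>simplices M K. amap X \<theta> \<cdot> g) \<in> fam X M K Z"
proof (rule famI)
  fix \<theta> assume \<theta>: "\<theta> \<in> simplices M K"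
  hence \<theta>': "\<theta> \<in> Hom Delta (fst \<theta>) M" by (simp add: simplices_iff)
  show "(\<lambda>\<theta>\<in>simplices M K. amap X \<theta> \<cdot> g) \<theta> \<in> Hom C Z (omap X (fst \<theta>))"
    using \<theta> Cmp_in[OF g sobj_amap[OF X \<theta>']] by simp
  fix k \<phi> assume \<phi>: "\<phi> \<in> Hom Delta k (fst \<theta>)"
  show "(\<lambda>\<theta>\<in>simplices M K. amap X \<theta> \<cdot> g) (Cmp Delta_plus \<theta> \<phi>) =
      amap X \<phi> \<cdot> (\<lambda>\<theta>\<in>simplices M K. amap X \<theta> \<cdot> g) \<theta>"
    using \<theta> simplices_Cmp[OF K \<theta> \<phi>] sobj_Cmp[OF X \<phi> \<theta>']
      Cmp_assoc[OF g sobj_amap[OF X \<theta>'] sobj_amap[OF X \<phi>]] by simp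
qed simp

lemma fam_Idt:
  assumes \<rho>: "\<rho> \<in> fam X M K Z" and K: "{..<M} \<in> K" and M: "0 < M" and \<theta>: "\<theta> \<in> simplices M K"
  shows "\<rho> \<theta> = amap X \<theta> \<cdot> \<rho> (Idt Delta_plus M)"
proof -
  have \<theta>': "\<theta> \<in> Hom Delta (fst \<theta>) M" using \<theta> by (simp add: simplices_iff)
  have i: "fst (Idt Delta_plus M) = M" using Hom_Delta_plusD[OF Idt_Delta_plus] by blast
  show ?thesis
    using famD(3)[OF \<rho> Idt_simplices[OF M K], unfolded i, OF \<theta>'] Delta.Idt_Cmp[OF \<theta>'] by simp
qed

text \<open>The presheaf \<open>Hom(K \<rightarrow> \<Delta>, X \<rightarrow> Y)\<close>, with the simplex of \<open>Y\<close> given by Yoneda as a point of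
  the object of simplices on \<open>M\<close> vertices.\<close>

definition Rel :: "('o, 'a) sobj \<Rightarrow> ('o, 'a) sobj \<Rightarrow> (nat \<Rightarrow> 'a) \<Rightarrow> nat \<Rightarrow> nat set set \<Rightarrow>
    ('o, 'a, (darr \<Rightarrow> 'a) \<times> 'a) psh" where
  "Rel X Y f M K =
     \<lparr>elts = (\<lambda>Z. {(\<rho>, y). \<rho> \<in> fam X M K Z \<and> y \<in> Hom C Z (omap Y M) \<and>
                 (\<forall>\<theta> \<in> simplices M K. f (fst \<theta>) \<cdot> \<rho> \<theta> = amap Y \<theta> \<cdot> y)}),
      restr = (\<lambda>h (\<rho>, y). (\<lambda>\<theta>\<in>simplices M K. \<rho> \<theta> \<cdot> h, y \<cdot> h))\<rparr>"

definition rel_pt :: "('o, 'a) sobj \<Rightarrow> (nat \<Rightarrow> 'a) \<Rightarrow> nat \<Rightarrow> nat set set \<Rightarrow>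
    'o \<Rightarrow> 'a \<Rightarrow> (darr \<Rightarrow> 'a) \<times> 'a" where
  "rel_pt X f M K Z g = (\<lambda>\<theta>\<in>simplices M K. amap X \<theta> \<cdot> g, f M \<cdot> g)"

lemma Rel_elts: "(\<rho>, y) \<in> elts (Rel X Y f M K) Z \<longleftrightarrow>
    \<rho> \<in> fam X M K Z \<and> y \<in> Hom C Z (omap Y M) \<and>
    (\<forall>\<theta> \<in> simplices M K. f (fst \<theta>) \<cdot> \<rho> \<theta> = amap Y \<theta> \<cdot> y)"
  by (simp add: Rel_def)

lemma Rel_restr: "restr (Rel X Y f M K) h (\<rho>, y) = (\<lambda>\<theta>\<in>simplices M K. \<rho> \<theta> \<cdot> h, y \<cdot> h)"
  by (simp add: Rel_def)

lemma fam_restr_Cmp: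
  assumes "\<rho> \<in> fam X M K Z" "h \<in> Hom C Z' Z" "k \<in> Hom C Z'' Z'"
  shows "(\<lambda>\<theta>\<in>simplices M K. \<rho> \<theta> \<cdot> (h \<cdot> k)) =
    (\<lambda>\<theta>\<in>simplices M K. (\<lambda>\<theta>\<in>simplices M K. \<rho> \<theta> \<cdot> h) \<theta> \<cdot> k)"
  by (rule restrict_ext) (use Cmp_assoc[OF assms(3,2) famD(2)[OF assms(1)]] in simp)

lemma fam_restr_Idt:
  assumes "\<rho> \<in> fam X M K Z"
  shows "(\<lambda>\<theta>\<in>simplices M K. \<rho> \<theta> \<cdot> Idt C Z) = \<rho>"
  by (rule extensionalityI[OF _ famD(1)[OF assms]]) (use Cmp_Idt[OF famD(2)[OF assms]] in auto)

lemma Rel_presheaf: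
  assumes X: "simplicial_object C X" and Y: "simplicial_object C Y" and f: "simplicial_map C X Y f"
    and K: "complex M K"
  shows "presheaf (Rel X Y f M K)"
proof (rule presheafI, goal_cases)
  case (1 Z Z' h x)
  obtain \<rho> y where x: "x = (\<rho>, y)" by (cases x)
  have \<rho>: "\<rho> \<in> fam X M K Z" and y: "y \<in> Hom C Z (omap Y M)"
    and eq: "\<And>\<theta>. \<theta> \<in> simplices M K \<Longrightarrow> f (fst \<theta>) \<cdot> \<rho> \<theta> = amap Y \<theta> \<cdot> y"
    using 1(2) unfolding x Rel_elts by simp_all
  have "f (fst \<theta>) \<cdot> (\<rho> \<theta> \<cdot> h) = amap Y \<theta> \<cdot> (y \<cdot> h)" if \<theta>: "\<theta> \<in> simplices M K" for \<theta>
  proof -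
    have \<theta>': "\<theta> \<in> Hom Delta (fst \<theta>) M" using \<theta> by (simp add: simplices_iff)
    show ?thesis
      using Cmp_assoc[OF 1(1) famD(2)[OF \<rho> \<theta>] smap_Hom[OF f Hom_DeltaD(3)[OF \<theta>']]]
        Cmp_assoc[OF 1(1) y sobj_amap[OF Y \<theta>']] eq[OF \<theta>] by simp
  qed
  thus ?case unfolding x Rel_restr Rel_elts
    using fam_restr[OF X K \<rho> 1(1)] Cmp_in[OF 1(1) y] by simp
next
  case (2 Z Z' Z'' h k x)
  obtain \<rho> y where x: "x = (\<rho>, y)" by (cases x)
  have \<rho>: "\<rho> \<in> fam X M K Z" and y: "y \<in> Hom C Z (omap Y M)"
    using 2(3) unfolding x Rel_elts by simp_all
  show ?case unfolding x Rel_restr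
    using fam_restr_Cmp[OF \<rho> 2(1,2)] Cmp_assoc[OF 2(2,1) y] by simp
next
  case (3 Z x)
  obtain \<rho> y where x: "x = (\<rho>, y)" by (cases x)
  have \<rho>: "\<rho> \<in> fam X M K Z" and y: "y \<in> Hom C Z (omap Y M)"
    using 3(2) unfolding x Rel_elts by simp_all
  show ?case unfolding x Rel_restr using fam_restr_Idt[OF \<rho>] Cmp_Idt[OF y] by simp
qed

lemma rel_pt_natural:
  assumes X: "simplicial_object C X" and Y: "simplicial_object C Y" and f: "simplicial_map C X Y f"
    and K: "complex M K" and M: "0 < M"
  shows "natural (yo C (omap X M)) (Rel X Y f M K) (rel_pt X f M K)"
proof (rule naturalI)
  fix Z g assume "g \<in> elts (yo C (omap X M)) Z"
  hence g: "g \<in> Hom C Z (omap X M)" by (simp add: yo_def)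
  have "f (fst \<theta>) \<cdot> (amap X \<theta> \<cdot> g) = amap Y \<theta> \<cdot> (f M \<cdot> g)" if \<theta>: "\<theta> \<in> simplices M K" for \<theta>
  proof -
    have \<theta>': "\<theta> \<in> Hom Delta (fst \<theta>) M" using \<theta> by (simp add: simplices_iff)
    show ?thesis
      using Cmp_assoc[OF g sobj_amap[OF X \<theta>'] smap_Hom[OF f Hom_DeltaD(3)[OF \<theta>']]]
        Cmp_assoc[OF g smap_Hom[OF f M] sobj_amap[OF Y \<theta>']] smap_natural[OF f \<theta>'] by simp
  qed
  thus "rel_pt X f M K Z g \<in> elts (Rel X Y f M K) Z"
    unfolding rel_pt_def Rel_elts using fam_point[OF X K g] Cmp_in[OF g smap_Hom[OF f M]] by simp
  fix Z' h assume h: "h \<in> Hom C Z' Z"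
  have "amap X \<theta> \<cdot> (g \<cdot> h) = amap X \<theta> \<cdot> g \<cdot> h" if \<theta>: "\<theta> \<in> simplices M K" for \<theta>
    using Cmp_assoc[OF h g sobj_amap[OF X]] \<theta> unfolding simplices_iff by metis
  moreover have "f M \<cdot> (g \<cdot> h) = f M \<cdot> g \<cdot> h"
    using Cmp_assoc[OF h g smap_Hom[OF f M]] by simp
  ultimately show "rel_pt X f M K Z' (restr (yo C (omap X M)) h g) =
      restr (Rel X Y f M K) h (rel_pt X f M K Z g)"
    unfolding rel_pt_def Rel_restr by (auto simp: yo_def intro!: restrict_ext)
qed

lemma psh_maps_fam:
  assumes K: "complex (Suc m) K" and t: "t \<in> psh_maps Delta (subc m K) (hom_sset C Z X)"
  shows "(\<lambda>\<theta>\<in>simplices (Suc m) K. t (fst \<theta>) \<theta>) \<in> fam X (Suc m) K Z"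
    and "t \<in> (\<Pi>\<^sub>E n \<in> {0<..}. {s \<in> Hom Delta n (Suc m). verts s \<in> K} \<rightarrow>\<^sub>E Hom C Z (omap X n))"
    and "\<phi> \<in> Hom Delta k n \<Longrightarrow> s \<in> Hom Delta n (Suc m) \<Longrightarrow> verts s \<in> K \<Longrightarrow>
      t k (Cmp Delta_plus s \<phi>) = amap X \<phi> \<cdot> t n s"
proof -
  show PiE: "t \<in> (\<Pi>\<^sub>E n \<in> {0<..}. {s \<in> Hom Delta n (Suc m). verts s \<in> K} \<rightarrow>\<^sub>E Hom C Z (omap X n))"
    using psh_maps_PiE[OF t] by (simp add: subc_sel hom_sset_def)
  have nat: "t k (Cmp Delta_plus s \<phi>) = amap X \<phi> \<cdot> t n s"
    if "\<phi> \<in> Hom Delta k n" "s \<in> Hom Delta n (Suc m)" "verts s \<in> K" for \<phi> k n s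
    using psh_maps_natural[OF t Hom_DeltaD(6)[OF that(1)], of s] that Hom_DeltaD[OF that(1)]
    by (simp add: subc_sel hom_sset_def)
  show "\<phi> \<in> Hom Delta k n \<Longrightarrow> s \<in> Hom Delta n (Suc m) \<Longrightarrow> verts s \<in> K \<Longrightarrow>
      t k (Cmp Delta_plus s \<phi>) = amap X \<phi> \<cdot> t n s" by (rule nat)
  show "(\<lambda>\<theta>\<in>simplices (Suc m) K. t (fst \<theta>) \<theta>) \<in> fam X (Suc m) K Z"
  proof (rule famI)
    fix \<theta> assume \<theta>: "\<theta> \<in> simplices (Suc m) K"
    hence \<theta>': "\<theta> \<in> Hom Delta (fst \<theta>) (Suc m)" "verts \<theta> \<in> K" by (auto simp: simplices_iff)
    have "t (fst \<theta>) \<in> {s \<in> Hom Delta (fst \<theta>) (Suc m). verts s \<in> K} \<rightarrow>\<^sub>E Hom C Z (omap X (fst \<theta>))"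
      using PiE_mem[OF PiE] Hom_DeltaD(3)[OF \<theta>'(1)] by simp
    thus "(\<lambda>\<theta>\<in>simplices (Suc m) K. t (fst \<theta>) \<theta>) \<theta> \<in> Hom C Z (omap X (fst \<theta>))"
      using \<theta> \<theta>' PiE_mem by fastforce
    fix k \<phi> assume \<phi>: "\<phi> \<in> Hom Delta k (fst \<theta>)"
    show "(\<lambda>\<theta>\<in>simplices (Suc m) K. t (fst \<theta>) \<theta>) (Cmp Delta_plus \<theta> \<phi>) =
        amap X \<phi> \<cdot> (\<lambda>\<theta>\<in>simplices (Suc m) K. t (fst \<theta>) \<theta>) \<theta>"
      using \<theta> simplices_Cmp[OF K \<theta> \<phi>] nat[OF \<phi> \<theta>'] Hom_DeltaD(1)[OF \<phi>] by simp
  qed simp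
qed

lemma fam_psh_maps:
  assumes K: "complex (Suc m) K" and \<rho>: "\<rho> \<in> fam X (Suc m) K Z"
  shows "(\<lambda>n\<in>{0<..}. \<lambda>s\<in>{s \<in> Hom Delta n (Suc m). verts s \<in> K}. \<rho> s)
    \<in> psh_maps Delta (subc m K) (hom_sset C Z X)"
proof -
  have in_s: "s \<in> simplices (Suc m) K \<and> fst s = n" if "s \<in> Hom Delta n (Suc m)" "verts s \<in> K" for s n
    using that Hom_DeltaD(1)[OF that(1)] by (simp add: simplices_iff)
  show ?thesis
    unfolding psh_maps_def
  proof (intro CollectI conjI ballI)
    show "(\<lambda>n\<in>{0<..}. \<lambda>s\<in>{s \<in> Hom Delta n (Suc m). verts s \<in> K}. \<rho> s)
        \<in> (\<Pi>\<^sub>E n\<in>Obj Delta. elts (subc m K) n \<rightarrow>\<^sub>E elts (hom_sset C Z X) n)"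
    proof (intro PiE_I)
      fix n s assume n: "n \<in> Obj Delta" and s: "s \<in> elts (subc m K) n"
      hence s: "s \<in> Hom Delta n (Suc m)" "verts s \<in> K" by (auto simp: subc_sel)
      hence "\<rho> s \<in> Hom C Z (omap X n)" using famD(2)[OF \<rho>, of s] in_s[OF s] by simp
      thus "(\<lambda>n\<in>{0<..}. \<lambda>s\<in>{s \<in> Hom Delta n (Suc m). verts s \<in> K}. \<rho> s) n s
          \<in> elts (hom_sset C Z X) n"
        using n s by (simp add: hom_sset_def)
    qed (auto simp: subc_sel)
    fix \<phi> s assume "\<phi> \<in> Arr Delta" and "s \<in> elts (subc m K) (Cod Delta \<phi>)"
    hence \<phi>: "\<phi> \<in> Hom Delta (fst \<phi>) (fst (snd \<phi>))"
      and s: "s \<in> Hom Delta (fst (snd \<phi>)) (Suc m)" "verts s \<in> K"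
      by (auto simp: subc_sel Arr_Delta_Hom)
    have s': "s \<in> simplices (Suc m) K" "fst s = fst (snd \<phi>)" using in_s[OF s] by auto
    have "Cmp Delta_plus s \<phi> \<in> simplices (Suc m) K" using simplices_Cmp[OF K s'(1)] \<phi> s'(2) by simp
    hence c: "Cmp Delta_plus s \<phi> \<in> Hom Delta (fst \<phi>) (Suc m)" "verts (Cmp Delta_plus s \<phi>) \<in> K"
      by (auto simp: simplices_iff)
    show "(\<lambda>n\<in>{0<..}. \<lambda>s\<in>{s \<in> Hom Delta n (Suc m). verts s \<in> K}. \<rho> s) (Dom Delta \<phi>)
          (restr (subc m K) \<phi> s) =
        restr (hom_sset C Z X) \<phi>
          ((\<lambda>n\<in>{0<..}. \<lambda>s\<in>{s \<in> Hom Delta n (Suc m). verts s \<in> K}. \<rho> s) (Cod Delta \<phi>) s)"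
      using c s s' famD(3)[OF \<rho> s'(1)] \<phi> Hom_DeltaD(3)[OF \<phi>] Hom_DeltaD(4)[OF \<phi>]
      by (simp add: subc_sel hom_sset_def)
  qed
qed

text \<open>By Yoneda a map from the standard simplex is determined by its value at the identity.\<close>

definition to_Rel :: "nat \<Rightarrow> nat set set \<Rightarrow>
    'o \<Rightarrow> (nat \<Rightarrow> darr \<Rightarrow> 'a) \<times> (nat \<Rightarrow> darr \<Rightarrow> 'a) \<Rightarrow> (darr \<Rightarrow> 'a) \<times> 'a" where
  "to_Rel m K Z = (\<lambda>(\<rho>, \<sigma>). (\<lambda>\<theta>\<in>simplices (Suc m) K. \<rho> (fst \<theta>) \<theta>, \<sigma> (Suc m) (Idt Delta_plus (Suc m))))"

abbreviation Hom_sub :: "('o, 'a) sobj \<Rightarrow> ('o, 'a) sobj \<Rightarrow> (nat \<Rightarrow> 'a) \<Rightarrow> nat \<Rightarrow> nat set set \<Rightarrow>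
    ('o, 'a, (nat \<Rightarrow> darr \<Rightarrow> 'a) \<times> (nat \<Rightarrow> darr \<Rightarrow> 'a)) psh" where
  "Hom_sub X Y f m K \<equiv> Hom_rel C (subc m K) (simplex m) (sincl (subc m K)) X Y f"

lemma Hom_sub_elts:
  "(\<rho>, \<sigma>) \<in> elts (Hom_sub X Y f m K) Z \<longleftrightarrow>
     \<rho> \<in> psh_maps Delta (subc m K) (hom_sset C Z X) \<and>
     \<sigma> \<in> psh_maps Delta (subc m (Pow {..<Suc m})) (hom_sset C Z Y) \<and>
     (\<forall>\<theta> \<in> simplices (Suc m) K. f (fst \<theta>) \<cdot> \<rho> (fst \<theta>) \<theta> = \<sigma> (fst \<theta>) \<theta>)"
proof -
  have "(\<forall>n \<in> Obj Delta. \<forall>r \<in> elts (subc m K) n. f n \<cdot> \<rho> n r = \<sigma> n (sincl (subc m K) n r)) \<longleftrightarrow>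
      (\<forall>\<theta> \<in> simplices (Suc m) K. f (fst \<theta>) \<cdot> \<rho> (fst \<theta>) \<theta> = \<sigma> (fst \<theta>) \<theta>)" (is "?L \<longleftrightarrow> ?R")
  proof
    assume L: ?L
    show ?R
    proof
      fix \<theta> assume "\<theta> \<in> simplices (Suc m) K"
      hence "\<theta> \<in> Hom Delta (fst \<theta>) (Suc m)" "verts \<theta> \<in> K" by (auto simp: simplices_iff)
      thus "f (fst \<theta>) \<cdot> \<rho> (fst \<theta>) \<theta> = \<sigma> (fst \<theta>) \<theta>"
        using L[rule_format, of "fst \<theta>" \<theta>] Hom_DeltaD(3)[of \<theta>] by (simp add: subc_sel sincl_def)
    qed
  next
    assume R: ?R
    show ?L
    proof (intro ballI)
      fix n r assume "n \<in> Obj Delta" and "r \<in> elts (subc m K) n"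
      hence r: "r \<in> Hom Delta n (Suc m)" "verts r \<in> K" "0 < n" by (auto simp: subc_sel)
      hence "r \<in> simplices (Suc m) K" "fst r = n" using Hom_DeltaD(1)[OF r(1)] by (auto simp: simplices_iff)
      thus "f n \<cdot> \<rho> n r = \<sigma> n (sincl (subc m K) n r)"
        using R r by (auto simp: subc_sel sincl_def)
    qed
  qed
  thus ?thesis unfolding Hom_rel_def Hom_psh_def simplex_eq_subc by simp
qed

lemma Hom_sub_restr:
  "restr (Hom_sub X Y f m K) h (\<rho>, \<sigma>) =
     (\<lambda>n\<in>{0<..}. \<lambda>s\<in>{s \<in> Hom Delta n (Suc m). verts s \<in> K}. \<rho> n s \<cdot> h,
      \<lambda>n\<in>{0<..}. \<lambda>s\<in>{s \<in> Hom Delta n (Suc m). verts s \<in> Pow {..<Suc m}}. \<sigma> n s \<cdot> h)"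
  unfolding Hom_rel_def Hom_psh_def simplex_eq_subc by (simp add: subc_sel)

lemma psh_maps_restr:
  assumes X: "simplicial_object C X" and K: "complex (Suc m) K"
    and t: "t \<in> psh_maps Delta (subc m K) (hom_sset C Z X)" and h: "h \<in> Hom C Z' Z"
  shows "(\<lambda>n\<in>{0<..}. \<lambda>s\<in>{s \<in> Hom Delta n (Suc m). verts s \<in> K}. t n s \<cdot> h)
    \<in> psh_maps Delta (subc m K) (hom_sset C Z' X)"
proof -
  note f = fam_psh_maps[OF K fam_restr[OF X K psh_maps_fam(1)[OF K t] h]]
  have "(\<lambda>n\<in>{0<..}. \<lambda>s\<in>{s \<in> Hom Delta n (Suc m). verts s \<in> K}.
        (\<lambda>\<theta>\<in>simplices (Suc m) K. (\<lambda>\<theta>\<in>simplices (Suc m) K. t (fst \<theta>) \<theta>) \<theta> \<cdot> h) s) =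
      (\<lambda>n\<in>{0<..}. \<lambda>s\<in>{s \<in> Hom Delta n (Suc m). verts s \<in> K}. t n s \<cdot> h)"
    by (intro restrict_ext) (auto simp: simplices_iff dest: Hom_DeltaD(1))
  thus ?thesis using f by simp
qed

lemma Hom_sub_closed:
  assumes X: "simplicial_object C X" and Y: "simplicial_object C Y" and f: "simplicial_map C X Y f"
    and K: "complex (Suc m) K"
    and x: "x \<in> elts (Hom_sub X Y f m K) Z" and h: "h \<in> Hom C Z' Z"
  shows "restr (Hom_sub X Y f m K) h x \<in> elts (Hom_sub X Y f m K) Z'"
proof -
  obtain \<rho> \<sigma> where xe: "x = (\<rho>, \<sigma>)" by (cases x)
  have \<rho>: "\<rho> \<in> psh_maps Delta (subc m K) (hom_sset C Z X)"
    and \<sigma>: "\<sigma> \<in> psh_maps Delta (subc m (Pow {..<Suc m})) (hom_sset C Z Y)"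
    and eq: "\<And>\<theta>. \<theta> \<in> simplices (Suc m) K \<Longrightarrow> f (fst \<theta>) \<cdot> \<rho> (fst \<theta>) \<theta> = \<sigma> (fst \<theta>) \<theta>"
    using x unfolding xe Hom_sub_elts by simp_all
  have "f (fst \<theta>) \<cdot> (\<rho> (fst \<theta>) \<theta> \<cdot> h) = \<sigma> (fst \<theta>) \<theta> \<cdot> h" if \<theta>: "\<theta> \<in> simplices (Suc m) K" for \<theta>
  proof -
    have "\<rho> (fst \<theta>) \<theta> \<in> Hom C Z (omap X (fst \<theta>))"
      using famD(2)[OF psh_maps_fam(1)[OF K \<rho>] \<theta>] \<theta> by simp
    moreover have "0 < fst \<theta>" using \<theta> Hom_DeltaD(3) unfolding simplices_iff by blast
    ultimately show ?thesis using Cmp_assoc[OF h _ smap_Hom[OF f]] eq[OF \<theta>] by metis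
  qed
  moreover have "verts \<theta> \<subseteq> {..<Suc m}" if "\<theta> \<in> simplices (Suc m) K" for \<theta>
    using that verts_subset Hom_DeltaD(5) unfolding simplices_iff by blast
  ultimately show ?thesis
    unfolding xe Hom_sub_restr Hom_sub_elts
    using psh_maps_restr[OF X K \<rho> h] psh_maps_restr[OF Y complex_Pow \<sigma> h]
    by (auto simp: simplices_iff dest: Hom_DeltaD(3))
qed

lemma to_Rel_nat_bij:
  assumes X: "simplicial_object C X" and Y: "simplicial_object C Y" and f: "simplicial_map C X Y f"
    and K: "complex (Suc m) K"
  shows "nat_bij (Hom_sub X Y f m K) (Rel X Y f (Suc m) K) (to_Rel m K)"
proof -
  let ?M = "Suc m"
  let ?i = "Idt Delta_plus ?M"
  have i: "?i \<in> Hom Delta ?M ?M" "verts ?i \<in> Pow {..<?M}"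
    using Hom_Delta_pos[OF Idt_Delta_plus] by (auto simp: verts_Idt)
  have yon: "\<sigma> n s = amap Y s \<cdot> \<sigma> ?M ?i"
    if "\<sigma> \<in> psh_maps Delta (subc m (Pow {..<?M})) (hom_sset C Z Y)" "s \<in> Hom Delta n ?M" for \<sigma> n s Z
    using psh_maps_fam(3)[OF complex_Pow that(1,2) i] Delta.Idt_Cmp[OF that(2)] by simp
  have \<sigma>i: "\<sigma> ?M ?i \<in> Hom C Z (omap Y ?M)"
    if "\<sigma> \<in> psh_maps Delta (subc m (Pow {..<?M})) (hom_sset C Z Y)" for \<sigma> Z
  proof -
    have "\<sigma> ?M \<in> {s \<in> Hom Delta ?M ?M. verts s \<in> Pow {..<?M}} \<rightarrow>\<^sub>E Hom C Z (omap Y ?M)"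
      using PiE_mem[OF psh_maps_fam(2)[OF complex_Pow that], of ?M] by simp
    from PiE_mem[OF this, of ?i] show ?thesis using i by simp
  qed
  show ?thesis
  proof (rule nat_bijI)
    show "natural (Hom_sub X Y f m K) (Rel X Y f ?M K) (to_Rel m K)"
    proof (rule naturalI)
      fix Z x assume x: "x \<in> elts (Hom_sub X Y f m K) Z"
      obtain \<rho> \<sigma> where xe: "x = (\<rho>, \<sigma>)" by (cases x)
      have \<rho>: "\<rho> \<in> psh_maps Delta (subc m K) (hom_sset C Z X)"
        and \<sigma>: "\<sigma> \<in> psh_maps Delta (subc m (Pow {..<?M})) (hom_sset C Z Y)"
        and eq: "\<And>\<theta>. \<theta> \<in> simplices ?M K \<Longrightarrow> f (fst \<theta>) \<cdot> \<rho> (fst \<theta>) \<theta> = \<sigma> (fst \<theta>) \<theta>"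
        using x unfolding xe Hom_sub_elts by simp_all
      show "to_Rel m K Z x \<in> elts (Rel X Y f ?M K) Z"
        unfolding xe to_Rel_def prod.case Rel_elts
        using psh_maps_fam(1)[OF K \<rho>] \<sigma>i[OF \<sigma>] eq yon[OF \<sigma>] by (simp add: simplices_iff)
      fix Z' h assume h: "h \<in> Hom C Z' Z"
      have "\<And>\<theta>. \<theta> \<in> simplices ?M K \<Longrightarrow> \<theta> \<in> Hom Delta (fst \<theta>) ?M \<and> verts \<theta> \<in> K \<and> 0 < fst \<theta>"
        using Hom_DeltaD(3) unfolding simplices_iff by blast
      thus "to_Rel m K Z' (restr (Hom_sub X Y f m K) h x) =
          restr (Rel X Y f ?M K) h (to_Rel m K Z x)"
        unfolding xe Hom_sub_restr to_Rel_def prod.case Rel_restr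
        using i by (auto intro!: restrict_ext)
    qed
  next
    fix Z x x'
    assume x: "x \<in> elts (Hom_sub X Y f m K) Z" and x': "x' \<in> elts (Hom_sub X Y f m K) Z"
      and eq: "to_Rel m K Z x = to_Rel m K Z x'"
    obtain \<rho> \<sigma> \<rho>' \<sigma>' where xe: "x = (\<rho>, \<sigma>)" "x' = (\<rho>', \<sigma>')" by (cases x; cases x')
    have \<rho>: "\<rho> \<in> psh_maps Delta (subc m K) (hom_sset C Z X)"
        "\<rho>' \<in> psh_maps Delta (subc m K) (hom_sset C Z X)"
      and \<sigma>: "\<sigma> \<in> psh_maps Delta (subc m (Pow {..<?M})) (hom_sset C Z Y)"
        "\<sigma>' \<in> psh_maps Delta (subc m (Pow {..<?M})) (hom_sset C Z Y)"
      using x x' unfolding xe Hom_sub_elts by simp_all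
    have e1: "(\<lambda>\<theta>\<in>simplices ?M K. \<rho> (fst \<theta>) \<theta>) = (\<lambda>\<theta>\<in>simplices ?M K. \<rho>' (fst \<theta>) \<theta>)"
      and e2: "\<sigma> ?M ?i = \<sigma>' ?M ?i"
      using eq unfolding xe to_Rel_def by simp_all
    have ext: "t = t'" if t: "t \<in> psh_maps Delta (subc m L) (hom_sset C Z X')"
        "t' \<in> psh_maps Delta (subc m L) (hom_sset C Z X')" and L: "complex ?M L"
        and ag: "\<And>n s. s \<in> Hom Delta n ?M \<Longrightarrow> verts s \<in> L \<Longrightarrow> t n s = t' n s" for t t' L X'
    proof (rule PiE_ext[OF psh_maps_fam(2)[OF L t(1)] psh_maps_fam(2)[OF L t(2)]])
      fix n :: nat assume n: "n \<in> {0<..}"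
      show "t n = t' n"
        by (rule PiE_ext[OF PiE_mem[OF psh_maps_fam(2)[OF L t(1)] n]
              PiE_mem[OF psh_maps_fam(2)[OF L t(2)] n]]) (use ag in simp)
    qed
    have "\<rho> = \<rho>'"
    proof (rule ext[OF \<rho> K])
      fix n s assume "s \<in> Hom Delta n ?M" "verts s \<in> K"
      hence "s \<in> simplices ?M K" "fst s = n" using Hom_DeltaD(1) by (auto simp: simplices_iff)
      thus "\<rho> n s = \<rho>' n s" using fun_cong[OF e1, of s] by simp
    qed
    moreover have "\<sigma> = \<sigma>'"
      by (rule ext[OF \<sigma> complex_Pow]) (use yon[OF \<sigma>(1)] yon[OF \<sigma>(2)] e2 in simp)
    ultimately show "x = x'" unfolding xe by simp
  next
    fix Z x assume x: "x \<in> elts (Rel X Y f ?M K) Z"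
    obtain \<rho> y where xe: "x = (\<rho>, y)" by (cases x)
    have \<rho>: "\<rho> \<in> fam X ?M K Z" and y: "y \<in> Hom C Z (omap Y ?M)"
      and eq: "\<And>\<theta>. \<theta> \<in> simplices ?M K \<Longrightarrow> f (fst \<theta>) \<cdot> \<rho> \<theta> = amap Y \<theta> \<cdot> y"
      using x unfolding xe Rel_elts by simp_all
    let ?\<rho> = "\<lambda>n\<in>{0<..}. \<lambda>s\<in>{s \<in> Hom Delta n ?M. verts s \<in> K}. \<rho> s"
    let ?\<sigma> = "\<lambda>n\<in>{0<..}. \<lambda>s\<in>{s \<in> Hom Delta n ?M. verts s \<in> Pow {..<?M}}.
      (\<lambda>\<theta>\<in>simplices ?M (Pow {..<?M}). amap Y \<theta> \<cdot> y) s"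
    have s: "\<theta> \<in> Hom Delta (fst \<theta>) ?M \<and> verts \<theta> \<in> K \<and> 0 < fst \<theta> \<and> verts \<theta> \<subseteq> {..<?M} \<and>
        \<theta> \<in> simplices ?M (Pow {..<?M})"
      if "\<theta> \<in> simplices ?M K" for \<theta>
      using simplicesD[OF that] by (simp add: simplices_iff)
    have "(?\<rho>, ?\<sigma>) \<in> elts (Hom_sub X Y f m K) Z"
      unfolding Hom_sub_elts
    proof (intro conjI ballI fam_psh_maps[OF K \<rho>] fam_psh_maps[OF complex_Pow fam_point[OF Y complex_Pow y]])
      show "f (fst \<theta>) \<cdot> ?\<rho> (fst \<theta>) \<theta> = ?\<sigma> (fst \<theta>) \<theta>" if "\<theta> \<in> simplices ?M K" for \<theta>
        using eq[OF that] s[OF that] by simp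
    qed
    moreover have "?\<sigma> ?M ?i = y"
      using i Idt_simplices[of ?M "Pow {..<?M}"] sobj_Idt[OF Y, of ?M] Idt_Cmp[OF y] by simp
    moreover have "(\<lambda>\<theta>\<in>simplices ?M K. ?\<rho> (fst \<theta>) \<theta>) = \<rho>"
      by (rule extensionalityI[OF _ famD(1)[OF \<rho>]]) (use s in auto)
    ultimately show "\<exists>z \<in> elts (Hom_sub X Y f m K) Z. to_Rel m K Z z = x"
      unfolding xe to_Rel_def by (intro bexI[of _ "(?\<rho>, ?\<sigma>)"]) simp_all
  qed
qed

text \<open>Functoriality of restriction can be tested after an injective natural map into a presheaf.\<close>

lemma presheaf_nat_bij:
  assumes cl: "\<And>Z Z' h x. h \<in> Hom C Z' Z \<Longrightarrow> x \<in> elts F Z \<Longrightarrow> restr F h x \<in> elts F Z'"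
    and t: "nat_bij F G t" and G: "presheaf G"
  shows "presheaf F"
proof (rule presheafI, goal_cases)
  case (2 Z Z' Z'' h k x)
  have Z: "Z \<in> Obj C" "Z'' \<in> Obj C" using 2 HomD by blast+
  have hx: "restr F h x \<in> elts F Z'" using cl 2 by blast
  have hk: "h \<cdot> k \<in> Hom C Z'' Z" using Cmp_in 2 by blast
  note n = nat_bij_natural[OF t]
  show ?case
    by (rule nat_bij_inj[OF t Z(2) cl[OF hk 2(3)] cl[OF 2(2) hx]])
      (simp add: naturalD(2)[OF n hk 2(3)] naturalD(2)[OF n 2(2) hx] naturalD(2)[OF n 2(1,3)]
        presheafD(2)[OF G 2(1,2) naturalD(1)[OF n Z(1) 2(3)]])
next
  case (3 Z x)
  note n = nat_bij_natural[OF t] and i = Idt_in[OF 3(1)]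
  show ?case
    by (rule nat_bij_inj[OF t 3(1) cl[OF i 3(2)] 3(2)])
      (simp add: naturalD(2)[OF n i 3(2)] presheafD(3)[OF G 3(1) naturalD(1)[OF n 3]])
qed (rule cl)

lemma to_Rel_rel_point:
  assumes Y: "simplicial_object C Y" and f: "simplicial_map C X Y f" and g: "g \<in> Hom C Z (omap X (Suc m))"
  shows "to_Rel m K Z (rel_point C (subc m K) m X Y f g) = rel_pt X f (Suc m) K Z g"
proof -
  have i: "Idt Delta_plus (Suc m) \<in> Hom Delta (Suc m) (Suc m)"
    using Hom_Delta_pos[OF Idt_Delta_plus] by simp
  have fg: "f (Suc m) \<cdot> g \<in> Hom C Z (omap Y (Suc m))" using Cmp_in[OF g smap_Hom[OF f]] by simp
  have "\<And>\<theta>. \<theta> \<in> simplices (Suc m) K \<Longrightarrow> \<theta> \<in> Hom Delta (fst \<theta>) (Suc m) \<and> verts \<theta> \<in> K \<and> 0 < fst \<theta>"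
    using Hom_DeltaD(3) unfolding simplices_iff by blast
  thus ?thesis
    using i Idt_Cmp[OF fg] sobj_Idt[OF Y, of "Suc m"]
    unfolding to_Rel_def rel_point_def rel_pt_def
    by (auto simp: subc_sel elts_simplex intro!: restrict_ext)
qed

lemma rel_point_natural:
  assumes X: "simplicial_object C X" and Y: "simplicial_object C Y" and f: "simplicial_map C X Y f"
    and K: "complex (Suc m) K"
  shows "natural (yo C (omap X (Suc m))) (Hom_sub X Y f m K) (\<lambda>Z. rel_point C (subc m K) m X Y f)"
proof -
  let ?M = "Suc m"
  note t = to_Rel_nat_bij[OF X Y f K]
  note n = nat_bij_natural[OF t] and p = rel_pt_natural[OF X Y f K, simplified]
  have el: "rel_point C (subc m K) m X Y f g \<in> elts (Hom_sub X Y f m K) Z"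
    if g: "g \<in> Hom C Z (omap X ?M)" for Z g
  proof -
    have fg: "f ?M \<cdot> g \<in> Hom C Z (omap Y ?M)" using Cmp_in[OF g smap_Hom[OF f]] by simp
    have *: "(\<lambda>n\<in>{0<..}. \<lambda>s\<in>{s \<in> Hom Delta n ?M. verts s \<in> L}. amap X' s \<cdot> g')
        \<in> psh_maps Delta (subc m L) (hom_sset C Z X')"
      if L: "complex ?M L" and X': "simplicial_object C X'" and g': "g' \<in> Hom C Z (omap X' ?M)" for L X' g'
    proof -
      have "(\<lambda>n\<in>{0<..}. \<lambda>s\<in>{s \<in> Hom Delta n ?M. verts s \<in> L}. amap X' s \<cdot> g') =
          (\<lambda>n\<in>{0<..}. \<lambda>s\<in>{s \<in> Hom Delta n ?M. verts s \<in> L}.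
            (\<lambda>\<theta>\<in>simplices ?M L. amap X' \<theta> \<cdot> g') s)"
        by (intro restrict_ext) (auto simp: simplices_iff dest: Hom_DeltaD(1))
      thus ?thesis using fam_psh_maps[OF L fam_point[OF X' L g']] by simp
    qed
    have s: "\<theta> \<in> Hom Delta (fst \<theta>) ?M \<and> verts \<theta> \<in> K \<and> 0 < fst \<theta> \<and> verts \<theta> \<subseteq> {..<?M}"
      if "\<theta> \<in> simplices ?M K" for \<theta>
      using simplicesD[OF that] by simp
    have eq: "f (fst \<theta>) \<cdot> (amap X \<theta> \<cdot> g) = amap Y \<theta> \<cdot> (f ?M \<cdot> g)" if \<theta>: "\<theta> \<in> simplices ?M K" for \<theta>
    proof -
      have "g \<in> elts (yo C (omap X ?M)) Z" "Z \<in> Obj C" using g HomD[OF g] by (simp_all add: yo_def)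
      from naturalD(1)[OF p this(2,1)] show ?thesis using \<theta> unfolding rel_pt_def Rel_elts by simp
    qed
    show ?thesis
      unfolding rel_point_def Hom_sub_elts
      using *[OF K X g] *[OF complex_Pow Y fg] s eq
      by (simp add: subc_sel simplex_eq_subc)
  qed
  show ?thesis
  proof (rule naturalI)
    show "rel_point C (subc m K) m X Y f g \<in> elts (Hom_sub X Y f m K) Z"
      if "g \<in> elts (yo C (omap X ?M)) Z" for Z g using el that by (simp add: yo_def)
    fix Z Z' h g assume h: "h \<in> Hom C Z' Z" and g: "g \<in> elts (yo C (omap X ?M)) Z"
    have gH: "g \<in> Hom C Z (omap X ?M)" using g by (simp add: yo_def)
    have gh: "g \<cdot> h \<in> Hom C Z' (omap X ?M)" using Cmp_in[OF h gH] .
    have Z': "Z' \<in> Obj C" using HomD[OF h] by blast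
    have "rel_point C (subc m K) m X Y f (g \<cdot> h) =
        restr (Hom_sub X Y f m K) h (rel_point C (subc m K) m X Y f g)"
      by (rule nat_bij_inj[OF t Z' el[OF gh] Hom_sub_closed[OF X Y f K el[OF gH] h]])
        (use naturalD(2)[OF p h g] in
          \<open>simp add: naturalD(2)[OF n h el[OF gH]] to_Rel_rel_point[OF Y f gH]
            to_Rel_rel_point[OF Y f gh] yo_def\<close>)
    thus "rel_point C (subc m K) m X Y f (restr (yo C (omap X ?M)) h g) =
        restr (Hom_sub X Y f m K) h (rel_point C (subc m K) m X Y f g)"
      by (simp add: yo_def)
  qed
qed

end

context extensive_site begin

text \<open>After the natural bijection with \<open>Rel\<close>, boundary and horn conditions ask for a cover whose source
  is the presheaf of points of \<open>X\<^sub>m\<close>.\<close>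

lemma rel_cond_iff_cover_map:
  assumes X: "simplicial_object C X" and Y: "simplicial_object C Y" and f: "simplicial_map C X Y f"
    and K: "complex (Suc m) K"
  shows "rel_cond C (\<lambda>c. c \<in> T) (subc m K) m X Y f \<longleftrightarrow>
    cover_map (yo C (omap X (Suc m))) (Rel X Y f (Suc m) K) (rel_pt X f (Suc m) K)"
proof -
  let ?M = "Suc m"
  note t = to_Rel_nat_bij[OF X Y f K] and R = Rel_presheaf[OF X Y f K]
  have H: "presheaf (Hom_sub X Y f m K)"
    by (rule presheaf_nat_bij[OF _ t R]) (rule Hom_sub_closed[OF X Y f K])
  note n = rel_point_natural[OF X Y f K]
  have pt: "to_Rel m K Z (rel_point C (subc m K) m X Y f g) = rel_pt X f ?M K Z g"
    if "g \<in> elts (yo C (omap X ?M)) Z" for Z g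
    using to_Rel_rel_point[OF Y f] that by (simp add: yo_def)
  have "rel_cond C (\<lambda>c. c \<in> T) (subc m K) m X Y f \<longleftrightarrow>
      cover_map (yo C (omap X ?M)) (Hom_sub X Y f m K) (\<lambda>Z. rel_point C (subc m K) m X Y f)"
    unfolding rel_cond_def using cover_map_yo_iff[OF H sobj_Obj[OF X] n] by simp
  also have "\<dots> \<longleftrightarrow> cover_map (yo C (omap X ?M)) (Rel X Y f ?M K) (rel_pt X f ?M K)"
  proof
    assume c: "cover_map (yo C (omap X ?M)) (Hom_sub X Y f m K) (\<lambda>Z. rel_point C (subc m K) m X Y f)"
    have "cover_map (Hom_sub X Y f m K) (Rel X Y f ?M K) (to_Rel m K)"
      using nat_bij_cover_map[OF t H R] cover_mapD(5)[OF c] by blast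
    from cover_map_cong[OF cover_map_comp[OF c this]]
    show "cover_map (yo C (omap X ?M)) (Rel X Y f ?M K) (rel_pt X f ?M K)" using pt by simp
  next
    assume c: "cover_map (yo C (omap X ?M)) (Rel X Y f ?M K) (rel_pt X f ?M K)"
    have "cover_map (yo C (omap X ?M)) (Rel X Y f ?M K)
        (\<lambda>Z g. to_Rel m K Z (rel_point C (subc m K) m X Y f g))"
      by (rule cover_map_cong[OF c]) (use pt in simp)
    from cover_map_nat_bij_cancel[OF this t H n]
    show "cover_map (yo C (omap X ?M)) (Hom_sub X Y f m K) (\<lambda>Z. rel_point C (subc m K) m X Y f)" .
  qed
  finally show ?thesis .
qed

end

section \<open>Lifting one simplex at a time\<close>

context category begin

text \<open>The presheaf \<open>Hom(K \<rightarrow> L, X \<rightarrow> Y)\<close> for subcomplexes \<open>K \<subseteq> L\<close>.\<close>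

definition Fam :: "('o, 'a) sobj \<Rightarrow> ('o, 'a) sobj \<Rightarrow> (nat \<Rightarrow> 'a) \<Rightarrow> nat \<Rightarrow> nat set set \<Rightarrow> nat set set \<Rightarrow>
    ('o, 'a, (darr \<Rightarrow> 'a) \<times> (darr \<Rightarrow> 'a)) psh" where
  "Fam X Y f M K L =
     \<lparr>elts = (\<lambda>Z. {(\<rho>, \<sigma>). \<rho> \<in> fam X M K Z \<and> \<sigma> \<in> fam Y M L Z \<and>
                 (\<forall>\<theta> \<in> simplices M K. f (fst \<theta>) \<cdot> \<rho> \<theta> = \<sigma> \<theta>)}),
      restr = (\<lambda>h (\<rho>, \<sigma>). (\<lambda>\<theta>\<in>simplices M K. \<rho> \<theta> \<cdot> h, \<lambda>\<theta>\<in>simplices M L. \<sigma> \<theta> \<cdot> h))\<rparr>"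

definition Fam_res :: "nat \<Rightarrow> nat set set \<Rightarrow> nat set set \<Rightarrow>
    'o \<Rightarrow> (darr \<Rightarrow> 'a) \<times> (darr \<Rightarrow> 'a) \<Rightarrow> (darr \<Rightarrow> 'a) \<times> (darr \<Rightarrow> 'a)" where
  "Fam_res M K L Z = (\<lambda>(\<rho>, \<sigma>). (restrict \<rho> (simplices M K), restrict \<sigma> (simplices M L)))"

text \<open>The presheaf \<open>Hom(L, Y)\<close>.\<close>

definition FamP :: "('o, 'a) sobj \<Rightarrow> nat \<Rightarrow> nat set set \<Rightarrow> ('o, 'a, darr \<Rightarrow> 'a) psh" where
  "FamP Y M L = \<lparr>elts = fam Y M L, restr = (\<lambda>h \<sigma>. \<lambda>\<theta>\<in>simplices M L. \<sigma> \<theta> \<cdot> h)\<rparr>"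

lemma Fam_elts: "(\<rho>, \<sigma>) \<in> elts (Fam X Y f M K L) Z \<longleftrightarrow>
    \<rho> \<in> fam X M K Z \<and> \<sigma> \<in> fam Y M L Z \<and> (\<forall>\<theta> \<in> simplices M K. f (fst \<theta>) \<cdot> \<rho> \<theta> = \<sigma> \<theta>)"
  by (simp add: Fam_def)

lemma Fam_restr: "restr (Fam X Y f M K L) h (\<rho>, \<sigma>) =
    (\<lambda>\<theta>\<in>simplices M K. \<rho> \<theta> \<cdot> h, \<lambda>\<theta>\<in>simplices M L. \<sigma> \<theta> \<cdot> h)"
  by (simp add: Fam_def)

lemma FamP_presheaf:
  assumes Y: "simplicial_object C Y" and L: "complex M L"
  shows "presheaf (FamP Y M L)"
  by (rule presheafI) (simp_all add: FamP_def fam_restr[OF Y L] fam_restr_Cmp fam_restr_Idt)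

lemma FamP_point_natural:
  assumes Y: "simplicial_object C Y" and L: "complex M L"
  shows "natural (yo C (omap Y M)) (FamP Y M L) (\<lambda>Z g. \<lambda>\<theta>\<in>simplices M L. amap Y \<theta> \<cdot> g)"
proof (rule naturalI)
  fix Z g assume g: "g \<in> elts (yo C (omap Y M)) Z"
  hence g': "g \<in> Hom C Z (omap Y M)" by (simp add: yo_def)
  show "(\<lambda>\<theta>\<in>simplices M L. amap Y \<theta> \<cdot> g) \<in> elts (FamP Y M L) Z"
    using fam_point[OF Y L g'] by (simp add: FamP_def)
  fix Z' h assume h: "h \<in> Hom C Z' Z"
  have "amap Y \<theta> \<cdot> (g \<cdot> h) = amap Y \<theta> \<cdot> g \<cdot> h" if \<theta>: "\<theta> \<in> simplices M L" for \<theta>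
    using Cmp_assoc[OF h g' sobj_amap[OF Y simplicesD(1)[OF \<theta>]]] by simp
  thus "(\<lambda>\<theta>\<in>simplices M L. amap Y \<theta> \<cdot> restr (yo C (omap Y M)) h g) =
      restr (FamP Y M L) h (\<lambda>\<theta>\<in>simplices M L. amap Y \<theta> \<cdot> g)"
    by (auto simp: FamP_def yo_def intro!: restrict_ext)
qed

lemma Fam_presheaf:
  assumes X: "simplicial_object C X" and Y: "simplicial_object C Y" and f: "simplicial_map C X Y f"
    and K: "complex M K" and L: "complex M L" and KL: "K \<subseteq> L"
  shows "presheaf (Fam X Y f M K L)"
proof (rule presheafI, goal_cases)
  case (1 Z Z' h x)
  obtain \<rho> \<sigma> where x: "x = (\<rho>, \<sigma>)" by (cases x)
  have \<rho>: "\<rho> \<in> fam X M K Z" and \<sigma>: "\<sigma> \<in> fam Y M L Z"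
    and eq: "\<And>\<theta>. \<theta> \<in> simplices M K \<Longrightarrow> f (fst \<theta>) \<cdot> \<rho> \<theta> = \<sigma> \<theta>"
    using 1(2) unfolding x Fam_elts by simp_all
  have "f (fst \<theta>) \<cdot> (\<rho> \<theta> \<cdot> h) = \<sigma> \<theta> \<cdot> h \<and> \<theta> \<in> simplices M L" if \<theta>: "\<theta> \<in> simplices M K" for \<theta>
    using Cmp_assoc[OF 1(1) famD(2)[OF \<rho> \<theta>] smap_Hom[OF f simplicesD(3)[OF \<theta>]]] eq[OF \<theta>]
      simplices_mono[OF KL] \<theta> by auto
  thus ?case unfolding x Fam_restr Fam_elts
    using fam_restr[OF X K \<rho> 1(1)] fam_restr[OF Y L \<sigma> 1(1)] by simp
next
  case (2 Z Z' Z'' h k x)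
  obtain \<rho> \<sigma> where x: "x = (\<rho>, \<sigma>)" by (cases x)
  have \<rho>: "\<rho> \<in> fam X M K Z" and \<sigma>: "\<sigma> \<in> fam Y M L Z"
    using 2(3) unfolding x Fam_elts by simp_all
  show ?case unfolding x Fam_restr using fam_restr_Cmp[OF \<rho> 2(1,2)] fam_restr_Cmp[OF \<sigma> 2(1,2)] by simp
next
  case (3 Z x)
  obtain \<rho> \<sigma> where x: "x = (\<rho>, \<sigma>)" by (cases x)
  have \<rho>: "\<rho> \<in> fam X M K Z" and \<sigma>: "\<sigma> \<in> fam Y M L Z"
    using 3(2) unfolding x Fam_elts by simp_all
  show ?case unfolding x Fam_restr using fam_restr_Idt[OF \<rho>] fam_restr_Idt[OF \<sigma>] by simp
qed

lemma Fam_res_natural: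
  assumes K: "complex M K" and L: "complex M L" and KL: "K \<subseteq> L" "K \<subseteq> K'" "L \<subseteq> L'"
  shows "natural (Fam X Y f M K' L') (Fam X Y f M K L) (Fam_res M K L)"
proof (rule naturalI)
  fix Z x assume x: "x \<in> elts (Fam X Y f M K' L') Z"
  obtain \<rho> \<sigma> where xe: "x = (\<rho>, \<sigma>)" by (cases x)
  have \<rho>: "\<rho> \<in> fam X M K' Z" and \<sigma>: "\<sigma> \<in> fam Y M L' Z"
    and eq: "\<And>\<theta>. \<theta> \<in> simplices M K' \<Longrightarrow> f (fst \<theta>) \<cdot> \<rho> \<theta> = \<sigma> \<theta>"
    using x unfolding xe Fam_elts by simp_all
  note sub = simplices_mono[OF KL(1), of M] simplices_mono[OF KL(2), of M]
  show "Fam_res M K L Z x \<in> elts (Fam X Y f M K L) Z"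
    unfolding xe Fam_res_def prod.case Fam_elts
    using fam_sub[OF K KL(2) \<rho>] fam_sub[OF L KL(3) \<sigma>] eq sub by auto
  fix Z' h
  show "Fam_res M K L Z' (restr (Fam X Y f M K' L') h x) = restr (Fam X Y f M K L) h (Fam_res M K L Z x)"
    unfolding xe Fam_res_def prod.case Fam_restr
    using sub simplices_mono[OF KL(3), of M] by (auto simp: restrict_def fun_eq_iff)
qed

lemma fam_pullback:
  assumes \<rho>: "\<rho> \<in> fam X M K Z" and e: "e \<in> Hom Delta n M" and B: "complex n B"
    and sub: "\<And>\<theta>. \<theta> \<in> simplices n B \<Longrightarrow> Cmp Delta_plus e \<theta> \<in> simplices M K"
  shows "(\<lambda>\<theta>\<in>simplices n B. \<rho> (Cmp Delta_plus e \<theta>)) \<in> fam X n B Z"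
proof (rule famI)
  fix \<theta> assume \<theta>: "\<theta> \<in> simplices n B"
  note \<theta>' = simplicesD(1)[OF \<theta>]
  show "(\<lambda>\<theta>\<in>simplices n B. \<rho> (Cmp Delta_plus e \<theta>)) \<theta> \<in> Hom C Z (omap X (fst \<theta>))"
    using \<theta> famD(2)[OF \<rho> sub[OF \<theta>]] by simp
  fix k \<phi> assume \<phi>: "\<phi> \<in> Hom Delta k (fst \<theta>)"
  show "(\<lambda>\<theta>\<in>simplices n B. \<rho> (Cmp Delta_plus e \<theta>)) (Cmp Delta_plus \<theta> \<phi>) =
      amap X \<phi> \<cdot> (\<lambda>\<theta>\<in>simplices n B. \<rho> (Cmp Delta_plus e \<theta>)) \<theta>"
    using \<theta> simplices_Cmp[OF B \<theta> \<phi>] famD(3)[OF \<rho> sub[OF \<theta>], of \<phi> k] \<phi> Delta.Cmp_assoc[OF \<phi> \<theta>' e]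
    by simp
qed simp

text \<open>A simplex of the larger complex outside \<open>K\<close> has vertex set \<open>N\<close>, hence factors uniquely through the
  face inclusion \<open>e\<close> by a map \<open>\<phi>\<close>; the value there has to be the corresponding degeneracy of \<open>x\<close>. The
  boundary condition says that this rule and \<open>\<rho>\<close> agree on the simplices \<open>e \<circ> \<phi>\<close> that lie in \<open>K\<close>.\<close>

lemma fam_extend_simplex:
  assumes X: "simplicial_object C X" and K: "complex M K" and N: "N \<notin> K" "\<And>w. w \<subset> N \<Longrightarrow> w \<in> K"
    and e: "e \<in> Hom Delta n M" "inj_on (dapp e) {..<n}" "verts e = N"
    and \<rho>: "\<rho> \<in> fam X M K Z" and x: "x \<in> Hom C Z (omap X n)"
    and bd: "\<And>\<theta>. \<theta> \<in> simplices n {v. v \<subset> {..<n}} \<Longrightarrow> amap X \<theta> \<cdot> x = \<rho> (Cmp Delta_plus e \<theta>)"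
  obtains \<rho>' where "\<rho>' \<in> fam X M (insert N K) Z" "restrict \<rho>' (simplices M K) = \<rho>" "\<rho>' e = x"
    "\<And>\<phi> k. \<phi> \<in> Hom Delta k n \<Longrightarrow> \<rho>' (Cmp Delta_plus e \<phi>) = amap X \<phi> \<cdot> x"
proof -
  note e' = Hom_DeltaD(5)[OF e(1)]
  define fac where "fac \<theta> = (SOME \<phi>. \<phi> \<in> Hom Delta_plus (fst \<theta>) n \<and> Cmp Delta_plus e \<phi> = \<theta>)" for \<theta>
  define \<rho>' where "\<rho>' = (\<lambda>\<theta>\<in>simplices M (insert N K). if verts \<theta> = N then amap X (fac \<theta>) \<cdot> x else \<rho> \<theta>)"
  have new: "\<exists>\<psi>. \<psi> \<in> Hom Delta (fst \<theta>) n \<and> Cmp Delta_plus e \<psi> = \<theta>"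
    if \<theta>: "\<theta> \<in> Hom Delta (fst \<theta>) M" "verts \<theta> = N" for \<theta>
  proof -
    obtain \<psi> where "\<psi> \<in> Hom Delta_plus (fst \<theta>) n" "Cmp Delta_plus e \<psi> = \<theta>"
      using face_factor[OF e' e(2) Hom_DeltaD(5)[OF \<theta>(1)]] \<theta>(2) e(3) by blast
    thus ?thesis using Hom_Delta_pos Hom_DeltaD(3)[OF \<theta>(1)] by blast
  qed
  have on_e: "\<rho>' (Cmp Delta_plus e \<phi>) = amap X \<phi> \<cdot> x" if \<phi>: "\<phi> \<in> Hom Delta k n" for \<phi> k
  proof -
    note \<phi>' = Hom_DeltaD(5)[OF \<phi>] and f1 = Hom_DeltaD(1)[OF \<phi>]
    have c: "Cmp Delta_plus e \<phi> \<in> Hom Delta k M" using Delta.Cmp_in[OF \<phi> e(1)] by simp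
    have f2: "fst (Cmp Delta_plus e \<phi>) = k" using f1 by simp
    show ?thesis
    proof (cases "verts (Cmp Delta_plus e \<phi>) = N")
      case True
      have "fac (Cmp Delta_plus e \<phi>) = \<phi>"
        unfolding fac_def f2 using \<phi>' face_cancel[OF e' e(2)] by (intro some_equality) blast+
      thus ?thesis using True c f2 by (simp add: \<rho>'_def simplices_iff)
    next
      case False
      have "verts (Cmp Delta_plus e \<phi>) \<subset> N"
        using verts_Cmp_subset[OF \<phi>' e'] False e(3) by blast
      hence K': "Cmp Delta_plus e \<phi> \<in> simplices M (insert N K)"
        using N(2) c f2 by (simp add: simplices_iff)
      have "verts \<phi> \<noteq> {..<n}" using False verts_Cmp[OF \<phi>' e'] verts_eq[OF e'] e(3) by auto
      hence "\<phi> \<in> simplices n {v. v \<subset> {..<n}}"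
        using \<phi> f1 verts_subset[OF \<phi>'] by (auto simp: simplices_iff)
      thus ?thesis using bd K' False by (simp add: \<rho>'_def)
    qed
  qed
  have on_K: "\<rho>' \<theta> = \<rho> \<theta>" if "\<theta> \<in> simplices M K" for \<theta>
  proof -
    have "verts \<theta> \<noteq> N" using simplicesD(2)[OF that] N(1) by blast
    thus ?thesis using that simplices_mono[of K "insert N K" M] by (auto simp: \<rho>'_def)
  qed
  have cases: "\<theta> \<in> simplices M K \<or> (\<exists>\<psi>. \<psi> \<in> Hom Delta (fst \<theta>) n \<and> Cmp Delta_plus e \<psi> = \<theta>)"
    if "\<theta> \<in> simplices M (insert N K)" for \<theta>
    using simplicesD(1,2)[OF that] new[of \<theta>] by (auto simp: simplices_iff)
  have "\<rho>' \<in> fam X M (insert N K) Z"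
  proof (rule famI)
    show "\<rho>' \<in> extensional (simplices M (insert N K))" by (simp add: \<rho>'_def)
    fix \<theta> assume \<theta>: "\<theta> \<in> simplices M (insert N K)"
    show "\<rho>' \<theta> \<in> Hom C Z (omap X (fst \<theta>))"
      using cases[OF \<theta>]
    proof (elim disjE exE conjE)
      show ?thesis if "\<theta> \<in> simplices M K" using on_K[OF that] famD(2)[OF \<rho> that] by simp
      show ?thesis if "\<psi> \<in> Hom Delta (fst \<theta>) n" "Cmp Delta_plus e \<psi> = \<theta>" for \<psi>
        using on_e[OF that(1)] Cmp_in[OF x sobj_amap[OF X that(1)]] that(2) by simp
    qed
    fix k \<phi> assume \<phi>: "\<phi> \<in> Hom Delta k (fst \<theta>)"
    show "\<rho>' (Cmp Delta_plus \<theta> \<phi>) = amap X \<phi> \<cdot> \<rho>' \<theta>"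
      using cases[OF \<theta>]
    proof (elim disjE exE conjE)
      show ?thesis if "\<theta> \<in> simplices M K"
        using on_K[OF that] on_K[OF simplices_Cmp[OF K that \<phi>]] famD(3)[OF \<rho> that \<phi>] by simp
      fix \<psi> assume \<psi>: "\<psi> \<in> Hom Delta (fst \<theta>) n" "Cmp Delta_plus e \<psi> = \<theta>"
      have "Cmp Delta_plus \<psi> \<phi> \<in> Hom Delta k n" using Delta.Cmp_in[OF \<phi> \<psi>(1)] by simp
      from on_e[OF this] show ?thesis
        using on_e[OF \<psi>(1)] \<psi>(2) Delta.Cmp_assoc[OF \<phi> \<psi>(1) e(1)] sobj_Cmp[OF X \<phi> \<psi>(1)]
          Cmp_assoc[OF x sobj_amap[OF X \<psi>(1)] sobj_amap[OF X \<phi>]] by simp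
    qed
  qed
  moreover have "restrict \<rho>' (simplices M K) = \<rho>"
    by (rule extensionalityI[OF _ famD(1)[OF \<rho>]]) (use on_K in auto)
  moreover have "\<rho>' e = x"
    using on_e[OF Delta.Idt_in[of n, simplified]] Hom_DeltaD(3)[OF e(1)] Delta.Cmp_Idt[OF e(1)]
      sobj_Idt[OF X] Idt_Cmp[OF x] by simp
  ultimately show ?thesis using that on_e by blast
qed

end

context extensive_site begin

text \<open>Pointwise, a family on the larger complex is a family on \<open>K\<close> and a simplex \<open>x\<close> of \<open>X\<close> with
  prescribed boundary and prescribed image in \<open>Y\<close>: the restriction is a pullback of
  \<open>X\<^sub>n \<rightarrow> Hom(\<partial>\<Delta>\<^sup>n \<rightarrow> \<Delta>\<^sup>n, X \<rightarrow> Y)\<close>.\<close>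

lemma attach_simplex:
  assumes X: "simplicial_object C X" and Y: "simplicial_object C Y" and f: "simplicial_map C X Y f"
    and lift: "\<forall>n>0. cover_map (yo C (omap X n)) (Rel X Y f n {v. v \<subset> {..<n}})
      (rel_pt X f n {v. v \<subset> {..<n}})"
    and K: "complex M K" and K': "complex M (insert N K)" and L: "complex M L" and KL: "insert N K \<subseteq> L"
    and N: "N \<notin> K" "\<And>w. w \<subset> N \<Longrightarrow> w \<in> K"
    and rep: "representable (Fam X Y f M K L)"
  shows "cover_map (Fam X Y f M (insert N K) L) (Fam X Y f M K L) (Fam_res M K L)"
proof -
  have NM: "N \<subseteq> {..<M}" "N \<noteq> {}" using complexD(1)[OF K', of N] complexD(2)[OF K] N(1) by auto
  obtain e where e0: "e \<in> Hom Delta_plus (card N) M" "inj_on (dapp e) {..<card N}" "verts e = N"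
    using face_exists[OF NM(1)] .
  define n where "n = card N"
  have n0: "0 < n" unfolding n_def using NM finite_subset[OF NM(1)] by (simp add: card_gt_0_iff)
  have e: "e \<in> Hom Delta n M" "inj_on (dapp e) {..<n}" "verts e = N"
    using e0 Hom_Delta_pos[OF e0(1)] n0 unfolding n_def by auto
  note e' = Hom_DeltaD(5)[OF e(1)] and fe = Hom_DeltaD(1)[OF e(1)]
  let ?B = "{v. v \<subset> {..<n}}"
  have B: "complex n ?B" using complex_boundary[of "n - 1"] n0 by (simp flip: lessThan_Suc_atMost)
  have KL': "K \<subseteq> L" using KL by blast
  have eK': "e \<in> simplices M (insert N K)" using e fe by (simp add: simplices_iff)
  have eL: "e \<in> simplices M L" using eK' simplices_mono[OF KL] by blast
  have sub: "Cmp Delta_plus e \<theta> \<in> simplices M K" if \<theta>: "\<theta> \<in> simplices n ?B" for \<theta>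
  proof -
    note t = simplicesD[OF \<theta>]
    note t' = Hom_DeltaD(5)[OF t(1)]
    have "dapp e ` verts \<theta> \<subset> dapp e ` {..<n}"
      using t(2) inj_on_image_eq_iff[OF e(2), of "verts \<theta>" "{..<n}"] by auto
    hence "verts (Cmp Delta_plus e \<theta>) \<subset> N" using verts_Cmp[OF t' e'] verts_eq[OF e'] e(3) by simp
    moreover have "Cmp Delta_plus e \<theta> \<in> Hom Delta (fst \<theta>) M" using Delta.Cmp_in[OF t(1) e(1)] by simp
    ultimately show ?thesis using N(2) by (simp add: simplices_iff)
  qed
  define s :: "'o \<Rightarrow> (darr \<Rightarrow> 'a) \<times> (darr \<Rightarrow> 'a) \<Rightarrow> (darr \<Rightarrow> 'a) \<times> 'a" where
    "s Z = (\<lambda>(\<rho>, \<sigma>). (\<lambda>\<theta>\<in>simplices n ?B. \<rho> (Cmp Delta_plus e \<theta>), \<sigma> e))" for Z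
  define s' :: "'o \<Rightarrow> (darr \<Rightarrow> 'a) \<times> (darr \<Rightarrow> 'a) \<Rightarrow> 'a" where "s' Z = (\<lambda>(\<rho>, \<sigma>). \<rho> e)" for Z
  show ?thesis
  proof (rule cover_map_pullback[OF lift[rule_format, OF n0], of _ _ s _ s'])
    show "presheaf (Fam X Y f M (insert N K) L)" by (rule Fam_presheaf[OF X Y f K' L KL])
    show "presheaf (Fam X Y f M K L)" by (rule Fam_presheaf[OF X Y f K L KL'])
    show "representable (Fam X Y f M K L)" by (rule rep)
    show "natural (Fam X Y f M (insert N K) L) (Fam X Y f M K L) (Fam_res M K L)"
      by (rule Fam_res_natural[OF K L KL']) auto
    show "natural (Fam X Y f M K L) (Rel X Y f n ?B) s"
    proof (rule naturalI)
      fix Z x assume x: "x \<in> elts (Fam X Y f M K L) Z"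
      obtain \<rho> \<sigma> where xe: "x = (\<rho>, \<sigma>)" by (cases x)
      have \<rho>: "\<rho> \<in> fam X M K Z" and \<sigma>: "\<sigma> \<in> fam Y M L Z"
        and eq: "\<And>\<theta>. \<theta> \<in> simplices M K \<Longrightarrow> f (fst \<theta>) \<cdot> \<rho> \<theta> = \<sigma> \<theta>"
        using x unfolding xe Fam_elts by simp_all
      have "f (fst \<theta>) \<cdot> \<rho> (Cmp Delta_plus e \<theta>) = amap Y \<theta> \<cdot> \<sigma> e" if \<theta>: "\<theta> \<in> simplices n ?B" for \<theta>
        using eq[OF sub[OF \<theta>]] famD(3)[OF \<sigma> eL] simplicesD(1)[OF \<theta>] fe by simp
      thus "s Z x \<in> elts (Rel X Y f n ?B) Z"
        unfolding xe s_def prod.case Rel_elts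
        using fam_pullback[OF \<rho> e(1) B sub] famD(2)[OF \<sigma> eL] fe by simp
      fix Z' h
      show "s Z' (restr (Fam X Y f M K L) h x) = restr (Rel X Y f n ?B) h (s Z x)"
        unfolding xe s_def Fam_restr prod.case Rel_restr using sub eL by (auto intro!: restrict_ext)
    qed
    show "natural (Fam X Y f M (insert N K) L) (yo C (omap X n)) s'"
    proof (rule naturalI)
      fix Z x assume x: "x \<in> elts (Fam X Y f M (insert N K) L) Z"
      obtain \<rho> \<sigma> where xe: "x = (\<rho>, \<sigma>)" by (cases x)
      have \<rho>: "\<rho> \<in> fam X M (insert N K) Z" using x unfolding xe Fam_elts by simp
      show "s' Z x \<in> elts (yo C (omap X n)) Z"
        using famD(2)[OF \<rho> eK'] fe unfolding xe s'_def by (simp add: yo_def)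
      fix Z' h
      show "s' Z' (restr (Fam X Y f M (insert N K) L) h x) = restr (yo C (omap X n)) h (s' Z x)"
        unfolding xe s'_def Fam_restr using eK' by (simp add: yo_def)
    qed
  next
    fix Z x assume x: "x \<in> elts (Fam X Y f M (insert N K) L) Z"
    obtain \<rho> \<sigma> where xe: "x = (\<rho>, \<sigma>)" by (cases x)
    have \<rho>: "\<rho> \<in> fam X M (insert N K) Z"
      and eq: "\<And>\<theta>. \<theta> \<in> simplices M (insert N K) \<Longrightarrow> f (fst \<theta>) \<cdot> \<rho> \<theta> = \<sigma> \<theta>"
      using x unfolding xe Fam_elts by simp_all
    have "amap X \<theta> \<cdot> \<rho> e = \<rho> (Cmp Delta_plus e \<theta>)" if \<theta>: "\<theta> \<in> simplices n ?B" for \<theta>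
      using famD(3)[OF \<rho> eK'] simplicesD(1)[OF \<theta>] fe by simp
    thus "rel_pt X f n ?B Z (s' Z x) = s Z (Fam_res M K L Z x)"
      using eq[OF eK'] fe sub eL unfolding xe s'_def s_def rel_pt_def Fam_res_def
      by (auto intro!: restrict_ext)
  next
    fix Z x y assume x: "x \<in> elts (Fam X Y f M (insert N K) L) Z"
      and y: "y \<in> elts (Fam X Y f M (insert N K) L) Z"
      and ee: "s' Z x = s' Z y" and ek: "Fam_res M K L Z x = Fam_res M K L Z y"
    obtain \<rho> \<sigma> \<rho>' \<sigma>' where xe: "x = (\<rho>, \<sigma>)" "y = (\<rho>', \<sigma>')" by (cases x; cases y)
    have \<rho>: "\<rho> \<in> fam X M (insert N K) Z" "\<rho>' \<in> fam X M (insert N K) Z"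
      and \<sigma>: "\<sigma> \<in> fam Y M L Z" "\<sigma>' \<in> fam Y M L Z"
      using x y unfolding xe Fam_elts by simp_all
    have r: "restrict \<rho> (simplices M K) = restrict \<rho>' (simplices M K)"
      and t: "restrict \<sigma> (simplices M L) = restrict \<sigma>' (simplices M L)" and e1: "\<rho> e = \<rho>' e"
      using ee ek unfolding xe s'_def Fam_res_def by simp_all
    have "\<rho> = \<rho>'"
    proof (rule fam_eqI[OF \<rho>])
      fix \<theta> assume \<theta>: "\<theta> \<in> simplices M (insert N K)"
      show "\<rho> \<theta> = \<rho>' \<theta>"
      proof (cases "verts \<theta> = N")
        case True
        obtain \<phi> where \<phi>: "\<phi> \<in> Hom Delta_plus (fst \<theta>) n" "Cmp Delta_plus e \<phi> = \<theta>"
          using face_factor[OF e' e(2) Hom_DeltaD(5)[OF simplicesD(1)[OF \<theta>]]] True e(3) by blast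
        have "\<phi> \<in> Hom Delta (fst \<theta>) (fst e)"
          using Hom_Delta_pos[OF \<phi>(1) simplicesD(3)[OF \<theta>]] fe by simp
        thus ?thesis using famD(3)[OF \<rho>(1) eK'] famD(3)[OF \<rho>(2) eK'] \<phi>(2) e1 by metis
      next
        case False
        hence "\<theta> \<in> simplices M K" using \<theta> by (auto simp: simplices_iff)
        thus ?thesis using fun_cong[OF r, of \<theta>] by simp
      qed
    qed
    moreover have "\<sigma> = \<sigma>'"
    proof (rule fam_eqI[OF \<sigma>])
      show "\<sigma> \<theta> = \<sigma>' \<theta>" if "\<theta> \<in> simplices M L" for \<theta> using fun_cong[OF t, of \<theta>] that by simp
    qed
    ultimately show "x = y" unfolding xe by simp
  next
    fix Z x y assume x: "x \<in> elts (yo C (omap X n)) Z" and y: "y \<in> elts (Fam X Y f M K L) Z"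
      and eq: "rel_pt X f n ?B Z x = s Z y"
    have xH: "x \<in> Hom C Z (omap X n)" using x by (simp add: yo_def)
    obtain \<rho> \<sigma> where ye: "y = (\<rho>, \<sigma>)" by (cases y)
    have \<rho>: "\<rho> \<in> fam X M K Z" and \<sigma>: "\<sigma> \<in> fam Y M L Z"
      and feq: "\<And>\<theta>. \<theta> \<in> simplices M K \<Longrightarrow> f (fst \<theta>) \<cdot> \<rho> \<theta> = \<sigma> \<theta>"
      using y unfolding ye Fam_elts by simp_all
    have eq1: "(\<lambda>\<theta>\<in>simplices n ?B. amap X \<theta> \<cdot> x) = (\<lambda>\<theta>\<in>simplices n ?B. \<rho> (Cmp Delta_plus e \<theta>))"
      and eq2: "f n \<cdot> x = \<sigma> e"
      using eq unfolding ye rel_pt_def s_def by simp_all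
    have bd: "amap X \<theta> \<cdot> x = \<rho> (Cmp Delta_plus e \<theta>)" if "\<theta> \<in> simplices n ?B" for \<theta>
      using fun_cong[OF eq1, of \<theta>] that by simp
    obtain \<rho>' where \<rho>': "\<rho>' \<in> fam X M (insert N K) Z" "restrict \<rho>' (simplices M K) = \<rho>" "\<rho>' e = x"
      "\<And>\<phi> k. \<phi> \<in> Hom Delta k n \<Longrightarrow> \<rho>' (Cmp Delta_plus e \<phi>) = amap X \<phi> \<cdot> x"
      by (rule fam_extend_simplex[OF X K N e \<rho> xH bd]) blast+
    have "f (fst \<theta>) \<cdot> \<rho>' \<theta> = \<sigma> \<theta>" if \<theta>: "\<theta> \<in> simplices M (insert N K)" for \<theta>
    proof (cases "verts \<theta> = N")
      case True
      obtain \<phi> where \<phi>: "\<phi> \<in> Hom Delta_plus (fst \<theta>) n" "Cmp Delta_plus e \<phi> = \<theta>"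
        using face_factor[OF e' e(2) Hom_DeltaD(5)[OF simplicesD(1)[OF \<theta>]]] True e(3) by blast
      have \<phi>': "\<phi> \<in> Hom Delta (fst \<theta>) n" using Hom_Delta_pos[OF \<phi>(1) simplicesD(3)[OF \<theta>]] .
      have "f (fst \<theta>) \<cdot> (amap X \<phi> \<cdot> x) = amap Y \<phi> \<cdot> (f n \<cdot> x)"
        using Cmp_assoc[OF xH sobj_amap[OF X \<phi>'] smap_Hom[OF f simplicesD(3)[OF \<theta>]]]
          Cmp_assoc[OF xH smap_Hom[OF f n0] sobj_amap[OF Y \<phi>']] smap_natural[OF f \<phi>'] by simp
      moreover have "amap Y \<phi> \<cdot> \<sigma> e = \<sigma> \<theta>" using famD(3)[OF \<sigma> eL, of \<phi>] \<phi>(2) \<phi>' fe by simp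
      ultimately show ?thesis using \<rho>'(4)[OF \<phi>'] \<phi>(2) eq2 by simp
    next
      case False
      hence \<theta>K: "\<theta> \<in> simplices M K" using \<theta> by (auto simp: simplices_iff)
      thus ?thesis using fun_cong[OF \<rho>'(2), of \<theta>] feq[OF \<theta>K] by simp
    qed
    hence "(\<rho>', \<sigma>) \<in> elts (Fam X Y f M (insert N K) L) Z" unfolding Fam_elts using \<rho>'(1) \<sigma> by simp
    moreover have "restrict \<sigma> (simplices M L) = \<sigma>" using famD(1)[OF \<sigma>] by (rule extensional_restrict)
    ultimately show "\<exists>z \<in> elts (Fam X Y f M (insert N K) L) Z. s' Z z = x \<and> Fam_res M K L Z z = y"
      using \<rho>'(2,3) unfolding ye s'_def Fam_res_def by (intro bexI[of _ "(\<rho>', \<sigma>)"]) simp_all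
  qed
qed

lemma minimal_new_face:
  assumes K: "complex M K" and K': "complex M K'" and sub: "K \<subset> K'"
  obtains N where "N \<in> K'" "N \<notin> K" "\<And>w. w \<subset> N \<Longrightarrow> w \<in> K" "complex M (insert N K)"
proof -
  obtain N where N: "N \<in> K' - K" and min: "\<And>w. w \<in> K' - K \<Longrightarrow> card N \<le> card w"
  proof -
    have "K' - K \<noteq> {}" using sub by blast
    then obtain v where "v \<in> K' - K" by blast
    from ex_has_least_nat[of "\<lambda>v. v \<in> K' - K", OF this, of card] that show ?thesis by blast
  qed
  have NM: "N \<subseteq> {..<M}" using complexD(1)[OF K'] N by simp
  hence "finite N" by (rule finite_subset) simp
  have w: "w \<in> K" if "w \<subset> N" for w
  proof (rule ccontr)
    assume "w \<notin> K"
    moreover have "w \<in> K'" using complexD(3)[OF K', of N w] N that by simp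
    ultimately show False using min[of w] psubset_card_mono[OF \<open>finite N\<close> that] by simp
  qed
  have "complex M (insert N K)"
    unfolding complex_def
  proof (intro conjI ballI allI impI)
    show "insert N K \<subseteq> Pow {..<M}" "{} \<in> insert N K" using complexD(1,2)[OF K] NM by auto
    fix v u assume v: "v \<in> insert N K" and u: "u \<subseteq> v"
    show "u \<in> insert N K"
    proof (cases "u = N \<or> v \<noteq> N")
      case True
      thus ?thesis using v complexD(3)[OF K _ u] by auto
    next
      case False
      hence "u \<subset> N" using u by auto
      thus ?thesis using w by simp
    qed
  qed
  thus ?thesis using that N w by blast
qed

text \<open>The missing faces are added in order of dimension, so that the boundary of each is present when
  its turn comes. Representability of \<open>Hom(K \<rightarrow> L, X \<rightarrow> Y)\<close> is inherited at every step.\<close>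

lemma attach_subcomplex:
  assumes X: "simplicial_object C X" and Y: "simplicial_object C Y" and f: "simplicial_map C X Y f"
    and lift: "\<forall>n>0. cover_map (yo C (omap X n)) (Rel X Y f n {v. v \<subset> {..<n}})
      (rel_pt X f n {v. v \<subset> {..<n}})"
    and L: "complex M L"
  shows "complex M K \<Longrightarrow> complex M K' \<Longrightarrow> K \<subseteq> K' \<Longrightarrow> K' \<subseteq> L \<Longrightarrow> representable (Fam X Y f M K L) \<Longrightarrow>
    cover_map (Fam X Y f M K' L) (Fam X Y f M K L) (Fam_res M K L)"
proof (induction "card (K' - K)" arbitrary: K rule: less_induct)
  case less
  show ?case
  proof (cases "K = K'")
    case True
    have KL: "K \<subseteq> L" using less by blast
    have P: "presheaf (Fam X Y f M K L)" by (rule Fam_presheaf[OF X Y f less.prems(1) L KL])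
    have id: "Fam_res M K L Z x = x" if "x \<in> elts (Fam X Y f M K L) Z" for Z x
    proof -
      obtain \<rho> \<sigma> where x: "x = (\<rho>, \<sigma>)" by (cases x)
      have "\<rho> \<in> extensional (simplices M K)" "\<sigma> \<in> extensional (simplices M L)"
        using that famD(1) unfolding x Fam_elts by blast+
      thus ?thesis unfolding x Fam_res_def by (simp add: extensional_restrict)
    qed
    have "nat_bij (Fam X Y f M K L) (Fam X Y f M K L) (Fam_res M K L)"
    proof (rule nat_bijI)
      show "natural (Fam X Y f M K L) (Fam X Y f M K L) (Fam_res M K L)"
        by (rule Fam_res_natural[OF less.prems(1) L KL]) auto
    next
      fix Z x x' assume "x \<in> elts (Fam X Y f M K L) Z" "x' \<in> elts (Fam X Y f M K L) Z"
        "Fam_res M K L Z x = Fam_res M K L Z x'"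
      thus "x = x'" using id by metis
    next
      fix Z y assume "y \<in> elts (Fam X Y f M K L) Z"
      thus "\<exists>x \<in> elts (Fam X Y f M K L) Z. Fam_res M K L Z x = y" using id by metis
    qed
    thus ?thesis using nat_bij_cover_map P less.prems(5) True by blast
  next
    case False
    then obtain N where N: "N \<in> K'" "N \<notin> K" "\<And>w. w \<subset> N \<Longrightarrow> w \<in> K" "complex M (insert N K)"
      using minimal_new_face[OF less.prems(1,2)] less.prems(3) by (metis psubsetI)
    have sub: "insert N K \<subseteq> K'" "insert N K \<subseteq> L" using N(1) less.prems by auto
    have a: "cover_map (Fam X Y f M (insert N K) L) (Fam X Y f M K L) (Fam_res M K L)"
      by (rule attach_simplex[OF X Y f lift less.prems(1) N(4) L sub(2) N(2,3) less.prems(5)])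
    have "finite K'" using complexD(4)[OF less.prems(2)] .
    hence "card (K' - insert N K) < card (K' - K)"
      using N(1,2) by (intro psubset_card_mono) auto
    from less.hyps[OF this N(4) less.prems(2) sub(1) less.prems(4) cover_mapD(4)[OF a]]
    have b: "cover_map (Fam X Y f M K' L) (Fam X Y f M (insert N K) L) (Fam_res M (insert N K) L)" .
    have "simplices M K \<subseteq> simplices M (insert N K)" by (rule simplices_mono) auto
    hence "Fam_res M K L Z x = Fam_res M K L Z (Fam_res M (insert N K) L Z x)" for Z :: 'o and x
      unfolding Fam_res_def by (auto split: prod.splits simp: Int_absorb1 Int_absorb2)
    thus ?thesis using cover_map_cong[OF cover_map_comp[OF b a]] by blast
  qed
qed

lemma const_sobj: "simplicial_object C (const_fctr C one)"
proof -
  have "one \<in> Obj C" using one_terminal unfolding terminal_def by blast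
  hence "Idt C one \<in> Hom C one one" "Idt C one \<cdot> Idt C one = Idt C one"
    using Idt_in Idt_Cmp by blast+
  thus ?thesis
    unfolding simplicial_object_def is_fctr_def op_cat_def const_fctr_def
    using \<open>one \<in> Obj C\<close> by simp
qed

lemma to_one_unique: "h \<in> Hom C Z one \<Longrightarrow> k \<in> Hom C Z one \<Longrightarrow> h = k"
  using one_terminal HomD(4) unfolding terminal_def by blast

lemma bang_in: "Z \<in> Obj C \<Longrightarrow> bang C one Z \<in> Hom C Z one"
  using one_terminal theI'[of "\<lambda>h. h \<in> Hom C Z one"] unfolding terminal_def bang_def by blast

text \<open>Over the terminal object the component of a relative family in the base carries no information.\<close>

lemma Kan_object_cover_map:
  assumes Y: "simplicial_object C Y" and L: "complex (Suc m) L"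
    and b: "simplicial_map C Y (const_fctr C one) (\<lambda>p. bang C one (omap Y p))"
    and kan: "rel_cond C (\<lambda>c. c \<in> T) (subc m L) m Y (const_fctr C one) (\<lambda>p. bang C one (omap Y p))"
  shows "cover_map (yo C (omap Y (Suc m))) (FamP Y (Suc m) L) (\<lambda>Z g. \<lambda>\<theta>\<in>simplices (Suc m) L. amap Y \<theta> \<cdot> g)"
proof -
  let ?R = "Rel Y (const_fctr C one) (\<lambda>p. bang C one (omap Y p)) (Suc m) L"
  note c = kan[unfolded rel_cond_iff_cover_map[OF Y const_sobj b L]]
  have "nat_bij ?R (FamP Y (Suc m) L) (\<lambda>Z. fst)"
  proof (rule nat_bijI)
    show "natural ?R (FamP Y (Suc m) L) (\<lambda>Z. fst)"
      by (rule naturalI) (auto simp: Rel_def FamP_def)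
  next
    fix Z x x' assume "x \<in> elts ?R Z" "x' \<in> elts ?R Z" "fst x = fst x'"
    thus "x = x'" using to_one_unique by (cases x; cases x') (auto simp: Rel_elts const_fctr_def)
  next
    fix Z y assume Z: "Z \<in> Obj C" and "y \<in> elts (FamP Y (Suc m) L) Z"
    hence y: "y \<in> fam Y (Suc m) L Z" by (simp add: FamP_def)
    have "(y, bang C one Z) \<in> elts ?R Z"
      unfolding Rel_elts
    proof (intro conjI ballI y)
      show bZ: "bang C one Z \<in> Hom C Z (omap (const_fctr C one) (Suc m))"
        using bang_in[OF Z] by (simp add: const_fctr_def)
      fix \<theta> assume \<theta>: "\<theta> \<in> simplices (Suc m) L"
      show "bang C one (omap Y (fst \<theta>)) \<cdot> y \<theta> = amap (const_fctr C one) \<theta> \<cdot> bang C one Z"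
        using Cmp_in[OF famD(2)[OF y \<theta>] smap_Hom[OF b simplicesD(3)[OF \<theta>]]]
          Cmp_in[OF bZ sobj_amap[OF const_sobj simplicesD(1)[OF \<theta>]]] to_one_unique
        by (simp add: const_fctr_def)
    qed
    thus "\<exists>x \<in> elts ?R Z. fst x = y" by force
  qed
  from nat_bij_cover_map[OF this cover_mapD(2)[OF c] FamP_presheaf[OF Y L]] cover_mapD(5)[OF c]
  have "cover_map ?R (FamP Y (Suc m) L) (\<lambda>Z. fst)" by blast
  from cover_map_comp[OF c this] show ?thesis
    by (rule cover_map_cong) (simp add: rel_pt_def)
qed

text \<open>The simplices of \<open>X\<close> outside \<open>L\<close> are forgotten first, over the whole simplex of \<open>Y\<close>, by attaching
  faces; the simplices of \<open>Y\<close> outside \<open>L\<close> are forgotten afterwards, which is a pullback of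
  \<open>Y\<^sub>m \<rightarrow> Hom(L, Y)\<close>. This order covers at once the two possibilities, that \<open>L\<close> contains the
  face \<open>A\<close> and that it does not.\<close>

lemma relative_horn_cover:
  assumes X: "simplicial_object C X" and Y: "simplicial_object C Y" and f: "simplicial_map C X Y f"
    and lift: "\<forall>n>0. cover_map (yo C (omap X n)) (Rel X Y f n {v. v \<subset> {..<n}})
      (rel_pt X f n {v. v \<subset> {..<n}})"
    and M: "0 < M" and L: "complex M L" and A: "A \<subseteq> {..<M}"
    and kan: "cover_map (yo C (omap Y M)) (FamP Y M L) (\<lambda>Z g. \<lambda>\<theta>\<in>simplices M L. amap Y \<theta> \<cdot> g)"
  shows "cover_map (Fam X Y f M (Pow A) (Pow {..<M})) (Fam X Y f M (L \<inter> Pow A) L)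
    (Fam_res M (L \<inter> Pow A) L)"
proof -
  let ?F = "Pow {..<M}" and ?K = "L \<inter> Pow A"
  note F = complex_Pow[of M] and K = complex_Int[OF L complex_face[OF A]]
  have LF: "L \<subseteq> ?F" by (rule complex_subset_Pow[OF L])
  have KF: "?K \<subseteq> ?F" "?K \<subseteq> L" "?K \<subseteq> Pow A" "Pow A \<subseteq> ?F" using LF A by auto
  have iF: "Idt Delta_plus M \<in> simplices M ?F" by (rule Idt_simplices[OF M]) simp
  have fi: "fst (Idt Delta_plus M) = M" using Hom_Delta_plusD[OF Idt_Delta_plus] by blast
  have none: "fam X M {{}} Z = {\<lambda>_. undefined}" for Z
    unfolding fam_def simplices_empty by auto
  (* the X-part of a family on the empty complex is a function on no simplices *)
  have snd_bij: "nat_bij (Fam X Y f M {{}} L') (FamP Y M L') (\<lambda>Z. snd)" if "complex M L'" for L'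
  proof (rule nat_bijI)
    show "natural (Fam X Y f M {{}} L') (FamP Y M L') (\<lambda>Z. snd)"
      by (rule naturalI) (auto simp: Fam_def FamP_def)
  next
    fix Z x x' assume "x \<in> elts (Fam X Y f M {{}} L') Z" "x' \<in> elts (Fam X Y f M {{}} L') Z" "snd x = snd x'"
    thus "x = x'" by (cases x; cases x') (auto simp: Fam_elts none)
  next
    fix Z y assume "y \<in> elts (FamP Y M L') Z"
    hence "(\<lambda>_. undefined, y) \<in> elts (Fam X Y f M {{}} L') Z"
      unfolding Fam_elts none simplices_empty by (simp add: FamP_def)
    thus "\<exists>x \<in> elts (Fam X Y f M {{}} L') Z. snd x = y" by force
  qed
  have rep: "representable (Fam X Y f M {{}} L')" if L': "complex M L'" and r: "representable (FamP Y M L')" for L'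
  proof -
    have "{{}} \<subseteq> L'" using complexD(2)[OF L'] by simp
    hence "presheaf (Fam X Y f M {{}} L')" by (rule Fam_presheaf[OF X Y f complex_empty L'])
    thus ?thesis
      using universal_nat_bij_rev[OF snd_bij[OF L'] _ FamP_presheaf[OF Y L']] r
      unfolding representable_def by blast
  qed
  have yon: "nat_bij (yo C (omap Y M)) (FamP Y M ?F) (\<lambda>Z g. \<lambda>\<theta>\<in>simplices M ?F. amap Y \<theta> \<cdot> g)"
  proof (rule nat_bijI[OF FamP_point_natural[OF Y F]])
    fix Z x x' assume "x \<in> elts (yo C (omap Y M)) Z" "x' \<in> elts (yo C (omap Y M)) Z"
      and eq: "(\<lambda>\<theta>\<in>simplices M ?F. amap Y \<theta> \<cdot> x) = (\<lambda>\<theta>\<in>simplices M ?F. amap Y \<theta> \<cdot> x')"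
    hence "x \<in> Hom C Z (omap Y M)" "x' \<in> Hom C Z (omap Y M)" by (simp_all add: yo_def)
    thus "x = x'" using fun_cong[OF eq, of "Idt Delta_plus M"] iF sobj_Idt[OF Y M] Idt_Cmp by simp
  next
    fix Z y assume "y \<in> elts (FamP Y M ?F) Z"
    hence y: "y \<in> fam Y M ?F Z" by (simp add: FamP_def)
    have "(\<lambda>\<theta>\<in>simplices M ?F. amap Y \<theta> \<cdot> y (Idt Delta_plus M)) = y"
      by (rule extensionalityI[OF _ famD(1)[OF y]]) (use fam_Idt[OF y _ M] in auto)
    thus "\<exists>x \<in> elts (yo C (omap Y M)) Z. (\<lambda>\<theta>\<in>simplices M ?F. amap Y \<theta> \<cdot> x) = y"
      using famD(2)[OF y iF] fi by (auto simp: yo_def)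
  qed
  have "representable (FamP Y M ?F)"
    unfolding representable_def
    using universal_nat_bij[OF yon yo_presheaf yo_universal[OF sobj_Obj[OF Y M]]] by blast
  hence repF: "representable (Fam X Y f M {{}} ?F)" by (rule rep[OF F])
  have repL: "representable (Fam X Y f M {{}} L)" by (rule rep[OF L cover_mapD(5)[OF kan]])
  have e: "{{}} \<subseteq> ?K" using complexD(2)[OF K] by simp
  note att = attach_subcomplex[OF X Y f lift]
  have rKF: "representable (Fam X Y f M ?K ?F)"
    using cover_mapD(4)[OF att[OF F complex_empty K e KF(1) repF]] .
  have rKL: "representable (Fam X Y f M ?K L)"
    using cover_mapD(4)[OF att[OF L complex_empty K e KF(2) repL]] .
  have c1: "cover_map (Fam X Y f M (Pow A) ?F) (Fam X Y f M ?K ?F) (Fam_res M ?K ?F)"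
    by (rule att[OF F K complex_face[OF A] KF(3) KF(4) rKF])
  have c2: "cover_map (Fam X Y f M ?K ?F) (Fam X Y f M ?K L) (Fam_res M ?K L)"
  proof (rule cover_map_pullback[OF kan, of _ _ "\<lambda>Z. snd" _ "\<lambda>Z x. snd x (Idt Delta_plus M)"])
    show "presheaf (Fam X Y f M ?K ?F)" by (rule Fam_presheaf[OF X Y f K F KF(1)])
    show "presheaf (Fam X Y f M ?K L)" by (rule Fam_presheaf[OF X Y f K L KF(2)])
    show "representable (Fam X Y f M ?K L)" by (rule rKL)
    show "natural (Fam X Y f M ?K L) (FamP Y M L) (\<lambda>Z. snd)"
      by (rule naturalI) (auto simp: Fam_def FamP_def)
    show "natural (Fam X Y f M ?K ?F) (Fam X Y f M ?K L) (Fam_res M ?K L)"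
      by (rule Fam_res_natural[OF K L KF(2) _ LF]) auto
    show "natural (Fam X Y f M ?K ?F) (yo C (omap Y M)) (\<lambda>Z x. snd x (Idt Delta_plus M))"
    proof (rule naturalI)
      fix Z x assume "x \<in> elts (Fam X Y f M ?K ?F) Z"
      hence "snd x \<in> fam Y M ?F Z" by (cases x) (simp add: Fam_elts)
      from famD(2)[OF this iF] show "snd x (Idt Delta_plus M) \<in> elts (yo C (omap Y M)) Z"
        using fi by (simp add: yo_def)
      fix Z' h
      show "snd (restr (Fam X Y f M ?K ?F) h x) (Idt Delta_plus M) =
          restr (yo C (omap Y M)) h (snd x (Idt Delta_plus M))"
        using iF by (cases x) (simp add: Fam_restr yo_def)
    qed
  next
    fix Z x assume x: "x \<in> elts (Fam X Y f M ?K ?F) Z"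
    obtain \<rho> \<sigma> where xe: "x = (\<rho>, \<sigma>)" by (cases x)
    have \<sigma>: "\<sigma> \<in> fam Y M ?F Z" using x unfolding xe Fam_elts by simp
    show "(\<lambda>\<theta>\<in>simplices M L. amap Y \<theta> \<cdot> snd x (Idt Delta_plus M)) = snd (Fam_res M ?K L Z x)"
      using fam_Idt[OF \<sigma> _ M] simplices_mono[OF LF, of M]
      unfolding xe Fam_res_def by (auto intro!: restrict_ext)
  next
    fix Z x y assume x: "x \<in> elts (Fam X Y f M ?K ?F) Z" and y: "y \<in> elts (Fam X Y f M ?K ?F) Z"
      and i: "snd x (Idt Delta_plus M) = snd y (Idt Delta_plus M)"
      and r: "Fam_res M ?K L Z x = Fam_res M ?K L Z y"
    obtain \<rho> \<sigma> \<rho>' \<sigma>' where xe: "x = (\<rho>, \<sigma>)" "y = (\<rho>', \<sigma>')" by (cases x; cases y)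
    have \<rho>: "\<rho> \<in> fam X M ?K Z" "\<rho>' \<in> fam X M ?K Z" and \<sigma>: "\<sigma> \<in> fam Y M ?F Z" "\<sigma>' \<in> fam Y M ?F Z"
      using x y unfolding xe Fam_elts by simp_all
    have "restrict \<rho> (simplices M ?K) = restrict \<rho>' (simplices M ?K)"
      using r unfolding xe Fam_res_def by simp
    hence "\<rho> = \<rho>'" using famD(1)[OF \<rho>(1)] famD(1)[OF \<rho>(2)] by (simp add: extensional_restrict)
    moreover have "\<sigma> = \<sigma>'"
    proof (rule fam_eqI[OF \<sigma>])
      show "\<sigma> \<theta> = \<sigma>' \<theta>" if "\<theta> \<in> simplices M ?F" for \<theta>
        using fam_Idt[OF \<sigma>(1) _ M that] fam_Idt[OF \<sigma>(2) _ M that] i unfolding xe by simp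
    qed
    ultimately show "x = y" unfolding xe by simp
  next
    fix Z x y assume x: "x \<in> elts (yo C (omap Y M)) Z" and y: "y \<in> elts (Fam X Y f M ?K L) Z"
      and eq: "(\<lambda>\<theta>\<in>simplices M L. amap Y \<theta> \<cdot> x) = snd y"
    have xH: "x \<in> Hom C Z (omap Y M)" using x by (simp add: yo_def)
    obtain \<rho> \<sigma> where ye: "y = (\<rho>, \<sigma>)" by (cases y)
    have \<rho>: "\<rho> \<in> fam X M ?K Z" and \<sigma>: "\<sigma> \<in> fam Y M L Z"
      and feq: "\<And>\<theta>. \<theta> \<in> simplices M ?K \<Longrightarrow> f (fst \<theta>) \<cdot> \<rho> \<theta> = \<sigma> \<theta>"
      using y unfolding ye Fam_elts by simp_all
    let ?\<sigma> = "\<lambda>\<theta>\<in>simplices M ?F. amap Y \<theta> \<cdot> x"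
    have on_L: "?\<sigma> \<theta> = \<sigma> \<theta>" if "\<theta> \<in> simplices M L" for \<theta>
      using fun_cong[OF eq, of \<theta>] that simplices_mono[OF LF, of M] unfolding ye by auto
    have "(\<rho>, ?\<sigma>) \<in> elts (Fam X Y f M ?K ?F) Z"
      unfolding Fam_elts
    proof (intro conjI ballI \<rho> fam_point[OF Y F xH])
      fix \<theta> assume \<theta>: "\<theta> \<in> simplices M ?K"
      show "f (fst \<theta>) \<cdot> \<rho> \<theta> = ?\<sigma> \<theta>"
        unfolding on_L[OF subsetD[OF simplices_mono[OF KF(2)] \<theta>]] by (rule feq[OF \<theta>])
    qed
    moreover have "restrict ?\<sigma> (simplices M L) = \<sigma>"
      by (rule extensionalityI[OF _ famD(1)[OF \<sigma>]]) (use on_L in auto)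
    moreover have "restrict \<rho> (simplices M ?K) = \<rho>" using famD(1)[OF \<rho>] by (rule extensional_restrict)
    moreover have "?\<sigma> (Idt Delta_plus M) = x" using iF sobj_Idt[OF Y M] Idt_Cmp[OF xH] by simp
    ultimately show "\<exists>z \<in> elts (Fam X Y f M ?K ?F) Z. snd z (Idt Delta_plus M) = x \<and>
        Fam_res M ?K L Z z = y"
      unfolding ye Fam_res_def by (intro bexI[of _ "(\<rho>, ?\<sigma>)"]) simp_all
  qed
  have "Fam_res M ?K L Z x = Fam_res M ?K L Z (Fam_res M ?K ?F Z x)" for Z :: 'o and x
    using simplices_mono[OF LF, of M]
    unfolding Fam_res_def by (auto split: prod.splits simp: Int_absorb1 Int_absorb2)
  thus ?thesis using cover_map_cong[OF cover_map_comp[OF c1 c2]] by blast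
qed

end

section \<open>Coproducts in an extensive category\<close>

lemma prod_cat_Hom:
  "Hom (prod_cat C D) x y = Hom C (fst x) (fst y) \<times> Hom D (snd x) (snd y)"
  by (cases x; cases y) (auto simp: Hom_def prod_cat_def)

lemma prod_cat_category:
  assumes "category C" "category D"
  shows "category (prod_cat C D)"
proof -
  interpret C: category C by (rule assms(1))
  interpret D: category D by (rule assms(2))
  show ?thesis
    by unfold_locales
      (auto simp: prod_cat_Hom, auto simp: prod_cat_def C.Dom_in C.Cod_in D.Dom_in D.Cod_in C.Idt_in
        D.Idt_in C.Cmp_in D.Cmp_in C.Cmp_Idt D.Cmp_Idt C.Idt_Cmp D.Idt_Cmp C.Cmp_assoc D.Cmp_assoc)
qed

text \<open>Conjugating with the isomorphism recovers an arrow from its image. An equivalence is faithful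
  for this reason, and full because its inverse is faithful for the same reason.\<close>

lemma faithful_of_retraction:
  assumes "category C" and F: "is_fctr C D F" and G: "is_fctr D C G"
    and iso: "nat_isomorphic C C (comp_fctr G F) id_fctr"
    and u: "u \<in> Hom C x y" and v: "v \<in> Hom C x y" and eq: "amap F u = amap F v"
  shows "u = v"
proof -
  interpret C: category C by (rule assms(1))
  obtain t where t: "nat_trans C C (comp_fctr G F) id_fctr t" and ti: "\<And>x. x \<in> Obj C \<Longrightarrow> Defs.iso C (t x)"
    using iso unfolding nat_isomorphic_def by blast
  have xy: "x \<in> Obj C" "y \<in> Obj C" using C.HomD[OF u] by auto
  have tx: "t x \<in> Hom C (omap G (omap F x)) x" and ty: "t y \<in> Hom C (omap G (omap F y)) y"
    using t xy unfolding nat_trans_def by (simp_all add: comp_fctr_def id_fctr_def)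
  have nat: "t (Cod C w) \<cdot>\<^bsub>C\<^esub> amap G (amap F w) = w \<cdot>\<^bsub>C\<^esub> t (Dom C w)" if "w \<in> Arr C" for w
    using t that unfolding nat_trans_def by (simp add: comp_fctr_def id_fctr_def)
  have e: "u \<cdot>\<^bsub>C\<^esub> t x = v \<cdot>\<^bsub>C\<^esub> t x"
    using nat[of u] nat[of v] C.HomD[OF u] C.HomD[OF v] eq by simp
  obtain s where s: "s \<in> Hom C x (omap G (omap F x))" "t x \<cdot>\<^bsub>C\<^esub> s = Idt C x"
    using C.isoE[OF ti[OF xy(1)] tx] by metis
  have "u = (u \<cdot>\<^bsub>C\<^esub> t x) \<cdot>\<^bsub>C\<^esub> s" using C.Cmp_assoc[OF s(1) tx u] s(2) C.Cmp_Idt[OF u] by simp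
  also have "\<dots> = v" using C.Cmp_assoc[OF s(1) tx v] s(2) C.Cmp_Idt[OF v] e by simp
  finally show ?thesis .
qed

lemma equivalence_full:
  assumes C: "category C" and D: "category D" and eq: "equivalence C D F"
    and xy: "x \<in> Obj C" "y \<in> Obj C" and w: "w \<in> Hom D (omap F x) (omap F y)"
  obtains u where "u \<in> Hom C x y" "amap F u = w"
proof -
  interpret C: category C by (rule C)
  interpret D: category D by (rule D)
  obtain G where F: "is_fctr C D F" and G: "is_fctr D C G"
    and GF: "nat_isomorphic C C (comp_fctr G F) id_fctr"
    and FG: "nat_isomorphic D D (comp_fctr F G) id_fctr"
    using eq unfolding equivalence_def by blast
  obtain t where t: "nat_trans C C (comp_fctr G F) id_fctr t" and ti: "\<And>x. x \<in> Obj C \<Longrightarrow> Defs.iso C (t x)"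
    using GF unfolding nat_isomorphic_def by blast
  have tx: "t x \<in> Hom C (omap G (omap F x)) x" and ty: "t y \<in> Hom C (omap G (omap F y)) y"
    using t xy unfolding nat_trans_def by (simp_all add: comp_fctr_def id_fctr_def)
  have nat: "t (Cod C w) \<cdot>\<^bsub>C\<^esub> amap G (amap F w) = w \<cdot>\<^bsub>C\<^esub> t (Dom C w)" if "w \<in> Arr C" for w
    using t that unfolding nat_trans_def by (simp add: comp_fctr_def id_fctr_def)
  have Fmap: "amap F v \<in> Hom D (omap F (Dom C v)) (omap F (Cod C v))" if "v \<in> Arr C" for v
    using F that unfolding is_fctr_def by simp
  have Gmap: "amap G v \<in> Hom C (omap G (Dom D v)) (omap G (Cod D v))" if "v \<in> Arr D" for v
    using G that unfolding is_fctr_def by simp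
  obtain s where s: "s \<in> Hom C x (omap G (omap F x))" "s \<cdot>\<^bsub>C\<^esub> t x = Idt C (omap G (omap F x))"
    using C.isoE[OF ti[OF xy(1)] tx] by metis
  obtain r where r: "r \<in> Hom C y (omap G (omap F y))" "r \<cdot>\<^bsub>C\<^esub> t y = Idt C (omap G (omap F y))"
    using C.isoE[OF ti[OF xy(2)] ty] by metis
  have Gw: "amap G w \<in> Hom C (omap G (omap F x)) (omap G (omap F y))"
    using Gmap[of w] D.HomD[OF w] by simp
  have tg: "t y \<cdot>\<^bsub>C\<^esub> amap G w \<in> Hom C (omap G (omap F x)) y" using C.Cmp_in[OF Gw ty] .
  define u where "u = (t y \<cdot>\<^bsub>C\<^esub> amap G w) \<cdot>\<^bsub>C\<^esub> s"
  have u: "u \<in> Hom C x y" unfolding u_def using C.Cmp_in[OF s(1) tg] .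
  have Fu: "amap F u \<in> Hom D (omap F x) (omap F y)" using Fmap[of u] C.HomD[OF u] by simp
  have GFu: "amap G (amap F u) \<in> Hom C (omap G (omap F x)) (omap G (omap F y))"
    using Gmap[of "amap F u"] D.HomD[OF Fu] by simp
  have "t y \<cdot>\<^bsub>C\<^esub> amap G (amap F u) = u \<cdot>\<^bsub>C\<^esub> t x" using nat[of u] C.HomD[OF u] by simp
  also have "\<dots> = t y \<cdot>\<^bsub>C\<^esub> amap G w"
    unfolding u_def using C.Cmp_assoc[OF tx s(1) tg] s(2) C.Cmp_Idt[OF tg] by simp
  finally have "r \<cdot>\<^bsub>C\<^esub> (t y \<cdot>\<^bsub>C\<^esub> amap G (amap F u)) = r \<cdot>\<^bsub>C\<^esub> (t y \<cdot>\<^bsub>C\<^esub> amap G w)" by simp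
  hence "amap G (amap F u) = amap G w"
    using C.Cmp_assoc[OF GFu ty r(1)] C.Cmp_assoc[OF Gw ty r(1)] r(2) C.Idt_Cmp[OF GFu] C.Idt_Cmp[OF Gw]
    by simp
  from faithful_of_retraction[OF D G F FG Fu w this] show ?thesis using that u by blast
qed

lemma equivalence_faithful:
  assumes C: "category C" and eq: "equivalence C D F"
    and "u \<in> Hom C x y" "v \<in> Hom C x y" "amap F u = amap F v"
  shows "u = v"
proof -
  obtain G where F: "is_fctr C D F" and G: "is_fctr D C G"
    and GF: "nat_isomorphic C C (comp_fctr G F) id_fctr"
    using eq unfolding equivalence_def by blast
  show ?thesis by (rule faithful_of_retraction[OF C F G GF assms(3-5)])
qed

lemma equivalence_surj:
  assumes eq: "equivalence C D F" and y: "y \<in> Obj D"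
  obtains x e where "x \<in> Obj C" "e \<in> Hom D (omap F x) y" "Defs.iso D e"
proof -
  obtain G where G: "is_fctr D C G" and FG: "nat_isomorphic D D (comp_fctr F G) id_fctr"
    using eq unfolding equivalence_def by blast
  obtain t where t: "nat_trans D D (comp_fctr F G) id_fctr t" and ti: "\<And>x. x \<in> Obj D \<Longrightarrow> Defs.iso D (t x)"
    using FG unfolding nat_isomorphic_def by blast
  have "omap G y \<in> Obj C" using G y unfolding is_fctr_def by simp
  moreover have "t y \<in> Hom D (omap F (omap G y)) y"
    using t y unfolding nat_trans_def by (simp add: comp_fctr_def id_fctr_def)
  ultimately show ?thesis using that ti[OF y] by blast
qed

context category begin

lemma slice_Hom:
  "Hom (slice C A) f f' = {(g, h, g'). g = f \<and> g' = f' \<and> f \<in> Arr C \<and> Cod C f = A \<and> f' \<in> Arr C \<and>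
     Cod C f' = A \<and> h \<in> Hom C (Dom C f) (Dom C f') \<and> f' \<cdot> h = f}"
  by (auto simp: Hom_def slice_def)

lemma slice_category: "category (slice C A)"
proof
  fix f g h :: "'a \<times> 'a \<times> 'a" and x y z w :: 'a
  show "f \<in> Arr (slice C A) \<Longrightarrow> Dom (slice C A) f \<in> Obj (slice C A)"
    "f \<in> Arr (slice C A) \<Longrightarrow> Cod (slice C A) f \<in> Obj (slice C A)"
    by (auto simp: slice_def)
  show "x \<in> Obj (slice C A) \<Longrightarrow> Idt (slice C A) x \<in> Hom (slice C A) x x"
    unfolding slice_Hom using Idt_in Dom_in Cmp_Idt[of x "Dom C x" "Cod C x"] Hom_ArrI[of x]
    by (auto simp: slice_def)
  {
    assume f: "f \<in> Hom (slice C A) x y" and g: "g \<in> Hom (slice C A) y z"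
    obtain a b where ab: "f = (x, a, y)" "g = (y, b, z)" using f g unfolding slice_Hom by auto
    have a: "x \<in> Arr C" "Cod C x = A" "a \<in> Hom C (Dom C x) (Dom C y)" "y \<cdot> a = x"
      and b: "z \<in> Arr C" "Cod C z = A" "b \<in> Hom C (Dom C y) (Dom C z)" "z \<cdot> b = y"
      using f g unfolding ab slice_Hom by auto
    show "Cmp (slice C A) g f \<in> Hom (slice C A) x z"
      using a b Cmp_in[OF a(3) b(3)] Cmp_assoc[OF a(3) b(3) Hom_ArrI[OF b(1)]]
      unfolding ab slice_Hom by (simp add: slice_def)
  }
  {
    assume f: "f \<in> Hom (slice C A) x y"
    obtain a where ab: "f = (x, a, y)" using f unfolding slice_Hom by auto
    have a: "a \<in> Hom C (Dom C x) (Dom C y)" using f unfolding ab slice_Hom by auto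
    show "Cmp (slice C A) f (Idt (slice C A) x) = f" "Cmp (slice C A) (Idt (slice C A) y) f = f"
      using Cmp_Idt[OF a] Idt_Cmp[OF a] by (simp_all add: ab slice_def)
  }
  assume f: "f \<in> Hom (slice C A) x y" and g: "g \<in> Hom (slice C A) y z" and h: "h \<in> Hom (slice C A) z w"
  obtain a b c where ab: "f = (x, a, y)" "g = (y, b, z)" "h = (z, c, w)"
    using f g h unfolding slice_Hom by auto
  have "a \<in> Hom C (Dom C x) (Dom C y)" "b \<in> Hom C (Dom C y) (Dom C z)" "c \<in> Hom C (Dom C z) (Dom C w)"
    using f g h unfolding ab slice_Hom by auto
  thus "Cmp (slice C A) (Cmp (slice C A) h g) f = Cmp (slice C A) h (Cmp (slice C A) g f)"
    using Cmp_assoc by (simp add: ab slice_def)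
qed

lemma slice_iso:
  assumes e: "(f, h, f') \<in> Hom (slice C A) f f'" and iso: "Defs.iso (slice C A) (f, h, f')"
  shows "iso C h"
proof -
  interpret S: category "slice C A" by (rule slice_category)
  obtain g where g: "g \<in> Hom (slice C A) f' f" "Cmp (slice C A) g (f, h, f') = Idt (slice C A) f"
      "Cmp (slice C A) (f, h, f') g = Idt (slice C A) f'"
    using S.isoE[OF iso e] .
  obtain k where k: "g = (f', k, f)" "k \<in> Hom C (Dom C f') (Dom C f)" using g(1) unfolding slice_Hom by auto
  have h: "h \<in> Hom C (Dom C f) (Dom C f')" using e unfolding slice_Hom by auto
  show ?thesis using isoI[OF h k(2)] g(2,3) k(1) by (simp add: slice_def)
qed

lemma coprodD:
  assumes "is_coproduct C I A S inc"
  shows "S \<in> Obj C" "i \<in> I \<Longrightarrow> A i \<in> Obj C" "i \<in> I \<Longrightarrow> inc i \<in> Hom C (A i) S"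
  using assms unfolding is_coproduct_def by simp_all

lemma coprod_ex:
  assumes "is_coproduct C I A S inc" "Z \<in> Obj C" "\<And>i. i \<in> I \<Longrightarrow> g i \<in> Hom C (A i) Z"
  obtains h where "h \<in> Hom C S Z" "\<And>i. i \<in> I \<Longrightarrow> h \<cdot> inc i = g i"
proof -
  have "\<exists>!h. h \<in> Hom C S Z \<and> (\<forall>i \<in> I. h \<cdot> inc i = g i)"
    using assms unfolding is_coproduct_def by simp
  thus ?thesis using that by blast
qed

lemma coprod_eqI:
  assumes c: "is_coproduct C I A S inc" and h: "h \<in> Hom C S Z" and k: "k \<in> Hom C S Z"
    and eq: "\<And>i. i \<in> I \<Longrightarrow> h \<cdot> inc i = k \<cdot> inc i"
  shows "h = k"
proof -
  have Z: "Z \<in> Obj C" using HomD[OF h] by blast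
  have "\<forall>i \<in> I. k \<cdot> inc i \<in> Hom C (A i) Z" using Cmp_in[OF coprodD(3)[OF c] k] by blast
  hence "\<exists>!h. h \<in> Hom C S Z \<and> (\<forall>i \<in> I. h \<cdot> inc i = k \<cdot> inc i)"
    using c Z unfolding is_coproduct_def by simp
  thus ?thesis using h k eq by blast
qed

lemma coprodI:
  assumes "S \<in> Obj C" "\<And>i. i \<in> I \<Longrightarrow> A i \<in> Obj C" "\<And>i. i \<in> I \<Longrightarrow> inc i \<in> Hom C (A i) S"
    and ex: "\<And>Z g. Z \<in> Obj C \<Longrightarrow> (\<And>i. i \<in> I \<Longrightarrow> g i \<in> Hom C (A i) Z) \<Longrightarrow>
      \<exists>h \<in> Hom C S Z. \<forall>i \<in> I. h \<cdot> inc i = g i"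
    and un: "\<And>Z h k. h \<in> Hom C S Z \<Longrightarrow> k \<in> Hom C S Z \<Longrightarrow>
      (\<And>i. i \<in> I \<Longrightarrow> h \<cdot> inc i = k \<cdot> inc i) \<Longrightarrow> h = k"
  shows "is_coproduct C I A S inc"
  unfolding is_coproduct_def
proof (intro conjI ballI allI impI)
  fix Z g assume Z: "Z \<in> Obj C" and g: "\<forall>i \<in> I. g i \<in> Hom C (A i) Z"
  then obtain h where h: "h \<in> Hom C S Z" "\<forall>i \<in> I. h \<cdot> inc i = g i" using ex[OF Z, of g] by blast
  show "\<exists>!h. h \<in> Hom C S Z \<and> (\<forall>i \<in> I. h \<cdot> inc i = g i)"
  proof (rule ex1I[of _ h])
    fix k assume "k \<in> Hom C S Z \<and> (\<forall>i \<in> I. k \<cdot> inc i = g i)"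
    thus "k = h" using un[of k Z h] h by simp
  qed (use h in simp)
qed (use assms in simp_all)

lemma coprod_reindex:
  assumes c: "is_coproduct C I A S inc" and b: "bij_betw b I' I"
  shows "is_coproduct C I' (\<lambda>i. A (b i)) S (\<lambda>i. inc (b i))"
proof (rule coprodI)
  have bI: "b i \<in> I" if "i \<in> I'" for i using bij_betw_apply[OF b that] .
  show "S \<in> Obj C" using coprodD[OF c] by blast
  show "A (b i) \<in> Obj C" "inc (b i) \<in> Hom C (A (b i)) S" if "i \<in> I'" for i
    using coprodD[OF c] bI[OF that] by blast+
  have inv: "the_inv_into I' b i \<in> I' \<and> b (the_inv_into I' b i) = i" if "i \<in> I" for i
    using the_inv_into_into[OF bij_betw_imp_inj_on[OF b], of i I'] that
      f_the_inv_into_f[OF bij_betw_imp_inj_on[OF b], of i] bij_betw_imp_surj_on[OF b] by simp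
  {
    fix Z g assume Z: "Z \<in> Obj C" and g: "\<And>i. i \<in> I' \<Longrightarrow> g i \<in> Hom C (A (b i)) Z"
    have "g (the_inv_into I' b i) \<in> Hom C (A i) Z" if "i \<in> I" for i
      using g[of "the_inv_into I' b i"] inv[OF that] by simp
    then obtain h where h: "h \<in> Hom C S Z" "\<And>i. i \<in> I \<Longrightarrow> h \<cdot> inc i = g (the_inv_into I' b i)"
      using coprod_ex[OF c Z, of "\<lambda>i. g (the_inv_into I' b i)"] by blast
    have "h \<cdot> inc (b i) = g i" if "i \<in> I'" for i
      using h(2)[OF bI[OF that]] the_inv_into_f_f[OF bij_betw_imp_inj_on[OF b] that] by simp
    thus "\<exists>h \<in> Hom C S Z. \<forall>i \<in> I'. h \<cdot> inc (b i) = g i" using h(1) by blast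
  next
    fix Z h k assume hk: "h \<in> Hom C S Z" "k \<in> Hom C S Z" and eq: "\<And>i. i \<in> I' \<Longrightarrow> h \<cdot> inc (b i) = k \<cdot> inc (b i)"
    show "h = k" by (rule coprod_eqI[OF c hk]) (use inv eq in metis)
  }
qed

lemma coprod_unique_iso:
  assumes c: "is_coproduct C I A S inc" and c': "is_coproduct C I A S' inc'"
  obtains e e' where "e \<in> Hom C S S'" "e' \<in> Hom C S' S" "e' \<cdot> e = Idt C S" "e \<cdot> e' = Idt C S'"
    "\<And>i. i \<in> I \<Longrightarrow> e \<cdot> inc i = inc' i" "\<And>i. i \<in> I \<Longrightarrow> e' \<cdot> inc' i = inc i"
proof -
  have S: "S \<in> Obj C" "S' \<in> Obj C" using coprodD c c' by blast+
  obtain e where e: "e \<in> Hom C S S'" "\<And>i. i \<in> I \<Longrightarrow> e \<cdot> inc i = inc' i"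
    using coprod_ex[OF c S(2), of inc'] coprodD(3)[OF c'] by blast
  obtain e' where e': "e' \<in> Hom C S' S" "\<And>i. i \<in> I \<Longrightarrow> e' \<cdot> inc' i = inc i"
    using coprod_ex[OF c' S(1), of inc] coprodD(3)[OF c] by blast
  have "e' \<cdot> e = Idt C S"
    by (rule coprod_eqI[OF c Cmp_in[OF e(1) e'(1)] Idt_in[OF S(1)]])
      (simp add: Cmp_assoc[OF coprodD(3)[OF c] e(1) e'(1)] e(2) e'(2) Idt_Cmp[OF coprodD(3)[OF c]])
  moreover have "e \<cdot> e' = Idt C S'"
    by (rule coprod_eqI[OF c' Cmp_in[OF e'(1) e(1)] Idt_in[OF S(2)]])
      (simp add: Cmp_assoc[OF coprodD(3)[OF c'] e'(1) e(1)] e(2) e'(2) Idt_Cmp[OF coprodD(3)[OF c']])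
  ultimately show ?thesis using that e e' by blast
qed

lemma coprod_iso:
  assumes c: "is_coproduct C I A S inc" and e: "e \<in> Hom C S S'" and iso: "iso C e"
  shows "is_coproduct C I A S' (\<lambda>i. e \<cdot> inc i)"
proof -
  obtain d where d: "d \<in> Hom C S' S" "d \<cdot> e = Idt C S" "e \<cdot> d = Idt C S'" using isoE[OF iso e] .
  show ?thesis
  proof (rule coprodI)
    show "S' \<in> Obj C" using HomD[OF e] by blast
    show "A i \<in> Obj C" "e \<cdot> inc i \<in> Hom C (A i) S'" if "i \<in> I" for i
      using coprodD(2,3)[OF c that] Cmp_in[OF _ e] by blast+
    fix Z g assume Z: "Z \<in> Obj C" and g: "\<And>i. i \<in> I \<Longrightarrow> g i \<in> Hom C (A i) Z"
    obtain h where h: "h \<in> Hom C S Z" "\<And>i. i \<in> I \<Longrightarrow> h \<cdot> inc i = g i"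
      using coprod_ex[OF c Z g] by blast
    have "(h \<cdot> d) \<cdot> (e \<cdot> inc i) = g i" if "i \<in> I" for i
    proof -
      note i = coprodD(3)[OF c that]
      have "(h \<cdot> d) \<cdot> (e \<cdot> inc i) = h \<cdot> ((d \<cdot> e) \<cdot> inc i)"
        using Cmp_assoc[OF Cmp_in[OF i e] d(1) h(1)] Cmp_assoc[OF i e d(1)] by simp
      thus ?thesis using d(2) Idt_Cmp[OF i] h(2)[OF that] by simp
    qed
    thus "\<exists>h \<in> Hom C S' Z. \<forall>i \<in> I. h \<cdot> (e \<cdot> inc i) = g i" using Cmp_in[OF d(1) h(1)] by blast
  next
    fix Z h k assume h: "h \<in> Hom C S' Z" and k: "k \<in> Hom C S' Z"
      and eq: "\<And>i. i \<in> I \<Longrightarrow> h \<cdot> (e \<cdot> inc i) = k \<cdot> (e \<cdot> inc i)"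
    have "h \<cdot> e = k \<cdot> e"
      by (rule coprod_eqI[OF c Cmp_in[OF e h] Cmp_in[OF e k]])
        (simp add: Cmp_assoc[OF coprodD(3)[OF c] e h] Cmp_assoc[OF coprodD(3)[OF c] e k] eq)
    hence "(h \<cdot> e) \<cdot> d = (k \<cdot> e) \<cdot> d" by simp
    thus "h = k" using Cmp_assoc[OF d(1) e h] Cmp_assoc[OF d(1) e k] d(3) Cmp_Idt[OF h] Cmp_Idt[OF k] by simp
  qed
qed

lemma coprod_singleton_iso:
  assumes c: "is_coproduct C {i} A S inc"
  shows "iso C (inc i)"
proof -
  have i: "inc i \<in> Hom C (A i) S" and A: "A i \<in> Obj C" and S: "S \<in> Obj C" using coprodD[OF c] by auto
  have "\<And>j. j \<in> {i} \<Longrightarrow> Idt C (A i) \<in> Hom C (A j) (A i)" using Idt_in[OF A] by simp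
  then obtain d where d: "d \<in> Hom C S (A i)" "\<And>j. j \<in> {i} \<Longrightarrow> d \<cdot> inc j = Idt C (A i)"
    using coprod_ex[OF c A, of "\<lambda>_. Idt C (A i)"] by blast
  have "inc i \<cdot> d = Idt C S"
  proof (rule coprod_eqI[OF c Cmp_in[OF d(1) i] Idt_in[OF S]])
    fix j assume "j \<in> {i}"
    thus "inc i \<cdot> d \<cdot> inc j = Idt C S \<cdot> inc j"
      using Cmp_assoc[OF i d(1) i] d(2) Idt_Cmp[OF i] Cmp_Idt[OF i] by simp
  qed
  thus ?thesis using isoI[OF i d(1)] d(2) by simp
qed

end

context extensive_site begin

lemma finite_coproduct:
  assumes "finite I" "\<And>i. i \<in> I \<Longrightarrow> A i \<in> Obj C"
  obtains S inc where "is_coproduct C I A S inc"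
proof -
  obtain h where h: "bij_betw h {0..<card I} I" using ex_bij_betw_nat_finite[OF assms(1)] by blast
  hence h: "bij_betw h {..<card I} I" by (simp add: lessThan_atLeast0)
  have "\<forall>n < card I. A (h n) \<in> Obj C" using assms(2) bij_betw_apply[OF h] by simp
  moreover have "\<forall>A. (\<forall>n < card I. A n \<in> Obj C) \<longrightarrow> (\<exists>S inc. is_coproduct C {..<card I} A S inc)"
    using extensive unfolding extensive_def has_finite_coproducts_def by simp
  ultimately have "\<exists>S inc. is_coproduct C {..<card I} (\<lambda>n. A (h n)) S inc" by simp
  then obtain S inc where c: "is_coproduct C {..<card I} (\<lambda>n. A (h n)) S inc" by (elim exE)
  have b: "bij_betw (the_inv_into {..<card I} h) I {..<card I}" by (rule bij_betw_the_inv_into[OF h])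
  have "is_coproduct C I A S (\<lambda>i. inc (the_inv_into {..<card I} h i))"
  proof -
    note c' = coprod_reindex[OF c b]
    have "A (h (the_inv_into {..<card I} h i)) = A i" if "i \<in> I" for i
      using f_the_inv_into_f[OF bij_betw_imp_inj_on[OF h], of i] bij_betw_imp_surj_on[OF h] that by simp
    thus ?thesis using c' unfolding is_coproduct_def by simp
  qed
  thus ?thesis using that by blast
qed

lemma bin_coprod_coproduct:
  assumes "A \<in> Obj C" "B \<in> Obj C"
  shows "is_coproduct C UNIV (\<lambda>b. if b then B else A) (cop C A B) (snd (bin_coprod C A B))"
proof -
  obtain S and inc :: "bool \<Rightarrow> 'a" where "is_coproduct C UNIV (\<lambda>b. if b then B else A) S inc"
    by (rule finite_coproduct[of "UNIV :: bool set" "\<lambda>b. if b then B else A"]) (use assms in auto)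
  hence "case (S, inc) of (S, inc) \<Rightarrow> is_coproduct C UNIV (\<lambda>b. if b then B else A) S inc" by simp
  from someI[of "\<lambda>(S, inc). is_coproduct C UNIV (\<lambda>b. if b then B else A) S inc", OF this]
  show ?thesis unfolding cop_def bin_coprod_def by (simp add: case_prod_beta)
qed

lemma cop_in:
  assumes "A \<in> Obj C" "B \<in> Obj C"
  shows "cop C A B \<in> Obj C" "cinl C A B \<in> Hom C A (cop C A B)" "cinr C A B \<in> Hom C B (cop C A B)"
  using coprodD(1)[OF bin_coprod_coproduct[OF assms]] coprodD(3)[OF bin_coprod_coproduct[OF assms], of True]
    coprodD(3)[OF bin_coprod_coproduct[OF assms], of False]
  by (simp_all add: cinl_def cinr_def)

lemma cop_ex:
  assumes "u \<in> Hom C A Z" "v \<in> Hom C B Z"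
  obtains h where "h \<in> Hom C (cop C A B) Z" "h \<cdot> cinl C A B = u" "h \<cdot> cinr C A B = v"
proof -
  have o: "A \<in> Obj C" "B \<in> Obj C" "Z \<in> Obj C" using HomD[OF assms(1)] HomD[OF assms(2)] by auto
  have g: "\<And>i. i \<in> UNIV \<Longrightarrow> (if i then v else u) \<in> Hom C (if i then B else A) Z" using assms by simp
  obtain h where h: "h \<in> Hom C (cop C A B) Z"
    "\<And>i. i \<in> UNIV \<Longrightarrow> h \<cdot> snd (bin_coprod C A B) i = (if i then v else u)"
    using coprod_ex[OF bin_coprod_coproduct[OF o(1,2)] o(3) g] by blast
  show ?thesis using that[OF h(1)] h(2)[of True] h(2)[of False] by (simp add: cinl_def cinr_def)
qed

lemma cop_eqI:
  assumes "A \<in> Obj C" "B \<in> Obj C" "h \<in> Hom C (cop C A B) Z" "k \<in> Hom C (cop C A B) Z"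
    and "h \<cdot> cinl C A B = k \<cdot> cinl C A B" "h \<cdot> cinr C A B = k \<cdot> cinr C A B"
  shows "h = k"
proof (rule coprod_eqI[OF bin_coprod_coproduct[OF assms(1,2)] assms(3,4)])
  show "h \<cdot> snd (bin_coprod C A B) i = k \<cdot> snd (bin_coprod C A B) i" for i
    using assms(5,6) by (cases i) (simp_all add: cinl_def cinr_def)
qed

lemma cop_arr:
  assumes f: "f \<in> Hom C A A'" and g: "g \<in> Hom C B B'"
  shows "cop_arr C f g \<in> Hom C (cop C A B) (cop C A' B')"
    and "cop_arr C f g \<cdot> cinl C A B = cinl C A' B' \<cdot> f"
    and "cop_arr C f g \<cdot> cinr C A B = cinr C A' B' \<cdot> g"
proof -
  have o: "A \<in> Obj C" "B \<in> Obj C" "A' \<in> Obj C" "B' \<in> Obj C" "Dom C f = A" "Dom C g = B" "Cod C f = A'"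
    "Cod C g = B'"
    using HomD[OF f] HomD[OF g] by auto
  have fi: "cinl C A' B' \<cdot> f \<in> Hom C A (cop C A' B')" "cinr C A' B' \<cdot> g \<in> Hom C B (cop C A' B')"
    using Cmp_in[OF f cop_in(2)[OF o(3,4)]] Cmp_in[OF g cop_in(3)[OF o(3,4)]] by blast+
  obtain h where h: "h \<in> Hom C (cop C A B) (cop C A' B')" "h \<cdot> cinl C A B = cinl C A' B' \<cdot> f"
    "h \<cdot> cinr C A B = cinr C A' B' \<cdot> g"
    using cop_ex[OF fi] .
  have "cop_arr C f g = h"
    unfolding cop_arr_def o
  proof (rule the_equality)
    fix k assume "k \<in> Hom C (cop C A B) (cop C A' B') \<and> k \<cdot> cinl C A B = cinl C A' B' \<cdot> f \<and>
      k \<cdot> cinr C A B = cinr C A' B' \<cdot> g"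
    hence k: "k \<in> Hom C (cop C A B) (cop C A' B')" "k \<cdot> cinl C A B = h \<cdot> cinl C A B"
      "k \<cdot> cinr C A B = h \<cdot> cinr C A B" using h by simp_all
    show "k = h" by (rule cop_eqI[OF o(1,2) k(1) h(1) k(2,3)])
  qed (use h in simp)
  thus "cop_arr C f g \<in> Hom C (cop C A B) (cop C A' B')"
    "cop_arr C f g \<cdot> cinl C A B = cinl C A' B' \<cdot> f" "cop_arr C f g \<cdot> cinr C A B = cinr C A' B' \<cdot> g"
    using h by simp_all
qed

lemma coprod_split:
  assumes R: "is_coproduct C (I - {i}) A R r" and i: "i \<in> I" and Ai: "A i \<in> Obj C"
  shows "is_coproduct C I A (cop C (A i) R) (\<lambda>j. if j = i then cinl C (A i) R else cinr C (A i) R \<cdot> r j)"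
proof -
  have Ro: "R \<in> Obj C" using coprodD[OF R] by blast
  note ci = cop_in[OF Ai Ro]
  show ?thesis
  proof (rule coprodI)
    show "cop C (A i) R \<in> Obj C" by (rule ci)
    fix j assume j: "j \<in> I"
    show "A j \<in> Obj C" using coprodD(2)[OF R, of j] Ai j by (cases "j = i") auto
    show "(if j = i then cinl C (A i) R else cinr C (A i) R \<cdot> r j) \<in> Hom C (A j) (cop C (A i) R)"
      using ci(2) Cmp_in[OF coprodD(3)[OF R, of j] ci(3)] j by auto
  next
    fix Z g assume Z: "Z \<in> Obj C" and g: "\<And>j. j \<in> I \<Longrightarrow> g j \<in> Hom C (A j) Z"
    obtain k where k: "k \<in> Hom C R Z" "\<And>j. j \<in> I - {i} \<Longrightarrow> k \<cdot> r j = g j"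
      using coprod_ex[OF R Z, of g] g by blast
    obtain h where h: "h \<in> Hom C (cop C (A i) R) Z" "h \<cdot> cinl C (A i) R = g i" "h \<cdot> cinr C (A i) R = k"
      using cop_ex[OF g[OF i] k(1)] .
    have "h \<cdot> (if j = i then cinl C (A i) R else cinr C (A i) R \<cdot> r j) = g j" if j: "j \<in> I" for j
    proof (cases "j = i")
      case False
      hence j': "j \<in> I - {i}" using j by simp
      show ?thesis using False Cmp_assoc[OF coprodD(3)[OF R j'] ci(3) h(1)] h(3) k(2)[OF j'] by simp
    qed (use h in simp)
    thus "\<exists>h \<in> Hom C (cop C (A i) R) Z. \<forall>j \<in> I.
        h \<cdot> (if j = i then cinl C (A i) R else cinr C (A i) R \<cdot> r j) = g j" using h(1) by blast
  next
    fix Z h k assume h: "h \<in> Hom C (cop C (A i) R) Z" and k: "k \<in> Hom C (cop C (A i) R) Z"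
      and eq: "\<And>j. j \<in> I \<Longrightarrow> h \<cdot> (if j = i then cinl C (A i) R else cinr C (A i) R \<cdot> r j) =
        k \<cdot> (if j = i then cinl C (A i) R else cinr C (A i) R \<cdot> r j)"
    have "h \<cdot> cinr C (A i) R = k \<cdot> cinr C (A i) R"
    proof (rule coprod_eqI[OF R Cmp_in[OF ci(3) h] Cmp_in[OF ci(3) k]])
      fix j assume j: "j \<in> I - {i}"
      thus "h \<cdot> cinr C (A i) R \<cdot> r j = k \<cdot> cinr C (A i) R \<cdot> r j"
        using eq[of j] Cmp_assoc[OF coprodD(3)[OF R j] ci(3) h] Cmp_assoc[OF coprodD(3)[OF R j] ci(3) k]
        by simp
    qed
    moreover have "h \<cdot> cinl C (A i) R = k \<cdot> cinl C (A i) R" using eq[OF i] by simp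
    ultimately show "h = k" by (intro cop_eqI[OF Ai Ro h k])
  qed
qed

lemma slice_cop_equivalence:
  assumes "A \<in> Obj C" "B \<in> Obj C"
  shows "equivalence (prod_cat (slice C A) (slice C B)) (slice C (cop C A B)) (slice_cop C)"
  using extensive assms unfolding extensive_def by blast

lemma cop_over_full:
  assumes f: "f \<in> Hom C U A" and f': "f' \<in> Hom C U' A" and g: "g \<in> Hom C V B" and g': "g' \<in> Hom C V' B"
    and w: "w \<in> Hom C (cop C U V) (cop C U' V')" and eq: "cop_arr C f' g' \<cdot> w = cop_arr C f g"
  obtains h k where "h \<in> Hom C U U'" "k \<in> Hom C V V'" "f' \<cdot> h = f" "g' \<cdot> k = g" "cop_arr C h k = w"
proof -
  have o: "A \<in> Obj C" "B \<in> Obj C" using HomD[OF f] HomD[OF g] by auto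
  note E = slice_cop_equivalence[OF o]
  note cat = prod_cat_category[OF slice_category slice_category]
  have x: "(f, g) \<in> Obj (prod_cat (slice C A) (slice C B))" "(f', g') \<in> Obj (prod_cat (slice C A) (slice C B))"
    using HomD[OF f] HomD[OF g] HomD[OF f'] HomD[OF g'] by (auto simp: prod_cat_def slice_def)
  have "(cop_arr C f g, w, cop_arr C f' g') \<in>
      Hom (slice C (cop C A B)) (omap (slice_cop C) (f, g)) (omap (slice_cop C) (f', g'))"
    using HomD[OF cop_arr(1)[OF f g]] HomD[OF cop_arr(1)[OF f' g']] w eq
    by (simp add: slice_Hom slice_cop_def)
  from equivalence_full[OF cat slice_category E x this]
  obtain u where u: "u \<in> Hom (prod_cat (slice C A) (slice C B)) (f, g) (f', g')"
    "amap (slice_cop C) u = (cop_arr C f g, w, cop_arr C f' g')" .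
  obtain h k where u': "u = ((f, h, f'), (g, k, g'))"
    using u(1) unfolding prod_cat_Hom slice_Hom by (cases u) auto
  have "h \<in> Hom C U U'" "k \<in> Hom C V V'" "f' \<cdot> h = f" "g' \<cdot> k = g"
    using u(1) HomD[OF f] HomD[OF g] HomD[OF f'] HomD[OF g'] unfolding u' prod_cat_Hom slice_Hom by auto
  moreover have "cop_arr C h k = w" using u(2) unfolding u' slice_cop_def by simp
  ultimately show ?thesis using that by blast
qed

lemma cop_over_faithful:
  assumes f: "f \<in> Hom C U A" and f': "f' \<in> Hom C U' A" and g: "g \<in> Hom C V B" and g': "g' \<in> Hom C V' B"
    and h: "h \<in> Hom C U U'" "f' \<cdot> h = f" and k: "k \<in> Hom C V V'" "g' \<cdot> k = g"
    and h': "h' \<in> Hom C U U'" "f' \<cdot> h' = f" and k': "k' \<in> Hom C V V'" "g' \<cdot> k' = g"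
    and eq: "cop_arr C h k = cop_arr C h' k'"
  shows "h = h'"
proof -
  have o: "A \<in> Obj C" "B \<in> Obj C" using HomD[OF f] HomD[OF g] by auto
  note E = slice_cop_equivalence[OF o]
  note cat = prod_cat_category[OF slice_category slice_category]
  have u: "((f, h, f'), (g, k, g')) \<in> Hom (prod_cat (slice C A) (slice C B)) (f, g) (f', g')"
    "((f, h', f'), (g, k', g')) \<in> Hom (prod_cat (slice C A) (slice C B)) (f, g) (f', g')"
    using h k h' k' HomD[OF f] HomD[OF g] HomD[OF f'] HomD[OF g'] unfolding prod_cat_Hom slice_Hom by auto
  have "amap (slice_cop C) ((f, h, f'), (g, k, g')) = amap (slice_cop C) ((f, h', f'), (g, k', g'))"
    using eq by (simp add: slice_cop_def)
  from equivalence_faithful[OF cat E u this] show ?thesis by simp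
qed

lemma cop_over_surj:
  assumes z: "z \<in> Hom C Z (cop C A B)" and o: "A \<in> Obj C" "B \<in> Obj C"
  obtains U V f g e where "f \<in> Hom C U A" "g \<in> Hom C V B" "e \<in> Hom C (cop C U V) Z" "iso C e"
    "z \<cdot> e = cop_arr C f g"
proof -
  note E = slice_cop_equivalence[OF o]
  have "z \<in> Obj (slice C (cop C A B))" using HomD[OF z] by (simp add: slice_def)
  from equivalence_surj[OF E this]
  obtain x t where x: "x \<in> Obj (prod_cat (slice C A) (slice C B))"
    and t: "t \<in> Hom (slice C (cop C A B)) (omap (slice_cop C) x) z" "Defs.iso (slice C (cop C A B)) t" .
  obtain f g where fg: "x = (f, g)" by (cases x)
  have f: "f \<in> Hom C (Dom C f) A" and g: "g \<in> Hom C (Dom C g) B"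
    using x unfolding fg by (auto simp: prod_cat_def slice_def Hom_def)
  obtain e where te: "t = (cop_arr C f g, e, z)" using t(1) unfolding fg slice_Hom by (auto simp: slice_cop_def)
  have "e \<in> Hom C (cop C (Dom C f) (Dom C g)) Z" "z \<cdot> e = cop_arr C f g"
    using t(1) HomD[OF cop_arr(1)[OF f g]] HomD[OF z] unfolding te fg slice_Hom by auto
  moreover have "iso C e" using slice_iso[OF _ t(2)[unfolded te]] t(1)
    unfolding te fg by (simp add: slice_cop_def)
  ultimately show ?thesis using that f g by blast
qed

text \<open>A point \<open>w\<close> of the left summand \<open>A\<close> becomes, after adding an initial object to its source, a
  coproduct of two arrows over \<open>A \<squnion> B\<close>. Full faithfulness then splits any lift of it into two parts, so
  the square formed with the left injections is a pullback.\<close>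

lemma cop_left_pullback_ex:
  assumes f: "f \<in> Hom C U A" and g: "g \<in> Hom C V B"
    and w: "w \<in> Hom C W A" and k: "k \<in> Hom C W (cop C U V)"
    and eq: "cop_arr C f g \<cdot> k = cinl C A B \<cdot> w"
  shows "\<exists>!h. h \<in> Hom C W U \<and> f \<cdot> h = w \<and> cinl C U V \<cdot> h = k"
proof -
  have o: "A \<in> Obj C" "B \<in> Obj C" "U \<in> Obj C" "V \<in> Obj C" "W \<in> Obj C"
    using HomD[OF f] HomD[OF g] HomD[OF w] by auto
  obtain E and inc :: "nat \<Rightarrow> 'a" where E: "is_coproduct C {} (\<lambda>_. W) E inc"
    using finite_coproduct[of "{} :: nat set" "\<lambda>_. W"] by auto
  have Eo: "E \<in> Obj C" using coprodD[OF E] by blast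
  have Eu: "x = y" if "x \<in> Hom C E Q" "y \<in> Hom C E Q" for x y Q by (rule coprod_eqI[OF E that]) simp
  have Eex: "\<exists>x. x \<in> Hom C E Q" if "Q \<in> Obj C" for Q using coprod_ex[OF E that] by blast
  obtain b where b: "b \<in> Hom C E B" using Eex[OF o(2)] by blast
  obtain c where c: "c \<in> Hom C E W" using Eex[OF o(5)] by blast
  obtain p where p: "p \<in> Hom C (cop C W E) W" "p \<cdot> cinl C W E = Idt C W" "p \<cdot> cinr C W E = c"
    using cop_ex[OF Idt_in[OF o(5)] c] .
  note i = cop_in[OF o(5) Eo] and fg = cop_arr[OF f g] and AB = cop_in[OF o(1,2)] and UV = cop_in[OF o(3,4)]
  have kp: "k \<cdot> p \<in> Hom C (cop C W E) (cop C U V)" using Cmp_in[OF p(1) k] .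
  have kpl: "(k \<cdot> p) \<cdot> cinl C W E = k" using Cmp_assoc[OF i(2) p(1) k] p(2) Cmp_Idt[OF k] by simp
  have over: "cop_arr C f g \<cdot> (k \<cdot> p) = cop_arr C w b"
  proof (rule cop_eqI[OF o(5) Eo Cmp_in[OF kp fg(1)] cop_arr(1)[OF w b]])
    show "(cop_arr C f g \<cdot> (k \<cdot> p)) \<cdot> cinl C W E = cop_arr C w b \<cdot> cinl C W E"
      using Cmp_assoc[OF i(2) kp fg(1)] kpl eq cop_arr(2)[OF w b] by simp
    show "(cop_arr C f g \<cdot> (k \<cdot> p)) \<cdot> cinr C W E = cop_arr C w b \<cdot> cinr C W E"
      by (rule Eu[OF Cmp_in[OF i(3) Cmp_in[OF kp fg(1)]] Cmp_in[OF i(3) cop_arr(1)[OF w b]]])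
  qed
  obtain h l where hl: "h \<in> Hom C W U" "l \<in> Hom C E V" "f \<cdot> h = w" "g \<cdot> l = b" "cop_arr C h l = k \<cdot> p"
    using cop_over_full[OF w f b g kp over] .
  show ?thesis
  proof (rule ex1I[of _ h])
    show "h \<in> Hom C W U \<and> f \<cdot> h = w \<and> cinl C U V \<cdot> h = k"
      using hl cop_arr(2)[OF hl(1,2)] kpl by simp
    fix h' assume h': "h' \<in> Hom C W U \<and> f \<cdot> h' = w \<and> cinl C U V \<cdot> h' = k"
    hence hH: "h' \<in> Hom C W U" by simp
    have "cop_arr C h' l = k \<cdot> p"
    proof (rule cop_eqI[OF o(5) Eo cop_arr(1)[OF hH hl(2)] kp])
      show "cop_arr C h' l \<cdot> cinl C W E = k \<cdot> p \<cdot> cinl C W E"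
        using cop_arr(2)[OF hH hl(2)] h' kpl by simp
      show "cop_arr C h' l \<cdot> cinr C W E = k \<cdot> p \<cdot> cinr C W E"
        by (rule Eu[OF Cmp_in[OF i(3) cop_arr(1)[OF hH hl(2)]] Cmp_in[OF i(3) kp]])
    qed
    thus "h' = h" using cop_over_faithful[OF w f b g hH _ hl(2,4) hl(1,3) hl(2,4)] h' hl(5) by simp
  qed
qed

text \<open>Singling out one summand reduces statements on finite coproducts to the chosen binary ones,
  which are all that extensivity speaks of.\<close>

lemma coprod_as_cop:
  assumes S: "is_coproduct C I A S inc" and fin: "finite I" and i: "i \<in> I"
  obtains R r e e' where "is_coproduct C (I - {i}) A R r" "e \<in> Hom C (cop C (A i) R) S"
    "e' \<in> Hom C S (cop C (A i) R)" "e' \<cdot> e = Idt C (cop C (A i) R)" "e \<cdot> e' = Idt C S"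
    "e \<cdot> cinl C (A i) R = inc i" "\<And>j. j \<in> I - {i} \<Longrightarrow> (e \<cdot> cinr C (A i) R) \<cdot> r j = inc j"
proof -
  obtain R r where R: "is_coproduct C (I - {i}) A R r"
    using finite_coproduct[of "I - {i}" A] fin coprodD(2)[OF S] by auto
  have Ai: "A i \<in> Obj C" and Ro: "R \<in> Obj C" using coprodD[OF S] coprodD[OF R] i by auto
  obtain e e' where e: "e \<in> Hom C (cop C (A i) R) S" "e' \<in> Hom C S (cop C (A i) R)"
    "e' \<cdot> e = Idt C (cop C (A i) R)" "e \<cdot> e' = Idt C S"
    and ei: "\<And>j. j \<in> I \<Longrightarrow> e \<cdot> (if j = i then cinl C (A i) R else cinr C (A i) R \<cdot> r j) = inc j"
    using coprod_unique_iso[OF coprod_split[OF R i Ai] S] by metis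
  have "e \<cdot> cinl C (A i) R = inc i" using ei[OF i] by simp
  moreover have "(e \<cdot> cinr C (A i) R) \<cdot> r j = inc j" if "j \<in> I - {i}" for j
    using ei[of j] that Cmp_assoc[OF coprodD(3)[OF R that] cop_in(3)[OF Ai Ro] e(1)] by simp
  ultimately show ?thesis using that R e by blast
qed

lemma coprod_map_as_cop_arr:
  assumes Sc: "is_coproduct C I A S inc" and Sc': "is_coproduct C I B S' inc'"
    and fin: "finite I" and i: "i \<in> I" and h: "h \<in> Hom C S S'"
    and hi: "\<And>j. j \<in> I \<Longrightarrow> hh j \<in> Hom C (A j) (B j)" "\<And>j. j \<in> I \<Longrightarrow> h \<cdot> inc j = inc' j \<cdot> hh j"
  obtains R r R' r' k e e' d d' where "is_coproduct C (I - {i}) A R r" "is_coproduct C (I - {i}) B R' r'"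
    "k \<in> Hom C R R'" "\<And>j. j \<in> I - {i} \<Longrightarrow> k \<cdot> r j = r' j \<cdot> hh j"
    "e \<in> Hom C (cop C (A i) R) S" "e' \<in> Hom C S (cop C (A i) R)"
    "e' \<cdot> e = Idt C (cop C (A i) R)" "e \<cdot> e' = Idt C S"
    "d \<in> Hom C (cop C (B i) R') S'" "d' \<in> Hom C S' (cop C (B i) R')"
    "d' \<cdot> d = Idt C (cop C (B i) R')" "d \<cdot> d' = Idt C S'"
    "e \<cdot> cinl C (A i) R = inc i" "d \<cdot> cinl C (B i) R' = inc' i" "h \<cdot> e = d \<cdot> cop_arr C (hh i) k"
proof -
  obtain R r e e' where R: "is_coproduct C (I - {i}) A R r" and e: "e \<in> Hom C (cop C (A i) R) S"
    "e' \<in> Hom C S (cop C (A i) R)" "e' \<cdot> e = Idt C (cop C (A i) R)" "e \<cdot> e' = Idt C S"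
    "e \<cdot> cinl C (A i) R = inc i" "\<And>j. j \<in> I - {i} \<Longrightarrow> (e \<cdot> cinr C (A i) R) \<cdot> r j = inc j"
    using coprod_as_cop[OF Sc fin i] by metis
  obtain R' r' d d' where R': "is_coproduct C (I - {i}) B R' r'" and d: "d \<in> Hom C (cop C (B i) R') S'"
    "d' \<in> Hom C S' (cop C (B i) R')" "d' \<cdot> d = Idt C (cop C (B i) R')" "d \<cdot> d' = Idt C S'"
    "d \<cdot> cinl C (B i) R' = inc' i" "\<And>j. j \<in> I - {i} \<Longrightarrow> (d \<cdot> cinr C (B i) R') \<cdot> r' j = inc' j"
    using coprod_as_cop[OF Sc' fin i] by metis
  have o: "A i \<in> Obj C" "B i \<in> Obj C" "R \<in> Obj C" "R' \<in> Obj C"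
    using coprodD[OF Sc] coprodD[OF Sc'] coprodD[OF R] coprodD[OF R'] i by auto
  have "\<And>j. j \<in> I - {i} \<Longrightarrow> r' j \<cdot> hh j \<in> Hom C (A j) R'"
    using Cmp_in[OF hi(1) coprodD(3)[OF R']] by blast
  then obtain k where k: "k \<in> Hom C R R'" "\<And>j. j \<in> I - {i} \<Longrightarrow> k \<cdot> r j = r' j \<cdot> hh j"
    using coprod_ex[OF R o(4), of "\<lambda>j. r' j \<cdot> hh j"] by blast
  note hk = cop_arr[OF hi(1)[OF i] k(1)] and AR = cop_in[OF o(1,3)] and BR = cop_in[OF o(2,4)]
  have "h \<cdot> e = d \<cdot> cop_arr C (hh i) k"
  proof (rule cop_eqI[OF o(1,3) Cmp_in[OF e(1) h] Cmp_in[OF hk(1) d(1)]])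
    show "(h \<cdot> e) \<cdot> cinl C (A i) R = (d \<cdot> cop_arr C (hh i) k) \<cdot> cinl C (A i) R"
      using Cmp_assoc[OF AR(2) e(1) h] e(5) hi(2)[OF i] Cmp_assoc[OF AR(2) hk(1) d(1)] hk(2)
        Cmp_assoc[OF hi(1)[OF i] BR(2) d(1)] d(5) by simp
    have er: "e \<cdot> cinr C (A i) R \<in> Hom C R S" and dr: "d \<cdot> cinr C (B i) R' \<in> Hom C R' S'"
      using Cmp_in[OF AR(3) e(1)] Cmp_in[OF BR(3) d(1)] by auto
    have "h \<cdot> (e \<cdot> cinr C (A i) R) = (d \<cdot> cinr C (B i) R') \<cdot> k"
    proof (rule coprod_eqI[OF R Cmp_in[OF er h] Cmp_in[OF k(1) dr]])
      fix j assume j: "j \<in> I - {i}"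
      hence jI: "j \<in> I" by simp
      note rj = coprodD(3)[OF R j] and rj' = coprodD(3)[OF R' j]
      have "(h \<cdot> (e \<cdot> cinr C (A i) R)) \<cdot> r j = inc' j \<cdot> hh j"
        using Cmp_assoc[OF rj er h] e(6)[OF j] hi(2)[OF jI] by simp
      also have "\<dots> = (d \<cdot> cinr C (B i) R') \<cdot> (r' j \<cdot> hh j)"
        using Cmp_assoc[OF hi(1)[OF jI] rj' dr] d(6)[OF j] by simp
      also have "\<dots> = ((d \<cdot> cinr C (B i) R') \<cdot> k) \<cdot> r j"
        using Cmp_assoc[OF rj k(1) dr] k(2)[OF j] by simp
      finally show "(h \<cdot> (e \<cdot> cinr C (A i) R)) \<cdot> r j = ((d \<cdot> cinr C (B i) R') \<cdot> k) \<cdot> r j" .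
    qed
    thus "(h \<cdot> e) \<cdot> cinr C (A i) R = (d \<cdot> cop_arr C (hh i) k) \<cdot> cinr C (A i) R"
      using Cmp_assoc[OF AR(3) e(1) h] Cmp_assoc[OF AR(3) hk(1) d(1)] hk(3)
        Cmp_assoc[OF k(1) BR(3) d(1)] by simp
  qed
  thus ?thesis using that[OF R R' k e(1-4) d(1-4) e(5) d(5)] by blast
qed

lemma coprod_square_pullback:
  assumes Sc: "is_coproduct C I A S inc" and Sc': "is_coproduct C I B S' inc'"
    and fin: "finite I" and i: "i \<in> I" and h: "h \<in> Hom C S S'"
    and hi: "\<And>j. j \<in> I \<Longrightarrow> hh j \<in> Hom C (A j) (B j)" "\<And>j. j \<in> I \<Longrightarrow> h \<cdot> inc j = inc' j \<cdot> hh j"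
    and w: "w \<in> Hom C W (B i)" and k: "k \<in> Hom C W S" and eq: "h \<cdot> k = inc' i \<cdot> w"
  shows "\<exists>!u. u \<in> Hom C W (A i) \<and> hh i \<cdot> u = w \<and> inc i \<cdot> u = k"
proof -
  obtain R r R' r' l e e' d d' where R: "is_coproduct C (I - {i}) A R r" "is_coproduct C (I - {i}) B R' r'"
    and l: "l \<in> Hom C R R'"
    and e: "e \<in> Hom C (cop C (A i) R) S" "e' \<in> Hom C S (cop C (A i) R)"
    "e' \<cdot> e = Idt C (cop C (A i) R)" "e \<cdot> e' = Idt C S"
    and d: "d \<in> Hom C (cop C (B i) R') S'" "d' \<in> Hom C S' (cop C (B i) R')"
    "d' \<cdot> d = Idt C (cop C (B i) R')" "d \<cdot> d' = Idt C S'"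
    and c: "e \<cdot> cinl C (A i) R = inc i" "d \<cdot> cinl C (B i) R' = inc' i" "h \<cdot> e = d \<cdot> cop_arr C (hh i) l"
    by (rule coprod_map_as_cop_arr[OF Sc Sc' fin i h hi]) blast+
  have o: "A i \<in> Obj C" "B i \<in> Obj C" "R \<in> Obj C" "R' \<in> Obj C"
    using coprodD[OF Sc] coprodD[OF Sc'] coprodD[OF R(1)] coprodD[OF R(2)] i by auto
  note hl = cop_arr[OF hi(1)[OF i] l] and AR = cop_in[OF o(1,3)] and BR = cop_in[OF o(2,4)]
  have ek: "e' \<cdot> k \<in> Hom C W (cop C (A i) R)" using Cmp_in[OF k e(2)] .
  have eek: "e \<cdot> (e' \<cdot> k) = k" using Cmp_assoc[OF k e(2,1)] e(4) Idt_Cmp[OF k] by simp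
  have dd: "d' \<cdot> (d \<cdot> x) = x" if "x \<in> Hom C Q (cop C (B i) R')" for x Q
    using Cmp_assoc[OF that d(1,2)] d(3) Idt_Cmp[OF that] by simp
  have "d \<cdot> (cop_arr C (hh i) l \<cdot> (e' \<cdot> k)) = d \<cdot> (cinl C (B i) R' \<cdot> w)"
    using Cmp_assoc[OF ek hl(1) d(1)] c(3) Cmp_assoc[OF ek e(1) h] eek eq
      Cmp_assoc[OF w BR(2) d(1)] c(2) by simp
  hence "cop_arr C (hh i) l \<cdot> (e' \<cdot> k) = cinl C (B i) R' \<cdot> w"
    using dd[OF Cmp_in[OF ek hl(1)]] dd[OF Cmp_in[OF w BR(2)]] by metis
  from cop_left_pullback_ex[OF hi(1)[OF i] l w ek this]
  have ex: "\<exists>!u. u \<in> Hom C W (A i) \<and> hh i \<cdot> u = w \<and> cinl C (A i) R \<cdot> u = e' \<cdot> k" .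
  have "cinl C (A i) R \<cdot> u = e' \<cdot> k \<longleftrightarrow> inc i \<cdot> u = k" if u: "u \<in> Hom C W (A i)" for u
  proof -
    have a: "e \<cdot> (cinl C (A i) R \<cdot> u) = inc i \<cdot> u" using Cmp_assoc[OF u AR(2) e(1)] c(1) by simp
    have b: "e' \<cdot> (e \<cdot> (cinl C (A i) R \<cdot> u)) = cinl C (A i) R \<cdot> u"
      using Cmp_assoc[OF Cmp_in[OF u AR(2)] e(1,2)] e(3) Idt_Cmp[OF Cmp_in[OF u AR(2)]] by simp
    show ?thesis using a b eek by metis
  qed
  thus ?thesis using ex by metis
qed

lemma coprod_map_cover:
  "finite I \<Longrightarrow> is_coproduct C I A S inc \<Longrightarrow> is_coproduct C I B S' inc' \<Longrightarrow> h \<in> Hom C S S' \<Longrightarrow>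
    (\<And>j. j \<in> I \<Longrightarrow> hh j \<in> Hom C (A j) (B j)) \<Longrightarrow> (\<And>j. j \<in> I \<Longrightarrow> h \<cdot> inc j = inc' j \<cdot> hh j) \<Longrightarrow>
    (\<And>j. j \<in> I \<Longrightarrow> hh j \<in> T) \<Longrightarrow> h \<in> T"
proof (induction I arbitrary: S S' inc inc' h rule: finite_induct)
  case empty
  have so: "S \<in> Obj C" "S' \<in> Obj C" using coprodD empty by blast+
  obtain k where k: "k \<in> Hom C S' S" using coprod_ex[OF empty(2) so(1), of undefined] by blast
  have "k \<cdot> h = Idt C S"
    by (rule coprod_eqI[OF empty(1) Cmp_in[OF empty(3) k] Idt_in[OF so(1)]]) simp
  moreover have "h \<cdot> k = Idt C S'"
    by (rule coprod_eqI[OF empty(2) Cmp_in[OF k empty(3)] Idt_in[OF so(2)]]) simp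
  ultimately show ?case using iso_T isoI[OF empty(3) k] by blast
next
  case (insert i I)
  have fin: "finite (insert i I)" and i: "i \<in> insert i I" and I: "insert i I - {i} = I"
    using insert.hyps by auto
  obtain R r R' r' l e e' d d' where R: "is_coproduct C (insert i I - {i}) A R r"
      "is_coproduct C (insert i I - {i}) B R' r'"
    and l: "l \<in> Hom C R R'" "\<And>j. j \<in> insert i I - {i} \<Longrightarrow> l \<cdot> r j = r' j \<cdot> hh j"
    and e: "e \<in> Hom C (cop C (A i) R) S" "e' \<in> Hom C S (cop C (A i) R)"
    "e' \<cdot> e = Idt C (cop C (A i) R)" "e \<cdot> e' = Idt C S"
    and d: "d \<in> Hom C (cop C (B i) R') S'" "d' \<in> Hom C S' (cop C (B i) R')"
    "d' \<cdot> d = Idt C (cop C (B i) R')" "d \<cdot> d' = Idt C S'"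
    and c: "h \<cdot> e = d \<cdot> cop_arr C (hh i) l"
    by (rule coprod_map_as_cop_arr[OF insert.prems(1,2) fin i insert.prems(3,4,5)]) blast+
  have hi: "hh i \<in> Hom C (A i) (B i)" using insert.prems(4)[OF i] .
  have "l \<in> T"
    using insert.IH[OF R(1)[unfolded I] R(2)[unfolded I] l(1)] insert.prems(4,6) l(2)[unfolded I] by blast
  hence "cop_arr C (hh i) l \<in> T"
    using cop_arr_cover[of "hh i" l] HomD[OF hi] HomD[OF l(1)] insert.prems(6)[OF i] by simp
  moreover have "d \<in> T" "e' \<in> T" using iso_T isoI[OF d(1,2,3,4)] isoI[OF e(2,1,4,3)] by blast+
  moreover note hk = cop_arr(1)[OF hi l(1)]
  ultimately have "d \<cdot> cop_arr C (hh i) l \<in> T" "e' \<in> T"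
    using Cmp_T[of "cop_arr C (hh i) l" d] HomD[OF hk] HomD[OF d(1)] by auto
  hence "(h \<cdot> e) \<cdot> e' \<in> T"
    unfolding c using Cmp_T[of e' "d \<cdot> cop_arr C (hh i) l"] HomD[OF e(2)] HomD[OF Cmp_in[OF hk d(1)]] by simp
  thus ?case using Cmp_assoc[OF e(2,1) insert.prems(3)] e(4) Cmp_Idt[OF insert.prems(3)] by simp
qed

text \<open>Essential surjectivity of the coproduct functor on slices splits off the part of \<open>Z\<close> over one summand
  at a time. The induction starts from a single summand; for no summands the claim would be that
  initial objects are strict.\<close>

lemma coprod_decompose:
  "finite I \<Longrightarrow> I \<noteq> {} \<Longrightarrow> is_coproduct C I B S inc \<Longrightarrow> h \<in> Hom C Z S \<Longrightarrow>
    \<exists>A z hh. is_coproduct C I A Z z \<and> (\<forall>i \<in> I. hh i \<in> Hom C (A i) (B i) \<and> h \<cdot> z i = inc i \<cdot> hh i)"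
proof (induction I arbitrary: S inc h Z rule: finite_ne_induct)
  case (singleton i)
  have S: "inc i \<in> Hom C (B i) S" using coprodD(3)[OF singleton(1)] by simp
  have Z: "Z \<in> Obj C" using HomD[OF singleton(2)] by blast
  obtain d where d: "d \<in> Hom C S (B i)" "d \<cdot> inc i = Idt C (B i)" "inc i \<cdot> d = Idt C S"
    using isoE[OF coprod_singleton_iso[OF singleton(1)] S] .
  have "is_coproduct C {i} (\<lambda>_. Z) Z (\<lambda>_. Idt C Z)"
  proof (rule coprodI)
    show "\<exists>h \<in> Hom C Z Q. \<forall>j \<in> {i}. h \<cdot> Idt C Z = g j"
      if "Q \<in> Obj C" "\<And>j. j \<in> {i} \<Longrightarrow> g j \<in> Hom C Z Q" for Q g
      using that(2)[of i] Cmp_Idt by (intro bexI[of _ "g i"]) auto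
    show "h = k" if "h \<in> Hom C Z Q" "k \<in> Hom C Z Q" "\<And>j. j \<in> {i} \<Longrightarrow> h \<cdot> Idt C Z = k \<cdot> Idt C Z" for h k Q
      using that(3) Cmp_Idt[OF that(1)] Cmp_Idt[OF that(2)] by simp
  qed (use Z Idt_in in auto)
  moreover have "d \<cdot> h \<in> Hom C Z (B i)" using Cmp_in[OF singleton(2) d(1)] .
  moreover have "h \<cdot> Idt C Z = inc i \<cdot> (d \<cdot> h)"
    using Cmp_Idt[OF singleton(2)] Cmp_assoc[OF singleton(2) d(1) S] d(3) Idt_Cmp[OF singleton(2)] by simp
  ultimately show ?case by (intro exI[of _ "\<lambda>_. Z"] exI[of _ "\<lambda>_. Idt C Z"] exI[of _ "\<lambda>_. d \<cdot> h"]) simp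
next
  case (insert i I)
  have fin: "finite (insert i I)" and i: "i \<in> insert i I" and I: "insert i I - {i} = I"
    using insert.hyps by auto
  obtain R r e e' where R: "is_coproduct C I B R r" and e: "e \<in> Hom C (cop C (B i) R) S"
    "e' \<in> Hom C S (cop C (B i) R)" "e' \<cdot> e = Idt C (cop C (B i) R)" "e \<cdot> e' = Idt C S"
    "e \<cdot> cinl C (B i) R = inc i" "\<And>j. j \<in> I \<Longrightarrow> (e \<cdot> cinr C (B i) R) \<cdot> r j = inc j"
    using coprod_as_cop[OF insert.prems(1) fin i] unfolding I by metis
  have o: "B i \<in> Obj C" "R \<in> Obj C" using coprodD[OF insert.prems(1)] coprodD[OF R] by auto
  note BR = cop_in[OF o]
  have eh: "e' \<cdot> h \<in> Hom C Z (cop C (B i) R)" using Cmp_in[OF insert.prems(2) e(2)] .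
  obtain U V f g d where f: "f \<in> Hom C U (B i)" and g: "g \<in> Hom C V R"
    and d: "d \<in> Hom C (cop C U V) Z" "iso C d" "(e' \<cdot> h) \<cdot> d = cop_arr C f g"
    using cop_over_surj[OF eh o] .
  have UV: "U \<in> Obj C" "V \<in> Obj C" using HomD[OF f] HomD[OF g] by auto
  note c = cop_in[OF UV] and fg = cop_arr[OF f g]
  obtain A z hh where A: "is_coproduct C I A V z"
    and hh: "\<And>j. j \<in> I \<Longrightarrow> hh j \<in> Hom C (A j) (B j) \<and> g \<cdot> z j = r j \<cdot> hh j"
    using insert.IH[OF R g] by blast
  define A' where "A' = (\<lambda>j. if j = i then U else A j)"
  have A': "is_coproduct C (insert i I - {i}) A' V z"
    using A insert.hyps(3) unfolding I A'_def is_coproduct_def by (auto split: if_splits) metis+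
  have "A' i \<in> Obj C" using UV by (simp add: A'_def)
  have Ai: "A' i = U" by (simp add: A'_def)
  from coprod_iso[OF coprod_split[OF A' i \<open>A' i \<in> Obj C\<close>, unfolded Ai] d(1,2)]
  have cop: "is_coproduct C (insert i I) A' Z
      (\<lambda>j. d \<cdot> (if j = i then cinl C U V else cinr C U V \<cdot> z j))" (is "is_coproduct _ _ _ _ ?z") .
  have hd: "h \<cdot> d = e \<cdot> cop_arr C f g"
    using d(3) Cmp_assoc[OF d(1) insert.prems(2) e(2)] Cmp_assoc[OF d(1) eh e(1)]
      Cmp_assoc[OF insert.prems(2) e(2,1)] e(4) Idt_Cmp[OF insert.prems(2)] by simp
  have maps: "h \<cdot> ?z j = inc j \<cdot> (if j = i then f else hh j) \<and> (if j = i then f else hh j) \<in> Hom C (A' j) (B j)"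
    if j: "j \<in> insert i I" for j
  proof (cases "j = i")
    case True
    have "h \<cdot> (d \<cdot> cinl C U V) = (e \<cdot> cop_arr C f g) \<cdot> cinl C U V"
      using Cmp_assoc[OF c(2) d(1) insert.prems(2)] hd by simp
    also have "\<dots> = inc i \<cdot> f"
      using Cmp_assoc[OF c(2) fg(1) e(1)] fg(2) Cmp_assoc[OF f BR(2) e(1)] e(5) by simp
    finally show ?thesis using True f by (simp add: A'_def)
  next
    case False
    hence jI: "j \<in> I" using j by simp
    note zj = coprodD(3)[OF A jI] and rj = coprodD(3)[OF R jI]
    have hj: "hh j \<in> Hom C (A j) (B j)" "g \<cdot> z j = r j \<cdot> hh j" using hh[OF jI] by auto
    have "h \<cdot> (d \<cdot> (cinr C U V \<cdot> z j)) = (e \<cdot> (cop_arr C f g \<cdot> cinr C U V)) \<cdot> z j"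
      using Cmp_assoc[OF Cmp_in[OF zj c(3)] d(1) insert.prems(2)] hd
        Cmp_assoc[OF zj c(3) Cmp_in[OF fg(1) e(1)]] Cmp_assoc[OF c(3) fg(1) e(1)] by simp
    also have "\<dots> = (e \<cdot> cinr C (B i) R) \<cdot> (g \<cdot> z j)"
      using fg(3) Cmp_assoc[OF g BR(3) e(1)] Cmp_assoc[OF zj g Cmp_in[OF BR(3) e(1)]] by simp
    also have "\<dots> = inc j \<cdot> hh j"
      using hj(2) Cmp_assoc[OF hj(1) rj Cmp_in[OF BR(3) e(1)]] e(6)[OF jI] by simp
    finally show ?thesis using False hj(1) by (simp add: A'_def)
  qed
  show ?case
  proof (rule exI[of _ A'], rule exI[of _ ?z], rule exI[of _ "\<lambda>j. if j = i then f else hh j"],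
      intro conjI ballI)
    show "is_coproduct C (insert i I) A' Z ?z" by (rule cop)
    fix j assume j: "j \<in> insert i I"
    show "(if j = i then f else hh j) \<in> Hom C (A' j) (B j)" by (rule conjunct2[OF maps[OF j]])
    show "h \<cdot> ?z j = inc j \<cdot> (if j = i then f else hh j)" by (rule conjunct1[OF maps[OF j]])
  qed
qed

end

section \<open>Gluing covers over a coproduct of terminal objects\<close>

context extensive_site begin

definition fibre :: "('o, 'a, 'e) psh \<Rightarrow> ('o \<Rightarrow> 'e \<Rightarrow> 'a) \<Rightarrow> 'a \<Rightarrow> ('o, 'a, 'e) psh" where
  "fibre F \<tau> j = F\<lparr>elts := (\<lambda>Z. {x \<in> elts F Z. \<tau> Z x = j \<cdot> bang C one Z})\<rparr>"

lemma fibre_sel: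
  "x \<in> elts (fibre F \<tau> j) Z \<longleftrightarrow> x \<in> elts F Z \<and> \<tau> Z x = j \<cdot> bang C one Z"
  "restr (fibre F \<tau> j) = restr F"
  by (simp_all add: fibre_def)

lemma bang_unique: "h \<in> Hom C Z one \<Longrightarrow> h = bang C one Z"
  using to_one_unique bang_in HomD(4) by blast

lemma bang_Cmp: "h \<in> Hom C Z' Z \<Longrightarrow> bang C one Z \<cdot> h = bang C one Z'"
  using bang_unique[OF Cmp_in[OF _ bang_in]] HomD(5) by blast

lemma fibre_presheaf:
  assumes F: "presheaf F" and \<tau>: "natural F (yo C B) \<tau>" and j: "j \<in> Hom C one B"
  shows "presheaf (fibre F \<tau> j)"
proof (rule presheafI)
  fix Z Z' h x assume h: "h \<in> Hom C Z' Z" and x: "x \<in> elts (fibre F \<tau> j) Z"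
  have Z: "Z \<in> Obj C" using HomD[OF h] by blast
  have "\<tau> Z' (restr F h x) = \<tau> Z x \<cdot> h"
    using naturalD(2)[OF \<tau> h] x by (simp add: fibre_sel yo_def)
  also have "\<dots> = j \<cdot> bang C one Z'"
    using x Cmp_assoc[OF h bang_in[OF Z] j] bang_Cmp[OF h] by (simp add: fibre_sel)
  finally show "restr (fibre F \<tau> j) h x \<in> elts (fibre F \<tau> j) Z'"
    using presheafD(1)[OF F h] x by (simp add: fibre_sel)
qed (auto simp: fibre_sel presheafD(2,3)[OF F])

text \<open>A point \<open>Z \<rightarrow> \<Squnion>\<^sub>i \<one>\<close> cuts \<open>Z\<close> into pieces, on each of which one is in a single fibre. Hence a
  presheaf over \<open>\<Squnion>\<^sub>i \<one>\<close> that turns coproducts into products is represented by the coproduct of objects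
  representing its fibres, and a coproduct of covers is a cover.\<close>

lemma cover_map_glue:
  assumes fin: "finite I" "I \<noteq> {}"
    and S: "is_coproduct C I A S inc" and J: "is_coproduct C I (\<lambda>_. one) B \<iota>"
    and F: "presheaf F" and \<phi>: "natural (yo C S) F \<phi>" and \<tau>: "natural F (yo C B) \<tau>"
    and glue: "\<And>Q Z z x. is_coproduct C I Q Z z \<Longrightarrow> (\<And>i. i \<in> I \<Longrightarrow> x i \<in> elts F (Q i)) \<Longrightarrow>
      \<exists>y \<in> elts F Z. \<forall>i \<in> I. restr F (z i) y = x i"
    and sep: "\<And>Q Z z x y. is_coproduct C I Q Z z \<Longrightarrow> x \<in> elts F Z \<Longrightarrow> y \<in> elts F Z \<Longrightarrow>
      (\<And>i. i \<in> I \<Longrightarrow> restr F (z i) x = restr F (z i) y) \<Longrightarrow> x = y"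
    and fib: "\<And>i. i \<in> I \<Longrightarrow> cover_map (yo C (A i)) (fibre F \<tau> (\<iota> i)) (\<lambda>Z g. \<phi> Z (inc i \<cdot> g))"
  shows "cover_map (yo C S) F \<phi>"
proof -
  note So = coprodD(1)[OF S] and Ao = coprodD(2)[OF S] and inc = coprodD(3)[OF S]
    and \<iota> = coprodD(3)[OF J]
  have fp: "presheaf (fibre F \<tau> (\<iota> i))" if "i \<in> I" for i using cover_mapD(2)[OF fib[OF that]] .
  have "\<exists>V v c. universal (fibre F \<tau> (\<iota> i)) V v \<and> c \<in> Hom C (A i) V \<and> c \<in> T \<and>
      restr F c v = \<phi> (A i) (inc i)" if i: "i \<in> I" for i
  proof -
    obtain V v where v: "universal (fibre F \<tau> (\<iota> i)) V v"
      using cover_mapD(5)[OF fib[OF i]] unfolding representable_def by blast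
    obtain c where "c \<in> Hom C (A i) V" "c \<in> T"
      "restr (fibre F \<tau> (\<iota> i)) c v = \<phi> (A i) (inc i \<cdot> Idt C (A i))"
      using cover_map_classifying[OF fib[OF i] yo_universal[OF Ao[OF i]] v] .
    thus ?thesis using v Cmp_Idt[OF inc[OF i]] by (auto simp: fibre_sel)
  qed
  then obtain V v c where v: "\<And>i. i \<in> I \<Longrightarrow> universal (fibre F \<tau> (\<iota> i)) (V i) (v i)"
    and c: "\<And>i. i \<in> I \<Longrightarrow> c i \<in> Hom C (A i) (V i)" "\<And>i. i \<in> I \<Longrightarrow> c i \<in> T"
      "\<And>i. i \<in> I \<Longrightarrow> restr F (c i) (v i) = \<phi> (A i) (inc i)"
    by metis
  have Vo: "\<And>i. i \<in> I \<Longrightarrow> V i \<in> Obj C" using universalD(1)[OF v] .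
  have vF: "v i \<in> elts F (V i)" "\<tau> (V i) (v i) = \<iota> i \<cdot> bang C one (V i)" if "i \<in> I" for i
    using universalD(2)[OF v[OF that]] by (simp_all add: fibre_sel)
  obtain U k where U: "is_coproduct C I V U k" by (rule finite_coproduct[of I V, OF fin(1) Vo])
  note Uo = coprodD(1)[OF U] and k = coprodD(3)[OF U]
  obtain w where w: "w \<in> elts F U" "\<And>i. i \<in> I \<Longrightarrow> restr F (k i) w = v i"
    using glue[OF U, of v] vF(1) by blast
  have "\<And>i. i \<in> I \<Longrightarrow> k i \<cdot> c i \<in> Hom C (A i) U" using Cmp_in[OF c(1) k] .
  then obtain d where d: "d \<in> Hom C S U" "\<And>i. i \<in> I \<Longrightarrow> d \<cdot> inc i = k i \<cdot> c i"
    using coprod_ex[OF S Uo, of "\<lambda>i. k i \<cdot> c i"] by blast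
  have dT: "d \<in> T" by (rule coprod_map_cover[OF fin(1) S U d(1) c(1) d(2) c(2)])
  have \<phi>1: "\<phi> S (Idt C S) \<in> elts F S" using naturalD(1)[OF \<phi> So] Idt_in[OF So] by (simp add: yo_def)
  (* on the summand A i both sides are the image under \<phi> of the inclusion *)
  have dw: "restr F d w = \<phi> S (Idt C S)"
  proof (rule sep[OF S presheafD(1)[OF F d(1) w(1)] \<phi>1])
    fix i assume i: "i \<in> I"
    have "restr F (inc i) (restr F d w) = restr F (c i) (v i)"
      using presheafD(2)[OF F d(1) inc[OF i] w(1)] d(2)[OF i] presheafD(2)[OF F k[OF i] c(1)[OF i] w(1)]
        w(2)[OF i] by simp
    also have "\<dots> = restr F (inc i) (\<phi> S (Idt C S))"
      using c(3)[OF i] naturalD(2)[OF \<phi> inc[OF i], of "Idt C S"] Idt_in[OF So] Idt_Cmp[OF inc[OF i]]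
      by (simp add: yo_def)
    finally show "restr F (inc i) (restr F d w) = restr F (inc i) (\<phi> S (Idt C S))" .
  qed
  have \<tau>w: "\<tau> U w \<in> Hom C U B" using naturalD(1)[OF \<tau> Uo w(1)] by (simp add: yo_def)
  have \<tau>k: "\<tau> U w \<cdot> k i = \<iota> i \<cdot> bang C one (V i)" if i: "i \<in> I" for i
    using naturalD(2)[OF \<tau> k[OF i] w(1)] w(2)[OF i] vF(2)[OF i] by (simp add: yo_def)
  have "universal F U w"
    unfolding universal_def
  proof (intro conjI ballI Uo w(1))
    fix Z x assume Z: "Z \<in> Obj C" and x: "x \<in> elts F Z"
    have \<tau>x: "\<tau> Z x \<in> Hom C Z B" using naturalD(1)[OF \<tau> Z x] by (simp add: yo_def)
    obtain Q z b where Q: "is_coproduct C I Q Z z"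
      and b: "\<And>i. i \<in> I \<Longrightarrow> b i \<in> Hom C (Q i) one \<and> \<tau> Z x \<cdot> z i = \<iota> i \<cdot> b i"
      using coprod_decompose[OF fin J \<tau>x] by blast
    note Qo = coprodD(2)[OF Q] and z = coprodD(3)[OF Q]
    have piece: "restr F (z i) x \<in> elts (fibre F \<tau> (\<iota> i)) (Q i)" if i: "i \<in> I" for i
      unfolding fibre_sel
      using presheafD(1)[OF F z[OF i] x] naturalD(2)[OF \<tau> z[OF i] x] b[OF i] bang_unique[of "b i"]
      by (auto simp: yo_def)
    have "\<exists>h. h \<in> Hom C (Q i) (V i) \<and> restr F h (v i) = restr F (z i) x" if i: "i \<in> I" for i
      using universalD(3)[OF v[OF i] Qo[OF i] piece[OF i]] by (simp add: fibre_sel)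
    then obtain h where h: "\<And>i. i \<in> I \<Longrightarrow> h i \<in> Hom C (Q i) (V i)"
      "\<And>i. i \<in> I \<Longrightarrow> restr F (h i) (v i) = restr F (z i) x" by metis
    have "\<And>i. i \<in> I \<Longrightarrow> k i \<cdot> h i \<in> Hom C (Q i) U" using Cmp_in[OF h(1) k] .
    then obtain g where g: "g \<in> Hom C Z U" "\<And>i. i \<in> I \<Longrightarrow> g \<cdot> z i = k i \<cdot> h i"
      using coprod_ex[OF Q Uo, of "\<lambda>i. k i \<cdot> h i"] by blast
    have gx: "restr F g w = x"
    proof (rule sep[OF Q presheafD(1)[OF F g(1) w(1)] x])
      fix i assume i: "i \<in> I"
      show "restr F (z i) (restr F g w) = restr F (z i) x"
        using presheafD(2)[OF F g(1) z[OF i] w(1)] g(2)[OF i] presheafD(2)[OF F k[OF i] h(1)[OF i] w(1)]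
          w(2)[OF i] h(2)[OF i] by simp
    qed
    (* uniqueness: the square of \<tau> over the summand i is a pullback, so any solution maps
       the piece of Z over i into the object V i, where it is determined *)
    have lift: "g' \<cdot> z i = k i \<cdot> h i" if g': "g' \<in> Hom C Z U" "restr F g' w = x" and i: "i \<in> I" for g' i
    proof -
      have g'z: "g' \<cdot> z i \<in> Hom C (Q i) U" using Cmp_in[OF z[OF i] g'(1)] .
      have "\<tau> U w \<cdot> (g' \<cdot> z i) = \<iota> i \<cdot> b i"
        using Cmp_assoc[OF z[OF i] g'(1) \<tau>w] naturalD(2)[OF \<tau> g'(1) w(1)] g'(2) b[OF i]
        by (simp add: yo_def)
      from coprod_square_pullback[OF U J fin(1) i \<tau>w bang_in[OF Vo] \<tau>k conjunct1[OF b[OF i]] g'z this]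
      obtain u where u: "u \<in> Hom C (Q i) (V i)" "k i \<cdot> u = g' \<cdot> z i" by blast
      have "restr F u (v i) = restr F (z i) x"
        using presheafD(2)[OF F k[OF i] u(1) w(1)] w(2)[OF i] u(2) presheafD(2)[OF F g'(1) z[OF i] w(1)]
          g'(2) by simp
      hence "u = h i"
        using universal_eqI[OF v[OF i] fp[OF i] u(1) h(1)[OF i]] h(2)[OF i] by (simp add: fibre_sel)
      thus ?thesis using u(2) by simp
    qed
    show "\<exists>!g. g \<in> Hom C Z U \<and> restr F g w = x"
    proof (rule ex1I[of _ g])
      show "g \<in> Hom C Z U \<and> restr F g w = x" using g(1) gx by simp
      fix g' assume "g' \<in> Hom C Z U \<and> restr F g' w = x"
      thus "g' = g" using coprod_eqI[OF Q _ g(1)] lift g(2) by simp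
    qed
  qed
  thus ?thesis unfolding cover_map_def
    using yo_presheaf F \<phi> yo_universal[OF So] d(1) dT dw by blast
qed

lemma Rel_separated:
  assumes z: "is_coproduct C I Q Z z" and W: "simplicial_object C W" and J: "simplicial_object C J"
    and x: "x \<in> elts (Rel W J \<pi> M K) Z" and y: "y \<in> elts (Rel W J \<pi> M K) Z"
    and eq: "\<And>i. i \<in> I \<Longrightarrow> restr (Rel W J \<pi> M K) (z i) x = restr (Rel W J \<pi> M K) (z i) y"
  shows "x = y"
proof -
  obtain \<rho> j \<rho>' j' where xy: "x = (\<rho>, j)" "y = (\<rho>', j')" by (cases x; cases y)
  have \<rho>: "\<rho> \<in> fam W M K Z" "\<rho>' \<in> fam W M K Z" and j: "j \<in> Hom C Z (omap J M)" "j' \<in> Hom C Z (omap J M)"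
    using x y unfolding xy Rel_elts by simp_all
  have e1: "(\<lambda>\<theta>\<in>simplices M K. \<rho> \<theta> \<cdot> z i) = (\<lambda>\<theta>\<in>simplices M K. \<rho>' \<theta> \<cdot> z i)"
    and e2: "j \<cdot> z i = j' \<cdot> z i" if "i \<in> I" for i
    using eq[OF that] unfolding xy Rel_restr by simp_all
  have "\<rho> = \<rho>'"
  proof (rule fam_eqI[OF \<rho>])
    fix \<theta> assume \<theta>: "\<theta> \<in> simplices M K"
    show "\<rho> \<theta> = \<rho>' \<theta>"
      by (rule coprod_eqI[OF z famD(2)[OF \<rho>(1) \<theta>] famD(2)[OF \<rho>(2) \<theta>]])
        (use fun_cong[OF e1, of _ \<theta>] \<theta> in simp)
  qed
  moreover have "j = j'" by (rule coprod_eqI[OF z j e2])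
  ultimately show ?thesis unfolding xy by simp
qed

lemma Rel_glue:
  assumes z: "is_coproduct C I Q Z z" and W: "simplicial_object C W" and J: "simplicial_object C J"
    and \<pi>: "simplicial_map C W J \<pi>" and K: "complex M K" and M: "0 < M"
    and x: "\<And>i. i \<in> I \<Longrightarrow> x i \<in> elts (Rel W J \<pi> M K) (Q i)"
  shows "\<exists>y \<in> elts (Rel W J \<pi> M K) Z. \<forall>i \<in> I. restr (Rel W J \<pi> M K) (z i) y = x i"
proof -
  note zi = coprodD(3)[OF z]
  have \<rho>: "fst (x i) \<in> fam W M K (Q i)" and j: "snd (x i) \<in> Hom C (Q i) (omap J M)"
    and r: "\<And>\<theta>. \<theta> \<in> simplices M K \<Longrightarrow> \<pi> (fst \<theta>) \<cdot> fst (x i) \<theta> = amap J \<theta> \<cdot> snd (x i)" if "i \<in> I" for i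
    using x[OF that] Rel_elts[of "fst (x i)" "snd (x i)"] by simp_all
  obtain l where l: "l \<in> Hom C Z (omap J M)" "\<And>i. i \<in> I \<Longrightarrow> l \<cdot> z i = snd (x i)"
    using coprod_ex[OF z sobj_Obj[OF J M], of "\<lambda>i. snd (x i)"] j by blast
  have "\<exists>g. g \<in> Hom C Z (omap W (fst \<theta>)) \<and> (\<forall>i \<in> I. g \<cdot> z i = fst (x i) \<theta>)" if \<theta>: "\<theta> \<in> simplices M K" for \<theta>
    using coprod_ex[OF z sobj_Obj[OF W simplicesD(3)[OF \<theta>]], of "\<lambda>i. fst (x i) \<theta>"] famD(2)[OF \<rho> \<theta>]
    by metis
  then obtain g where g: "\<And>\<theta>. \<theta> \<in> simplices M K \<Longrightarrow> g \<theta> \<in> Hom C Z (omap W (fst \<theta>))"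
    "\<And>\<theta> i. \<theta> \<in> simplices M K \<Longrightarrow> i \<in> I \<Longrightarrow> g \<theta> \<cdot> z i = fst (x i) \<theta>" by metis
  have gf: "restrict g (simplices M K) \<in> fam W M K Z"
  proof (rule famI)
    fix \<theta> assume \<theta>: "\<theta> \<in> simplices M K"
    show "restrict g (simplices M K) \<theta> \<in> Hom C Z (omap W (fst \<theta>))" using g(1) \<theta> by simp
    fix k \<phi> assume \<phi>: "\<phi> \<in> Hom Delta k (fst \<theta>)"
    note \<theta>\<phi> = simplices_Cmp[OF K \<theta> \<phi>]
    have k: "fst (Cmp Delta_plus \<theta> \<phi>) = k" using Hom_DeltaD(1)[OF \<phi>] by simp
    have "g (Cmp Delta_plus \<theta> \<phi>) = amap W \<phi> \<cdot> g \<theta>"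
    proof (rule coprod_eqI[OF z g(1)[OF \<theta>\<phi>, unfolded k] Cmp_in[OF g(1)[OF \<theta>] sobj_amap[OF W \<phi>]]])
      fix i assume i: "i \<in> I"
      show "g (Cmp Delta_plus \<theta> \<phi>) \<cdot> z i = amap W \<phi> \<cdot> g \<theta> \<cdot> z i"
        using g(2)[OF \<theta>\<phi> i] g(2)[OF \<theta> i] famD(3)[OF \<rho>[OF i] \<theta> \<phi>]
          Cmp_assoc[OF zi[OF i] g(1)[OF \<theta>] sobj_amap[OF W \<phi>]] by simp
    qed
    thus "restrict g (simplices M K) (Cmp Delta_plus \<theta> \<phi>) = amap W \<phi> \<cdot> restrict g (simplices M K) \<theta>"
      using \<theta> \<theta>\<phi> by simp
  qed simp
  have "\<pi> (fst \<theta>) \<cdot> g \<theta> = amap J \<theta> \<cdot> l" if \<theta>: "\<theta> \<in> simplices M K" for \<theta>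
  proof -
    note h = smap_Hom[OF \<pi> simplicesD(3)[OF \<theta>]] and a = sobj_amap[OF J simplicesD(1)[OF \<theta>]]
    show ?thesis
    proof (rule coprod_eqI[OF z Cmp_in[OF g(1)[OF \<theta>] h] Cmp_in[OF l(1) a]])
      fix i assume i: "i \<in> I"
      show "\<pi> (fst \<theta>) \<cdot> g \<theta> \<cdot> z i = amap J \<theta> \<cdot> l \<cdot> z i"
        using Cmp_assoc[OF zi[OF i] g(1)[OF \<theta>] h] Cmp_assoc[OF zi[OF i] l(1) a] g(2)[OF \<theta> i]
          l(2)[OF i] r[OF i \<theta>] by simp
    qed
  qed
  hence "(restrict g (simplices M K), l) \<in> elts (Rel W J \<pi> M K) Z" unfolding Rel_elts using gf l(1) by simp
  moreover have "restr (Rel W J \<pi> M K) (z i) (restrict g (simplices M K), l) = x i" if i: "i \<in> I" for i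
  proof -
    have "(\<lambda>\<theta>\<in>simplices M K. restrict g (simplices M K) \<theta> \<cdot> z i) = fst (x i)"
      by (rule extensionalityI[OF _ famD(1)[OF \<rho>[OF i]]]) (use g(2)[OF _ i] in auto)
    thus ?thesis unfolding Rel_restr using l(2)[OF i] by (simp add: prod_eq_iff)
  qed
  ultimately show ?thesis by blast
qed

end


section \<open>The fibres of the total object of a cograph\<close>

locale cograph_total = extensive_site C T one
  for C :: "('o, 'a) cat" (structure) and T :: "'a set" and one :: 'o +
  fixes X Y W J :: "('o, 'a) sobj" and f \<pi> :: "nat \<Rightarrow> 'a" and \<Gamma> :: "('o, 'a) bisobj"
    and inc :: "nat \<times> nat \<Rightarrow> 'a" and \<iota> :: "nat \<Rightarrow> darr \<Rightarrow> 'a" and p q :: "nat \<Rightarrow> nat \<Rightarrow> 'a"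
  assumes X: "simplicial_object C X" and Y: "simplicial_object C Y" and f: "simplicial_map C X Y f"
    and W: "simplicial_object C W" and J: "simplicial_object C J" and \<pi>: "simplicial_map C W J \<pi>"
    and \<Gamma>: "aug_bisimplicial_object C \<Gamma>"
    and pb: "is_pullback C (augment_map C one f a) (amap (augment C one Y) (front a b))
      (omap \<Gamma> (a, b)) (p a b) (q a b)"
    and p_nat: "\<alpha> \<in> Hom Delta_plus a' a \<Longrightarrow> \<beta> \<in> Hom Delta_plus b' b \<Longrightarrow>
      p a' b' \<cdot> amap \<Gamma> (\<alpha>, \<beta>) = amap (augment C one X) \<alpha> \<cdot> p a b"
    and q_nat: "\<alpha> \<in> Hom Delta_plus a' a \<Longrightarrow> \<beta> \<in> Hom Delta_plus b' b \<Longrightarrow>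
      q a' b' \<cdot> amap \<Gamma> (\<alpha>, \<beta>) = amap (augment C one Y) (join \<alpha> \<beta>) \<cdot> q a b"
    and W_cop: "0 < n \<Longrightarrow> is_coproduct C {(a, b). a + b = n} (omap \<Gamma>) (omap W n) inc"
    and W_nat: "\<alpha> \<in> Hom Delta_plus a' a \<Longrightarrow> \<beta> \<in> Hom Delta_plus b' b \<Longrightarrow> 0 < a' + b' \<Longrightarrow>
      amap W (join \<alpha> \<beta>) \<cdot> inc (a, b) = inc (a', b') \<cdot> amap \<Gamma> (\<alpha>, \<beta>)"
    and J_cop: "0 < n \<Longrightarrow> is_coproduct C (elts (simplex 1) n) (\<lambda>_. one) (omap J n) (\<iota> n)"
    and J_nat: "\<theta> \<in> Hom Delta k n \<Longrightarrow> s \<in> Hom Delta n 2 \<Longrightarrow>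
      amap J \<theta> \<cdot> \<iota> n s = \<iota> k (Cmp Delta_plus s \<theta>)"
    and \<pi>_inc: "0 < a + b \<Longrightarrow>
      \<pi> (a + b) \<cdot> inc (a, b) = \<iota> (a + b) (cut a b) \<cdot> bang C one (omap \<Gamma> (a, b))"
begin

lemma augment_amap:
  assumes "simplicial_object C Y'" "\<theta> \<in> Hom Delta_plus k n" "0 < k"
  shows "amap (augment C one Y') \<theta> = amap Y' \<theta>"
  using assms Hom_Delta_plusD[OF assms(2)] by (simp add: augment_def Let_def)

lemma pbD:
  shows "omap \<Gamma> (a, b) \<in> Obj C"
    and "p a b \<in> Hom C (omap \<Gamma> (a, b)) (Dom C (augment_map C one f a))"
    and "q a b \<in> Hom C (omap \<Gamma> (a, b)) (Dom C (amap (augment C one Y) (front a b)))"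
    and "augment_map C one f a \<cdot> p a b = amap (augment C one Y) (front a b) \<cdot> q a b"
  using pb[of a b] unfolding is_pullback_def by - (elim conjE, assumption)+

lemmas \<Gamma>_obj = pbD(1)

lemma \<Gamma>_amap:
  assumes "\<alpha> \<in> Hom Delta_plus a' a" "\<beta> \<in> Hom Delta_plus b' b"
  shows "amap \<Gamma> (\<alpha>, \<beta>) \<in> Hom C (omap \<Gamma> (a, b)) (omap \<Gamma> (a', b'))"
proof -
  have "(\<alpha>, \<beta>) \<in> Arr (prod_cat (op_cat Delta_plus) (op_cat Delta_plus))"
    using assms by (simp add: prod_cat_def op_cat_def Hom_def)
  hence "amap \<Gamma> (\<alpha>, \<beta>) \<in> Hom C (omap \<Gamma> (Dom (prod_cat (op_cat Delta_plus) (op_cat Delta_plus)) (\<alpha>, \<beta>)))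
      (omap \<Gamma> (Cod (prod_cat (op_cat Delta_plus) (op_cat Delta_plus)) (\<alpha>, \<beta>)))"
    using \<Gamma>[unfolded aug_bisimplicial_object_def is_fctr_def] by (elim conjE) (erule bspec)
  thus ?thesis using Hom_Delta_plusD[OF assms(1)] Hom_Delta_plusD[OF assms(2)]
    by (simp add: prod_cat_def op_cat_def)
qed

lemma one_obj: "one \<in> Obj C"
  using one_terminal unfolding terminal_def by blast

lemma leg_sources:
  "Dom C (augment_map C one f a) = (if a = 0 then one else omap X a)"
  "0 < a + b \<Longrightarrow> Dom C (amap (augment C one Y) (front a b)) = omap Y (a + b)"
proof -
  show "Dom C (augment_map C one f a) = (if a = 0 then one else omap X a)"
    using HomD[OF Idt_in[OF one_obj]] HomD[OF smap_Hom[OF f]] by (simp add: augment_map_def)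
  assume ab: "0 < a + b"
  show "Dom C (amap (augment C one Y) (front a b)) = omap Y (a + b)"
  proof (cases "a = 0")
    case True
    thus ?thesis using ab HomD[OF bang_in[OF sobj_Obj[OF Y ab]]]
      by (simp add: augment_def Let_def front_def)
  next
    case False
    thus ?thesis
      using augment_amap[OF Y front_Hom] HomD[OF sobj_amap[OF Y Hom_Delta_pos[OF front_Hom]]] by simp
  qed
qed

lemma p_in: "p a b \<in> Hom C (omap \<Gamma> (a, b)) (if a = 0 then one else omap X a)"
  using pbD(2)[of a b] unfolding leg_sources(1) .

lemma q_in: "0 < a + b \<Longrightarrow> q a b \<in> Hom C (omap \<Gamma> (a, b)) (omap Y (a + b))"
  using pbD(3)[of a b] leg_sources(2)[of a b] by simp

lemma pb_square: "0 < a \<Longrightarrow> f a \<cdot> p a b = amap Y (front a b) \<cdot> q a b"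
proof -
  assume a: "0 < a"
  show ?thesis using pbD(4)[of a b] a augment_amap[OF Y front_Hom a] by (simp add: augment_map_def)
qed

lemma pair_ex:
  assumes u: "u \<in> Hom C Z (if a = 0 then one else omap X a)" and v: "v \<in> Hom C Z (omap Y (a + b))"
    and ab: "0 < a + b" and eq: "0 < a \<Longrightarrow> f a \<cdot> u = amap Y (front a b) \<cdot> v"
  obtains g where "g \<in> Hom C Z (omap \<Gamma> (a, b))" "p a b \<cdot> g = u" "q a b \<cdot> g = v"
proof -
  have "augment_map C one f a \<cdot> u = amap (augment C one Y) (front a b) \<cdot> v"
  proof (cases "a = 0")
    case True
    have "amap (augment C one Y) (front a b) \<in> Hom C (omap Y (a + b)) one"
      using True ab bang_in[OF sobj_Obj[OF Y ab]] by (simp add: augment_def Let_def front_def)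
    thus ?thesis using Cmp_in[OF v] to_one_unique u True Idt_Cmp[of u Z one]
      by (simp add: augment_map_def)
  next
    case False
    thus ?thesis using eq augment_amap[OF Y front_Hom] by (simp add: augment_map_def)
  qed
  from pullback_arrow_ex[OF pb u[folded leg_sources(1)] v[folded leg_sources(2)[OF ab]] this] that
  show ?thesis .
qed

lemma inc_in: "0 < a + b \<Longrightarrow> inc (a, b) \<in> Hom C (omap \<Gamma> (a, b)) (omap W (a + b))"
  using coprodD(3)[OF W_cop, of "a + b" "(a, b)"] by simp

lemma cut_simplex: "0 < a + b \<Longrightarrow> cut a b \<in> Hom Delta (a + b) 2"
  by (rule Hom_Delta_pos[OF cut_Hom])

lemma \<iota>_in: "0 < a + b \<Longrightarrow> \<iota> (a + b) (cut a b) \<in> Hom C one (omap J (a + b))"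
  using coprodD(3)[OF J_cop, of "a + b" "cut a b"] cut_simplex[of a b]
  by (simp add: elts_simplex numeral_2_eq_2)

lemma J_cop_cut:
  assumes "0 < n"
  shows "is_coproduct C {(a, b). a + b = n} (\<lambda>_. one) (omap J n) (\<lambda>(a, b). \<iota> n (cut a b))"
proof -
  have "(\<lambda>(a, b). \<iota> n (cut a b)) = (\<lambda>i. \<iota> n ((\<lambda>(a, b). cut a b) i))" by auto
  thus ?thesis using coprod_reindex[OF J_cop[OF assms] cut_bij[OF assms]] by simp
qed

lemma finite_pairs: "finite {(a, b). a + b = (n::nat)}"
  by (rule finite_subset[of _ "{..n} \<times> {..n}"]) auto

text \<open>By extensivity the inclusion of the summand \<open>\<Gamma>\<^bsub>a,b\<^esub>\<close> is the pullback along \<open>\<pi>\<close> of the simplex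
  \<open>cut a b\<close> of \<open>j(\<Delta>\<^sup>1)\<close>.\<close>

lemma inc_factor:
  assumes ab: "0 < a + b" and g: "g \<in> Hom C Z (omap W (a + b))"
    and eq: "\<pi> (a + b) \<cdot> g = \<iota> (a + b) (cut a b) \<cdot> bang C one Z"
  shows "\<exists>!u. u \<in> Hom C Z (omap \<Gamma> (a, b)) \<and> inc (a, b) \<cdot> u = g"
proof -
  have Z: "Z \<in> Obj C" using HomD[OF g] by blast
  have 1: "bang C one (omap \<Gamma> i) \<in> Hom C (omap \<Gamma> i) one" for i
    using bang_in[OF \<Gamma>_obj] by (cases i) simp
  have 2: "\<pi> (a + b) \<cdot> inc i = (case i of (c, d) \<Rightarrow> \<iota> (a + b) (cut c d)) \<cdot> bang C one (omap \<Gamma> i)"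
    if i: "i \<in> {(c, d). c + d = a + b}" for i
  proof -
    obtain c d where cd: "i = (c, d)" "c + d = a + b" using i by auto
    have "0 < c + d" using ab cd by simp
    from \<pi>_inc[OF this] show ?thesis using cd by simp
  qed
  have 3: "\<pi> (a + b) \<cdot> g = (case (a, b) of (c, d) \<Rightarrow> \<iota> (a + b) (cut c d)) \<cdot> bang C one Z" using eq by simp
  have "\<exists>!u. u \<in> Hom C Z (omap \<Gamma> (a, b)) \<and> bang C one (omap \<Gamma> (a, b)) \<cdot> u = bang C one Z \<and>
      inc (a, b) \<cdot> u = g"
    by (rule coprod_square_pullback[OF W_cop[OF ab] J_cop_cut[OF ab] finite_pairs _ smap_Hom[OF \<pi> ab]
          1 2 bang_in[OF Z] g 3]) simp
  thus ?thesis using bang_Cmp by metis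
qed

lemma \<pi>_inc_Cmp:
  assumes ab: "0 < a + b" and u: "u \<in> Hom C Z (omap \<Gamma> (a, b))"
  shows "\<pi> (a + b) \<cdot> (inc (a, b) \<cdot> u) = \<iota> (a + b) (cut a b) \<cdot> bang C one Z"
  using Cmp_assoc[OF u inc_in[OF ab] smap_Hom[OF \<pi> ab]] \<pi>_inc[OF ab]
    Cmp_assoc[OF u bang_in[OF \<Gamma>_obj] \<iota>_in[OF ab]] bang_Cmp[OF u] by simp

lemma inc_mono:
  assumes ab: "0 < a + b" and u: "u \<in> Hom C Z (omap \<Gamma> (a, b))" and v: "v \<in> Hom C Z (omap \<Gamma> (a, b))"
    and eq: "inc (a, b) \<cdot> u = inc (a, b) \<cdot> v"
  shows "u = v"
  using inc_factor[OF ab Cmp_in[OF u inc_in[OF ab]] \<pi>_inc_Cmp[OF ab u]] u v eq by metis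

end

definition high_count :: "nat \<Rightarrow> darr \<Rightarrow> nat" where
  "high_count a \<theta> = fst \<theta> - low_count a \<theta>"

locale cograph_fibre = cograph_total +
  fixes a b :: nat and K :: "nat set set"
  assumes ab: "0 < a + b" and K: "complex (a + b) K"
begin

abbreviation "front_face \<equiv> K \<inter> Pow {..<a}"

abbreviation "lo \<equiv> low_count a"

abbreviation "hi \<equiv> high_count a"

abbreviation "Fib \<equiv> fibre (Rel W J \<pi> (a + b) K) (\<lambda>Z. snd) (\<iota> (a + b) (cut a b))"

abbreviation "Pairs \<equiv> Fam X Y f (a + b) front_face K"

text \<open>The simplex \<open>\<theta>\<close> lies over the simplex of \<open>\<Delta>\<^sup>1\<close> with \<open>lo \<theta>\<close> vertices 0 and \<open>hi \<theta>\<close> vertices 1. Its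
  position in \<open>\<Gamma>\<close> is given by these two numbers, and its faces by maps into their ordinal sum.\<close>

lemma lo_hi:
  assumes \<theta>: "\<theta> \<in> simplices (a + b) K"
  shows "lo \<theta> + hi \<theta> = fst \<theta>" "Cmp Delta_plus (cut a b) \<theta> = cut (lo \<theta>) (hi \<theta>)"
    "verts \<theta> \<subseteq> {..<a} \<longleftrightarrow> hi \<theta> = 0"
    "\<phi>\<^sub>1 \<in> Hom Delta_plus c (lo \<theta>) \<Longrightarrow> \<phi>\<^sub>2 \<in> Hom Delta_plus d (hi \<theta>) \<Longrightarrow>
      lo (Cmp Delta_plus \<theta> (join \<phi>\<^sub>1 \<phi>\<^sub>2)) = c \<and> hi (Cmp Delta_plus \<theta> (join \<phi>\<^sub>1 \<phi>\<^sub>2)) = d"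
proof -
  obtain a' b' \<alpha> \<beta> where n: "fst \<theta> = a' + b'" and \<alpha>: "\<alpha> \<in> Hom Delta_plus a' a"
    and \<beta>: "\<beta> \<in> Hom Delta_plus b' b" and j: "\<theta> = join \<alpha> \<beta>"
    using join_split[OF Hom_DeltaD(5)[OF simplicesD(1)[OF \<theta>]]] by metis
  have lo: "lo \<theta> = a'" and hi: "hi \<theta> = b'" using low_count_join[OF \<alpha> \<beta>] n j by (auto simp: high_count_def)
  show "lo \<theta> + hi \<theta> = fst \<theta>" using lo hi n by simp
  show "Cmp Delta_plus (cut a b) \<theta> = cut (lo \<theta>) (hi \<theta>)" unfolding lo hi unfolding j by (rule cut_join[OF \<alpha> \<beta>])
  show "verts \<theta> \<subseteq> {..<a} \<longleftrightarrow> hi \<theta> = 0" unfolding hi unfolding j by (rule verts_join_subset_iff[OF \<alpha> \<beta>])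
  assume "\<phi>\<^sub>1 \<in> Hom Delta_plus c (lo \<theta>)" "\<phi>\<^sub>2 \<in> Hom Delta_plus d (hi \<theta>)"
  hence \<phi>: "\<phi>\<^sub>1 \<in> Hom Delta_plus c a'" "\<phi>\<^sub>2 \<in> Hom Delta_plus d b'" unfolding lo hi by auto
  have "lo (Cmp Delta_plus \<theta> (join \<phi>\<^sub>1 \<phi>\<^sub>2)) = c"
    unfolding j join_Cmp[OF \<alpha> \<beta> \<phi>] by (rule low_count_join[OF Cmp_Delta_plus[OF \<phi>(1) \<alpha>] Cmp_Delta_plus[OF \<phi>(2) \<beta>]])
  moreover have "fst (Cmp Delta_plus \<theta> (join \<phi>\<^sub>1 \<phi>\<^sub>2)) = c + d"
    using Hom_Delta_plusD[OF \<phi>(1)] Hom_Delta_plusD[OF \<phi>(2)] by simp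
  ultimately show "lo (Cmp Delta_plus \<theta> (join \<phi>\<^sub>1 \<phi>\<^sub>2)) = c \<and> hi (Cmp Delta_plus \<theta> (join \<phi>\<^sub>1 \<phi>\<^sub>2)) = d"
    by (simp add: high_count_def)
qed

lemma lo_hi_pos: "\<theta> \<in> simplices (a + b) K \<Longrightarrow> 0 < lo \<theta> + hi \<theta>"
  using lo_hi(1) simplicesD(3) by metis

lemma face_split:
  assumes \<theta>: "\<theta> \<in> simplices (a + b) K" and \<phi>: "\<phi> \<in> Hom Delta k (fst \<theta>)"
  obtains c d \<phi>\<^sub>1 \<phi>\<^sub>2 where "k = c + d" "\<phi>\<^sub>1 \<in> Hom Delta_plus c (lo \<theta>)" "\<phi>\<^sub>2 \<in> Hom Delta_plus d (hi \<theta>)"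
    "\<phi> = join \<phi>\<^sub>1 \<phi>\<^sub>2"
proof (rule join_split[OF Hom_DeltaD(5)[OF \<phi>, folded lo_hi(1)[OF \<theta>]]], goal_cases)
  case (1 c d \<phi>\<^sub>1 \<phi>\<^sub>2)
  show ?case by (rule that[OF 1(2-5)])
qed

lemma join_face:
  assumes \<theta>: "\<theta> \<in> simplices (a + b) K"
    and \<phi>: "\<phi>\<^sub>1 \<in> Hom Delta_plus c (lo \<theta>)" "\<phi>\<^sub>2 \<in> Hom Delta_plus d (hi \<theta>)" and cd: "0 < c + d"
  shows "join \<phi>\<^sub>1 \<phi>\<^sub>2 \<in> Hom Delta (c + d) (fst \<theta>)"
    and "Cmp Delta_plus \<theta> (join \<phi>\<^sub>1 \<phi>\<^sub>2) \<in> simplices (a + b) K"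
proof -
  show j: "join \<phi>\<^sub>1 \<phi>\<^sub>2 \<in> Hom Delta (c + d) (fst \<theta>)"
    using Hom_Delta_pos[OF join_Hom[OF \<phi>] cd] unfolding lo_hi(1)[OF \<theta>] .
  show "Cmp Delta_plus \<theta> (join \<phi>\<^sub>1 \<phi>\<^sub>2) \<in> simplices (a + b) K" by (rule simplices_Cmp[OF K \<theta> j])
qed

lemma front_simplex:
  assumes \<theta>: "\<theta> \<in> simplices (a + b) K" and lo: "0 < lo \<theta>"
  shows "front (lo \<theta>) (hi \<theta>) \<in> Hom Delta (lo \<theta>) (fst \<theta>)"
    and "Cmp Delta_plus \<theta> (front (lo \<theta>) (hi \<theta>)) \<in> simplices (a + b) front_face"
    and "fst (Cmp Delta_plus \<theta> (front (lo \<theta>) (hi \<theta>))) = lo \<theta>"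
proof -
  let ?e = "from_empty (hi \<theta>)" and ?i = "Idt Delta_plus (lo \<theta>)"
  have c: "0 < lo \<theta> + 0" using lo by simp
  note j = join_face[OF \<theta> Idt_Delta_plus from_empty_Hom c, folded front_eq_join]
    and l = lo_hi(4)[OF \<theta> Idt_Delta_plus from_empty_Hom, folded front_eq_join]
  show "front (lo \<theta>) (hi \<theta>) \<in> Hom Delta (lo \<theta>) (fst \<theta>)" using j(1) by simp
  have "verts (Cmp Delta_plus \<theta> (front (lo \<theta>) (hi \<theta>))) \<subseteq> {..<a}" using lo_hi(3)[OF j(2)] l by simp
  thus "Cmp Delta_plus \<theta> (front (lo \<theta>) (hi \<theta>)) \<in> simplices (a + b) front_face"
    using simplicesD(1,2)[OF j(2)] by (simp add: simplices_iff)
  show "fst (Cmp Delta_plus \<theta> (front (lo \<theta>) (hi \<theta>))) = lo \<theta>" by (simp add: front_def)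
qed

lemma front_face_simplex:
  assumes "\<theta> \<in> simplices (a + b) front_face"
  shows "\<theta> \<in> simplices (a + b) K" "lo \<theta> = fst \<theta>" "hi \<theta> = 0"
proof -
  show \<theta>: "\<theta> \<in> simplices (a + b) K" using assms simplices_mono[of front_face K] by blast
  show h: "hi \<theta> = 0" using lo_hi(3)[OF \<theta>] simplicesD(2)[OF assms] by blast
  show "lo \<theta> = fst \<theta>" using lo_hi(1)[OF \<theta>] h by simp
qed

text \<open>The point of \<open>\<Gamma>\<close> through which the value at \<open>\<theta>\<close> of a family over the simplex \<open>cut a b\<close> factors.\<close>

definition component :: "(darr \<Rightarrow> 'b) \<Rightarrow> 'a \<Rightarrow> darr \<Rightarrow> 'b" where
  "component \<rho> Z \<theta> = (THE u. u \<in> Hom C Z (omap \<Gamma> (lo \<theta>, hi \<theta>)) \<and> inc (lo \<theta>, hi \<theta>) \<cdot> u = \<rho> \<theta>)"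

lemma component_eqI:
  assumes \<theta>: "\<theta> \<in> simplices (a + b) K" and u: "u \<in> Hom C Z (omap \<Gamma> (lo \<theta>, hi \<theta>))"
    and eq: "inc (lo \<theta>, hi \<theta>) \<cdot> u = \<rho> \<theta>"
  shows "component \<rho> Z \<theta> = u"
  unfolding component_def
proof (rule the_equality)
  fix v assume "v \<in> Hom C Z (omap \<Gamma> (lo \<theta>, hi \<theta>)) \<and> inc (lo \<theta>, hi \<theta>) \<cdot> v = \<rho> \<theta>"
  thus "v = u" using inc_mono[OF lo_hi_pos[OF \<theta>] _ u] eq by simp
qed (use u eq in simp)

lemma Fib_elts:
  "(\<rho>, j) \<in> elts Fib Z \<longleftrightarrow> \<rho> \<in> fam W (a + b) K Z \<and> j \<in> Hom C Z (omap J (a + b)) \<and>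
     (\<forall>\<theta> \<in> simplices (a + b) K. \<pi> (fst \<theta>) \<cdot> \<rho> \<theta> = amap J \<theta> \<cdot> j) \<and>
     j = \<iota> (a + b) (cut a b) \<cdot> bang C one Z"
  by (simp add: fibre_sel Rel_elts)

lemma over_cut:
  assumes \<theta>: "\<theta> \<in> simplices (a + b) K" and Z: "Z \<in> Obj C"
  shows "amap J \<theta> \<cdot> (\<iota> (a + b) (cut a b) \<cdot> bang C one Z) = \<iota> (fst \<theta>) (cut (lo \<theta>) (hi \<theta>)) \<cdot> bang C one Z"
proof -
  note \<theta>' = simplicesD(1)[OF \<theta>]
  show ?thesis
    using Cmp_assoc[OF bang_in[OF Z] \<iota>_in[OF ab] sobj_amap[OF J \<theta>']] J_nat[OF \<theta>' cut_simplex[OF ab]]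
      lo_hi(2)[OF \<theta>] by simp
qed

lemma component:
  assumes r: "(\<rho>, j) \<in> elts Fib Z" and Z: "Z \<in> Obj C" and \<theta>: "\<theta> \<in> simplices (a + b) K"
  shows "component \<rho> Z \<theta> \<in> Hom C Z (omap \<Gamma> (lo \<theta>, hi \<theta>))" "inc (lo \<theta>, hi \<theta>) \<cdot> component \<rho> Z \<theta> = \<rho> \<theta>"
proof -
  note n = lo_hi(1)[OF \<theta>]
  have \<rho>: "\<rho> \<in> fam W (a + b) K Z" and eq: "\<pi> (fst \<theta>) \<cdot> \<rho> \<theta> = amap J \<theta> \<cdot> j"
    and j: "j = \<iota> (a + b) (cut a b) \<cdot> bang C one Z"
    using r \<theta> unfolding Fib_elts by simp_all
  have "\<pi> (lo \<theta> + hi \<theta>) \<cdot> \<rho> \<theta> = \<iota> (lo \<theta> + hi \<theta>) (cut (lo \<theta>) (hi \<theta>)) \<cdot> bang C one Z"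
    unfolding n using eq over_cut[OF \<theta> Z] j by simp
  from inc_factor[OF lo_hi_pos[OF \<theta>] famD(2)[OF \<rho> \<theta>, folded n] this]
  obtain u where u: "u \<in> Hom C Z (omap \<Gamma> (lo \<theta>, hi \<theta>))" "inc (lo \<theta>, hi \<theta>) \<cdot> u = \<rho> \<theta>"
    by (elim ex1E conjE)
  have "component \<rho> Z \<theta> = u" by (rule component_eqI[where \<rho> = \<rho>, OF \<theta> u])
  thus "component \<rho> Z \<theta> \<in> Hom C Z (omap \<Gamma> (lo \<theta>, hi \<theta>))" "inc (lo \<theta>, hi \<theta>) \<cdot> component \<rho> Z \<theta> = \<rho> \<theta>"
    using u by simp_all
qed

lemma inc_face:
  assumes \<theta>: "\<theta> \<in> simplices (a + b) K" and u: "u \<in> Hom C Z (omap \<Gamma> (lo \<theta>, hi \<theta>))"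
    and \<phi>: "\<phi>\<^sub>1 \<in> Hom Delta_plus c (lo \<theta>)" "\<phi>\<^sub>2 \<in> Hom Delta_plus d (hi \<theta>)" and cd: "0 < c + d"
  shows "inc (c, d) \<cdot> (amap \<Gamma> (\<phi>\<^sub>1, \<phi>\<^sub>2) \<cdot> u) = amap W (join \<phi>\<^sub>1 \<phi>\<^sub>2) \<cdot> (inc (lo \<theta>, hi \<theta>) \<cdot> u)"
  using Cmp_assoc[OF u \<Gamma>_amap[OF \<phi>] inc_in[OF cd]] W_nat[OF \<phi> cd]
    Cmp_assoc[OF u inc_in[OF lo_hi_pos[OF \<theta>]], unfolded lo_hi(1)[OF \<theta>], OF sobj_amap[OF W join_face(1)[OF \<theta> \<phi> cd]]]
  by simp

lemma component_face:
  assumes r: "(\<rho>, j) \<in> elts Fib Z" and Z: "Z \<in> Obj C" and \<theta>: "\<theta> \<in> simplices (a + b) K"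
    and \<phi>: "\<phi>\<^sub>1 \<in> Hom Delta_plus c (lo \<theta>)" "\<phi>\<^sub>2 \<in> Hom Delta_plus d (hi \<theta>)" and cd: "0 < c + d"
  shows "component \<rho> Z (Cmp Delta_plus \<theta> (join \<phi>\<^sub>1 \<phi>\<^sub>2)) = amap \<Gamma> (\<phi>\<^sub>1, \<phi>\<^sub>2) \<cdot> component \<rho> Z \<theta>"
proof -
  note g = component[OF r Z \<theta>] and l = lo_hi(4)[OF \<theta> \<phi>] and jf = join_face[OF \<theta> \<phi> cd]
  have \<rho>: "\<rho> \<in> fam W (a + b) K Z" using r unfolding Fib_elts by simp
  show ?thesis
  proof (rule component_eqI[OF jf(2)])
    show "amap \<Gamma> (\<phi>\<^sub>1, \<phi>\<^sub>2) \<cdot> component \<rho> Z \<theta> \<in> Hom C Z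
        (omap \<Gamma> (lo (Cmp Delta_plus \<theta> (join \<phi>\<^sub>1 \<phi>\<^sub>2)), hi (Cmp Delta_plus \<theta> (join \<phi>\<^sub>1 \<phi>\<^sub>2))))"
      using Cmp_in[OF g(1) \<Gamma>_amap[OF \<phi>]] l by (metis (no_types))
    show "inc (lo (Cmp Delta_plus \<theta> (join \<phi>\<^sub>1 \<phi>\<^sub>2)), hi (Cmp Delta_plus \<theta> (join \<phi>\<^sub>1 \<phi>\<^sub>2))) \<cdot>
        (amap \<Gamma> (\<phi>\<^sub>1, \<phi>\<^sub>2) \<cdot> component \<rho> Z \<theta>) = \<rho> (Cmp Delta_plus \<theta> (join \<phi>\<^sub>1 \<phi>\<^sub>2))"
      unfolding conjunct1[OF l] conjunct2[OF l] inc_face[OF \<theta> g(1) \<phi> cd] g(2)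
      using famD(3)[OF \<rho> \<theta> jf(1)] by simp
  qed
qed

lemma component_restr:
  assumes r: "(\<rho>, j) \<in> elts Fib Z" and Z: "Z \<in> Obj C" and \<theta>: "\<theta> \<in> simplices (a + b) K"
    and h: "h \<in> Hom C Z' Z"
  shows "component (\<lambda>\<theta>\<in>simplices (a + b) K. \<rho> \<theta> \<cdot> h) Z' \<theta> = component \<rho> Z \<theta> \<cdot> h"
proof -
  note g = component[OF r Z \<theta>]
  have "inc (lo \<theta>, hi \<theta>) \<cdot> (component \<rho> Z \<theta> \<cdot> h) = (\<lambda>\<theta>\<in>simplices (a + b) K. \<rho> \<theta> \<cdot> h) \<theta>"
    using \<theta> Cmp_assoc[OF h g(1) inc_in[OF lo_hi_pos[OF \<theta>]]] g(2) by simp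
  from component_eqI[where \<rho> = "\<lambda>\<theta>\<in>simplices (a + b) K. \<rho> \<theta> \<cdot> h", OF \<theta> Cmp_in[OF h g(1)] this]
  show ?thesis .
qed

lemma p_face:
  assumes \<theta>: "\<theta> \<in> simplices (a + b) K" and u: "u \<in> Hom C Z (omap \<Gamma> (lo \<theta>, hi \<theta>))"
    and \<phi>: "\<phi>\<^sub>1 \<in> Hom Delta_plus c (lo \<theta>)" "\<phi>\<^sub>2 \<in> Hom Delta_plus d (hi \<theta>)" and c: "0 < c"
  shows "p c d \<cdot> (amap \<Gamma> (\<phi>\<^sub>1, \<phi>\<^sub>2) \<cdot> u) = amap X \<phi>\<^sub>1 \<cdot> (p (lo \<theta>) (hi \<theta>) \<cdot> u)"
proof -
  have \<phi>1: "\<phi>\<^sub>1 \<in> Hom Delta c (lo \<theta>)" by (rule Hom_Delta_pos[OF \<phi>(1) c])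
  have pl: "p (lo \<theta>) (hi \<theta>) \<in> Hom C (omap \<Gamma> (lo \<theta>, hi \<theta>)) (omap X (lo \<theta>))"
    using p_in[of "lo \<theta>" "hi \<theta>"] Hom_DeltaD(4)[OF \<phi>1] by simp
  show ?thesis
    using Cmp_assoc[OF u \<Gamma>_amap[OF \<phi>] p_in] p_nat[OF \<phi>] augment_amap[OF X \<phi>(1) c]
      Cmp_assoc[OF u pl sobj_amap[OF X \<phi>1]] by simp
qed

lemma q_face:
  assumes \<theta>: "\<theta> \<in> simplices (a + b) K" and u: "u \<in> Hom C Z (omap \<Gamma> (lo \<theta>, hi \<theta>))"
    and \<phi>: "\<phi>\<^sub>1 \<in> Hom Delta_plus c (lo \<theta>)" "\<phi>\<^sub>2 \<in> Hom Delta_plus d (hi \<theta>)" and cd: "0 < c + d"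
  shows "q c d \<cdot> (amap \<Gamma> (\<phi>\<^sub>1, \<phi>\<^sub>2) \<cdot> u) = amap Y (join \<phi>\<^sub>1 \<phi>\<^sub>2) \<cdot> (q (lo \<theta>) (hi \<theta>) \<cdot> u)"
  using Cmp_assoc[OF u \<Gamma>_amap[OF \<phi>] q_in[OF cd]] q_nat[OF \<phi>] augment_amap[OF Y join_Hom[OF \<phi>] cd]
    Cmp_assoc[OF u q_in[OF lo_hi_pos[OF \<theta>]], unfolded lo_hi(1)[OF \<theta>], OF sobj_amap[OF Y join_face(1)[OF \<theta> \<phi> cd]]]
  by simp

lemma p_front:
  assumes \<theta>: "\<theta> \<in> simplices (a + b) K" and u: "u \<in> Hom C Z (omap \<Gamma> (lo \<theta>, hi \<theta>))" and lo: "0 < lo \<theta>"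
  shows "p (lo \<theta>) 0 \<cdot> (amap \<Gamma> (Idt Delta_plus (lo \<theta>), from_empty (hi \<theta>)) \<cdot> u) = p (lo \<theta>) (hi \<theta>) \<cdot> u"
proof -
  have "p (lo \<theta>) (hi \<theta>) \<cdot> u \<in> Hom C Z (omap X (lo \<theta>))"
    using Cmp_in[OF u p_in] lo by simp
  thus ?thesis using p_face[OF \<theta> u Idt_Delta_plus from_empty_Hom lo] sobj_Idt[OF X lo] Idt_Cmp by simp
qed

text \<open>A family in the total object over \<open>cut a b\<close> amounts to its components in \<open>X\<close>, on the simplices
  with all vertices in the first block, together with its components in \<open>Y\<close>: by the pullback
  defining \<open>\<Gamma>\<close>, the value at any other simplex is determined by its \<open>Y\<close>-component and by the value
  at its front face.\<close>

definition to_Pairs :: "'a \<Rightarrow> (darr \<Rightarrow> 'b) \<times> 'b \<Rightarrow> (darr \<Rightarrow> 'b) \<times> (darr \<Rightarrow> 'b)" where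
  "to_Pairs Z = (\<lambda>(\<rho>, j). (\<lambda>\<theta>\<in>simplices (a + b) front_face. p (lo \<theta>) (hi \<theta>) \<cdot> component \<rho> Z \<theta>,
     \<lambda>\<theta>\<in>simplices (a + b) K. q (lo \<theta>) (hi \<theta>) \<cdot> component \<rho> Z \<theta>))"

lemma front_face_complex: "complex (a + b) front_face"
  by (rule complex_Int[OF K complex_face]) auto

lemma to_Pairs_natural: "natural Fib Pairs to_Pairs"
proof (rule naturalI)
  fix Z x assume Z: "Z \<in> Obj C" and x: "x \<in> elts Fib Z"
  obtain \<rho> j where xe: "x = (\<rho>, j)" by (cases x)
  note r = x[unfolded xe]
  note g = component[OF r Z]
  show "to_Pairs Z x \<in> elts Pairs Z"
    unfolding xe to_Pairs_def prod.case Fam_elts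
  proof (intro conjI ballI)
    show "(\<lambda>\<theta>\<in>simplices (a + b) front_face. p (lo \<theta>) (hi \<theta>) \<cdot> component \<rho> Z \<theta>) \<in> fam X (a + b) front_face Z"
    proof (rule famI)
      fix \<theta> assume \<theta>: "\<theta> \<in> simplices (a + b) front_face"
      note \<theta>' = front_face_simplex[OF \<theta>] and pos = simplicesD(3)[OF \<theta>]
      show "(\<lambda>\<theta>\<in>simplices (a + b) front_face. p (lo \<theta>) (hi \<theta>) \<cdot> component \<rho> Z \<theta>) \<theta> \<in> Hom C Z (omap X (fst \<theta>))"
        using Cmp_in[OF g(1)[OF \<theta>'(1)] p_in] \<theta> \<theta>'(2) pos by simp
      fix k \<phi> assume \<phi>: "\<phi> \<in> Hom Delta k (fst \<theta>)"
      have \<phi>': "\<phi> \<in> Hom Delta_plus k (lo \<theta>)" and k: "0 < k"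
        using Hom_DeltaD(3,5)[OF \<phi>] \<theta>'(2) by simp_all
      have e: "from_empty 0 \<in> Hom Delta_plus 0 (hi \<theta>)" using from_empty_Hom[of 0] \<theta>'(3) by simp
      have j0: "join \<phi> (from_empty 0) = \<phi>"
      proof (rule darr_eqI)
        show "join \<phi> (from_empty 0) \<in> Hom Delta_plus k (fst \<theta>)"
          using join_Hom[OF Hom_DeltaD(5)[OF \<phi>] from_empty_Hom[of 0]] by simp
        show "\<phi> \<in> Hom Delta_plus k (fst \<theta>)" using Hom_DeltaD(5)[OF \<phi>] .
        show "dapp (join \<phi> (from_empty 0)) i = dapp \<phi> i" if "i < k" for i
          using that Hom_DeltaD(1)[OF \<phi>] by (simp add: join_dapp from_empty_def)
      qed
      have k0: "0 < k + 0" using k by simp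
      note l = lo_hi(4)[OF \<theta>'(1) \<phi>' e, unfolded j0] and c = component_face[OF r Z \<theta>'(1) \<phi>' e k0, unfolded j0]
      show "(\<lambda>\<theta>\<in>simplices (a + b) front_face. p (lo \<theta>) (hi \<theta>) \<cdot> component \<rho> Z \<theta>) (Cmp Delta_plus \<theta> \<phi>) =
          amap X \<phi> \<cdot> (\<lambda>\<theta>\<in>simplices (a + b) front_face. p (lo \<theta>) (hi \<theta>) \<cdot> component \<rho> Z \<theta>) \<theta>"
        unfolding restrict_apply'[OF \<theta>] restrict_apply'[OF simplices_Cmp[OF front_face_complex \<theta> \<phi>]]
          conjunct1[OF l] conjunct2[OF l] c
        by (rule p_face[OF \<theta>'(1) g(1)[OF \<theta>'(1)] \<phi>' e k])
    qed simp
    show "(\<lambda>\<theta>\<in>simplices (a + b) K. q (lo \<theta>) (hi \<theta>) \<cdot> component \<rho> Z \<theta>) \<in> fam Y (a + b) K Z"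
    proof (rule famI)
      fix \<theta> assume \<theta>: "\<theta> \<in> simplices (a + b) K"
      show "(\<lambda>\<theta>\<in>simplices (a + b) K. q (lo \<theta>) (hi \<theta>) \<cdot> component \<rho> Z \<theta>) \<theta> \<in> Hom C Z (omap Y (fst \<theta>))"
        using Cmp_in[OF g(1)[OF \<theta>] q_in[OF lo_hi_pos[OF \<theta>]]] \<theta> lo_hi(1)[OF \<theta>] by simp
      fix k \<phi> assume \<phi>: "\<phi> \<in> Hom Delta k (fst \<theta>)"
      obtain c d \<phi>\<^sub>1 \<phi>\<^sub>2 where s: "k = c + d" "\<phi>\<^sub>1 \<in> Hom Delta_plus c (lo \<theta>)" "\<phi>\<^sub>2 \<in> Hom Delta_plus d (hi \<theta>)"
        "\<phi> = join \<phi>\<^sub>1 \<phi>\<^sub>2" using face_split[OF \<theta> \<phi>] .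
      have cd: "0 < c + d" using Hom_DeltaD(3)[OF \<phi>] s(1) by simp
      note l = lo_hi(4)[OF \<theta> s(2,3), folded s(4)] and cf = component_face[OF r Z \<theta> s(2,3) cd, folded s(4)]
      show "(\<lambda>\<theta>\<in>simplices (a + b) K. q (lo \<theta>) (hi \<theta>) \<cdot> component \<rho> Z \<theta>) (Cmp Delta_plus \<theta> \<phi>) =
          amap Y \<phi> \<cdot> (\<lambda>\<theta>\<in>simplices (a + b) K. q (lo \<theta>) (hi \<theta>) \<cdot> component \<rho> Z \<theta>) \<theta>"
        unfolding restrict_apply'[OF \<theta>] restrict_apply'[OF simplices_Cmp[OF K \<theta> \<phi>]]
          conjunct1[OF l] conjunct2[OF l] cf
        unfolding s(4) by (rule q_face[OF \<theta> g(1)[OF \<theta>] s(2,3) cd])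
    qed simp
    fix \<theta> assume \<theta>: "\<theta> \<in> simplices (a + b) front_face"
    note \<theta>' = front_face_simplex[OF \<theta>] and pos = simplicesD(3)[OF \<theta>]
    note gg = g(1)[OF \<theta>'(1), unfolded \<theta>'(2,3)]
    let ?n = "fst \<theta>"
    have n0: "0 < ?n + 0" using pos by simp
    have pp: "p ?n 0 \<in> Hom C (omap \<Gamma> (?n, 0)) (omap X ?n)" using p_in[of ?n 0] pos by simp
    have qq: "q ?n 0 \<in> Hom C (omap \<Gamma> (?n, 0)) (omap Y ?n)" using q_in[OF n0] by simp
    have "f ?n \<cdot> (p ?n 0 \<cdot> component \<rho> Z \<theta>) = (f ?n \<cdot> p ?n 0) \<cdot> component \<rho> Z \<theta>"
      using Cmp_assoc[OF gg pp smap_Hom[OF f pos]] by simp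
    also have "\<dots> = q ?n 0 \<cdot> component \<rho> Z \<theta>"
      unfolding pb_square[OF pos] front_0 sobj_Idt[OF Y pos] Idt_Cmp[OF qq] ..
    finally show "f ?n \<cdot> (\<lambda>\<theta>\<in>simplices (a + b) front_face. p (lo \<theta>) (hi \<theta>) \<cdot> component \<rho> Z \<theta>) \<theta> =
        (\<lambda>\<theta>\<in>simplices (a + b) K. q (lo \<theta>) (hi \<theta>) \<cdot> component \<rho> Z \<theta>) \<theta>"
      using \<theta> \<theta>' by simp
  qed
next
  fix Z Z' h x assume h: "h \<in> Hom C Z' Z" and x: "x \<in> elts Fib Z"
  obtain \<rho> j where xe: "x = (\<rho>, j)" by (cases x)
  have Z: "Z \<in> Obj C" using HomD[OF h] by blast
  note r = x[unfolded xe]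
  note g = component[OF r Z]
  have "p (lo \<theta>) (hi \<theta>) \<cdot> (component \<rho> Z \<theta> \<cdot> h) = p (lo \<theta>) (hi \<theta>) \<cdot> component \<rho> Z \<theta> \<cdot> h"
    if "\<theta> \<in> simplices (a + b) K" for \<theta>
    using Cmp_assoc[OF h g(1)[OF that] p_in] by simp
  moreover have "q (lo \<theta>) (hi \<theta>) \<cdot> (component \<rho> Z \<theta> \<cdot> h) = q (lo \<theta>) (hi \<theta>) \<cdot> component \<rho> Z \<theta> \<cdot> h"
    if "\<theta> \<in> simplices (a + b) K" for \<theta>
    using Cmp_assoc[OF h g(1)[OF that] q_in[OF lo_hi_pos[OF that]]] by simp
  ultimately show "to_Pairs Z' (restr Fib h x) = restr Pairs h (to_Pairs Z x)"
    unfolding xe to_Pairs_def Fam_restr prod.case fibre_sel Rel_restr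
    using component_restr[OF r Z _ h] front_face_simplex(1) by (auto intro!: restrict_ext)
qed

lemma to_Pairs_inj:
  assumes Z: "Z \<in> Obj C" and x: "x \<in> elts Fib Z" and y: "y \<in> elts Fib Z"
    and eq: "to_Pairs Z x = to_Pairs Z y"
  shows "x = y"
proof -
  obtain \<rho> j \<rho>' j' where xy: "x = (\<rho>, j)" "y = (\<rho>', j')" by (cases x; cases y)
  note r = x[unfolded xy] y[unfolded xy]
  note g = component[OF r(1) Z] and g' = component[OF r(2) Z]
  have \<rho>: "\<rho> \<in> fam W (a + b) K Z" "\<rho>' \<in> fam W (a + b) K Z" and j: "j = j'"
    using r unfolding Fib_elts by simp_all
  have e1: "(\<lambda>\<theta>\<in>simplices (a + b) front_face. p (lo \<theta>) (hi \<theta>) \<cdot> component \<rho> Z \<theta>) =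
      (\<lambda>\<theta>\<in>simplices (a + b) front_face. p (lo \<theta>) (hi \<theta>) \<cdot> component \<rho>' Z \<theta>)"
    and e2: "(\<lambda>\<theta>\<in>simplices (a + b) K. q (lo \<theta>) (hi \<theta>) \<cdot> component \<rho> Z \<theta>) =
      (\<lambda>\<theta>\<in>simplices (a + b) K. q (lo \<theta>) (hi \<theta>) \<cdot> component \<rho>' Z \<theta>)"
    using eq unfolding xy to_Pairs_def by simp_all
  have "\<rho> = \<rho>'"
  proof (rule fam_eqI[OF \<rho>])
    fix \<theta> assume \<theta>: "\<theta> \<in> simplices (a + b) K"
    have "p (lo \<theta>) (hi \<theta>) \<cdot> component \<rho> Z \<theta> = p (lo \<theta>) (hi \<theta>) \<cdot> component \<rho>' Z \<theta>"
    proof (cases "lo \<theta> = 0")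
      case True
      thus ?thesis
        using to_one_unique Cmp_in[OF g(1)[OF \<theta>] p_in] Cmp_in[OF g'(1)[OF \<theta>] p_in] by simp
    next
      case False
      hence lo: "0 < lo \<theta>" "0 < lo \<theta> + 0" by simp_all
      note fs = front_simplex[OF \<theta> lo(1)] and l = lo_hi(4)[OF \<theta> Idt_Delta_plus from_empty_Hom, folded front_eq_join]
      note c = component_face[OF r(1) Z \<theta> Idt_Delta_plus from_empty_Hom lo(2), folded front_eq_join]
      note c' = component_face[OF r(2) Z \<theta> Idt_Delta_plus from_empty_Hom lo(2), folded front_eq_join]
      from fun_cong[OF e1, of "Cmp Delta_plus \<theta> (front (lo \<theta>) (hi \<theta>))", unfolded restrict_apply'[OF fs(2)]
          conjunct1[OF l] conjunct2[OF l] c c' p_front[OF \<theta> g(1)[OF \<theta>] lo(1)] p_front[OF \<theta> g'(1)[OF \<theta>] lo(1)]]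
      show ?thesis .
    qed
    moreover have "q (lo \<theta>) (hi \<theta>) \<cdot> component \<rho> Z \<theta> = q (lo \<theta>) (hi \<theta>) \<cdot> component \<rho>' Z \<theta>"
      using fun_cong[OF e2, of \<theta>] \<theta> by simp
    ultimately have "component \<rho> Z \<theta> = component \<rho>' Z \<theta>"
      by (rule pullback_arrow_eqI[OF pb g(1)[OF \<theta>] g'(1)[OF \<theta>]])
    thus "\<rho> \<theta> = \<rho>' \<theta>" using g(2)[OF \<theta>] g'(2)[OF \<theta>] by simp
  qed
  thus ?thesis unfolding xy using j by simp
qed

lemma to_Pairs_surj:
  assumes Z: "Z \<in> Obj C" and z: "z \<in> elts Pairs Z"
  shows "\<exists>x \<in> elts Fib Z. to_Pairs Z x = z"
proof -
  obtain x y where ze: "z = (x, y)" by (cases z)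
  have x: "x \<in> fam X (a + b) front_face Z" and y: "y \<in> fam Y (a + b) K Z"
    and fxy: "\<And>\<theta>. \<theta> \<in> simplices (a + b) front_face \<Longrightarrow> f (fst \<theta>) \<cdot> x \<theta> = y \<theta>"
    using z unfolding ze Fam_elts by simp_all
  (* the components prescribed for the value at \<theta>: y \<theta> itself, and x at the front face of \<theta>;
     if \<theta> has no vertex in the first block, the X-component lives in the terminal object *)
  define u where "u \<theta> = (if lo \<theta> = 0 then bang C one Z else x (Cmp Delta_plus \<theta> (front (lo \<theta>) (hi \<theta>))))" for \<theta>
  have u: "u \<theta> \<in> Hom C Z (if lo \<theta> = 0 then one else omap X (lo \<theta>))" if \<theta>: "\<theta> \<in> simplices (a + b) K" for \<theta>
    using bang_in[OF Z] famD(2)[OF x front_simplex(2)[OF \<theta>]] front_simplex(3)[OF \<theta>] by (simp add: u_def)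
  have "\<exists>g. g \<in> Hom C Z (omap \<Gamma> (lo \<theta>, hi \<theta>)) \<and> p (lo \<theta>) (hi \<theta>) \<cdot> g = u \<theta> \<and> q (lo \<theta>) (hi \<theta>) \<cdot> g = y \<theta>"
    if \<theta>: "\<theta> \<in> simplices (a + b) K" for \<theta>
  proof -
    have "f (lo \<theta>) \<cdot> u \<theta> = amap Y (front (lo \<theta>) (hi \<theta>)) \<cdot> y \<theta>" if lo: "0 < lo \<theta>"
      using fxy[OF front_simplex(2)[OF \<theta> lo]] front_simplex(3)[OF \<theta> lo] lo
        famD(3)[OF y \<theta> front_simplex(1)[OF \<theta> lo]] by (simp add: u_def)
    from pair_ex[OF u[OF \<theta>] famD(2)[OF y \<theta>, folded lo_hi(1)[OF \<theta>]] lo_hi_pos[OF \<theta>] this]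
    show ?thesis by blast
  qed
  then obtain G where G: "\<And>\<theta>. \<theta> \<in> simplices (a + b) K \<Longrightarrow> G \<theta> \<in> Hom C Z (omap \<Gamma> (lo \<theta>, hi \<theta>))"
    "\<And>\<theta>. \<theta> \<in> simplices (a + b) K \<Longrightarrow> p (lo \<theta>) (hi \<theta>) \<cdot> G \<theta> = u \<theta>"
    "\<And>\<theta>. \<theta> \<in> simplices (a + b) K \<Longrightarrow> q (lo \<theta>) (hi \<theta>) \<cdot> G \<theta> = y \<theta>" by metis
  have G_face: "G (Cmp Delta_plus \<theta> (join \<phi>\<^sub>1 \<phi>\<^sub>2)) = amap \<Gamma> (\<phi>\<^sub>1, \<phi>\<^sub>2) \<cdot> G \<theta>"
    if \<theta>: "\<theta> \<in> simplices (a + b) K" and \<phi>: "\<phi>\<^sub>1 \<in> Hom Delta_plus c (lo \<theta>)" "\<phi>\<^sub>2 \<in> Hom Delta_plus d (hi \<theta>)"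
      and cd: "0 < c + d" for \<theta> \<phi>\<^sub>1 \<phi>\<^sub>2 c d
  proof -
    let ?\<theta>' = "Cmp Delta_plus \<theta> (join \<phi>\<^sub>1 \<phi>\<^sub>2)"
    note jf = join_face[OF \<theta> \<phi> cd] and l = lo_hi(4)[OF \<theta> \<phi>]
    note l1 = conjunct1[OF l] and l2 = conjunct2[OF l]
    have G': "G ?\<theta>' \<in> Hom C Z (omap \<Gamma> (c, d))" using G(1)[OF jf(2), unfolded l1 l2] .
    have \<Gamma>G: "amap \<Gamma> (\<phi>\<^sub>1, \<phi>\<^sub>2) \<cdot> G \<theta> \<in> Hom C Z (omap \<Gamma> (c, d))" using Cmp_in[OF G(1)[OF \<theta>] \<Gamma>_amap[OF \<phi>]] .
    have "p c d \<cdot> G ?\<theta>' = p c d \<cdot> (amap \<Gamma> (\<phi>\<^sub>1, \<phi>\<^sub>2) \<cdot> G \<theta>)"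
    proof (cases "c = 0")
      case True
      thus ?thesis using to_one_unique Cmp_in[OF G' p_in] Cmp_in[OF \<Gamma>G p_in] by simp
    next
      case False
      hence c: "0 < c" by simp
      have \<phi>1: "\<phi>\<^sub>1 \<in> Hom Delta c (lo \<theta>)" by (rule Hom_Delta_pos[OF \<phi>(1) c])
      have lo: "0 < lo \<theta>" using Hom_DeltaD(4)[OF \<phi>1] .
      note fs = front_simplex[OF \<theta> lo]
      have \<theta>h: "\<theta> \<in> Hom Delta (fst \<theta>) (a + b)" using simplicesD(1)[OF \<theta>] .
      have fr: "front c d \<in> Hom Delta c (c + d)" by (rule Hom_Delta_pos[OF front_Hom c])
      have "Cmp Delta_plus ?\<theta>' (front c d) = Cmp Delta_plus \<theta> (Cmp Delta_plus (join \<phi>\<^sub>1 \<phi>\<^sub>2) (front c d))"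
        using Delta.Cmp_assoc[OF fr jf(1) \<theta>h] by simp
      also have "\<dots> = Cmp Delta_plus \<theta> (Cmp Delta_plus (front (lo \<theta>) (hi \<theta>)) \<phi>\<^sub>1)"
        unfolding join_front[OF \<phi>] ..
      also have "\<dots> = Cmp Delta_plus (Cmp Delta_plus \<theta> (front (lo \<theta>) (hi \<theta>))) \<phi>\<^sub>1"
        using Delta.Cmp_assoc[OF \<phi>1 fs(1) \<theta>h] by simp
      finally have e: "Cmp Delta_plus ?\<theta>' (front c d) = Cmp Delta_plus (Cmp Delta_plus \<theta> (front (lo \<theta>) (hi \<theta>))) \<phi>\<^sub>1" .
      have "p c d \<cdot> G ?\<theta>' = x (Cmp Delta_plus ?\<theta>' (front c d))"
        using G(2)[OF jf(2), unfolded l1 l2] c unfolding u_def l1 l2 by simp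
      also have "\<dots> = amap X \<phi>\<^sub>1 \<cdot> u \<theta>"
        unfolding e using famD(3)[OF x fs(2), unfolded fs(3), OF \<phi>1] lo by (simp add: u_def)
      also have "\<dots> = p c d \<cdot> (amap \<Gamma> (\<phi>\<^sub>1, \<phi>\<^sub>2) \<cdot> G \<theta>)"
        using p_face[OF \<theta> G(1)[OF \<theta>] \<phi> c] G(2)[OF \<theta>] by simp
      finally show ?thesis .
    qed
    moreover have "q c d \<cdot> G ?\<theta>' = q c d \<cdot> (amap \<Gamma> (\<phi>\<^sub>1, \<phi>\<^sub>2) \<cdot> G \<theta>)"
      using G(3)[OF jf(2), unfolded l1 l2] q_face[OF \<theta> G(1)[OF \<theta>] \<phi> cd] G(3)[OF \<theta>]
        famD(3)[OF y \<theta> jf(1)] by simp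
    ultimately show ?thesis by (rule pullback_arrow_eqI[OF pb G' \<Gamma>G])
  qed
  define \<rho> where "\<rho> = (\<lambda>\<theta>\<in>simplices (a + b) K. inc (lo \<theta>, hi \<theta>) \<cdot> G \<theta>)"
  have \<rho>: "\<rho> \<in> fam W (a + b) K Z"
  proof (rule famI)
    fix \<theta> assume \<theta>: "\<theta> \<in> simplices (a + b) K"
    show "\<rho> \<theta> \<in> Hom C Z (omap W (fst \<theta>))"
      using Cmp_in[OF G(1)[OF \<theta>] inc_in[OF lo_hi_pos[OF \<theta>]]] \<theta> lo_hi(1)[OF \<theta>] by (simp add: \<rho>_def)
    fix k \<phi> assume \<phi>: "\<phi> \<in> Hom Delta k (fst \<theta>)"
    obtain c d \<phi>\<^sub>1 \<phi>\<^sub>2 where s: "k = c + d" "\<phi>\<^sub>1 \<in> Hom Delta_plus c (lo \<theta>)" "\<phi>\<^sub>2 \<in> Hom Delta_plus d (hi \<theta>)"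
      "\<phi> = join \<phi>\<^sub>1 \<phi>\<^sub>2" using face_split[OF \<theta> \<phi>] .
    have cd: "0 < c + d" using Hom_DeltaD(3)[OF \<phi>] s(1) by simp
    note l = lo_hi(4)[OF \<theta> s(2,3)]
    show "\<rho> (Cmp Delta_plus \<theta> \<phi>) = amap W \<phi> \<cdot> \<rho> \<theta>"
      unfolding \<rho>_def restrict_apply'[OF \<theta>] restrict_apply'[OF simplices_Cmp[OF K \<theta> \<phi>]]
      unfolding s(4) conjunct1[OF l] conjunct2[OF l] G_face[OF \<theta> s(2,3) cd]
      by (rule inc_face[OF \<theta> G(1)[OF \<theta>] s(2,3) cd])
  qed (simp add: \<rho>_def)
  let ?j = "\<iota> (a + b) (cut a b) \<cdot> bang C one Z"
  have r: "(\<rho>, ?j) \<in> elts Fib Z"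
    unfolding Fib_elts
  proof (intro conjI ballI \<rho>)
    show "?j \<in> Hom C Z (omap J (a + b))" using Cmp_in[OF bang_in[OF Z] \<iota>_in[OF ab]] .
    fix \<theta> assume \<theta>: "\<theta> \<in> simplices (a + b) K"
    show "\<pi> (fst \<theta>) \<cdot> \<rho> \<theta> = amap J \<theta> \<cdot> ?j"
      using \<pi>_inc_Cmp[OF lo_hi_pos[OF \<theta>] G(1)[OF \<theta>], unfolded lo_hi(1)[OF \<theta>]] \<theta> over_cut[OF \<theta> Z]
      by (simp add: \<rho>_def)
  qed simp
  have gG: "component \<rho> Z \<theta> = G \<theta>" if \<theta>: "\<theta> \<in> simplices (a + b) K" for \<theta>
    by (rule component_eqI[OF \<theta> G(1)[OF \<theta>]]) (simp add: \<rho>_def \<theta>)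
  have "(\<lambda>\<theta>\<in>simplices (a + b) front_face. p (lo \<theta>) (hi \<theta>) \<cdot> component \<rho> Z \<theta>) = x"
  proof (rule extensionalityI[OF _ famD(1)[OF x]])
    fix \<theta> assume \<theta>: "\<theta> \<in> simplices (a + b) front_face"
    note \<theta>' = front_face_simplex[OF \<theta>]
    have "u \<theta> = x \<theta>"
      using simplicesD(3)[OF \<theta>] \<theta>'(2,3) Delta.Cmp_Idt[OF simplicesD(1)[OF \<theta>]] by (simp add: u_def front_0)
    thus "(\<lambda>\<theta>\<in>simplices (a + b) front_face. p (lo \<theta>) (hi \<theta>) \<cdot> component \<rho> Z \<theta>) \<theta> = x \<theta>"
      using \<theta> gG[OF \<theta>'(1)] G(2)[OF \<theta>'(1)] by simp
  qed simp
  moreover have "(\<lambda>\<theta>\<in>simplices (a + b) K. q (lo \<theta>) (hi \<theta>) \<cdot> component \<rho> Z \<theta>) = y"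
    by (rule extensionalityI[OF _ famD(1)[OF y]]) (use gG G(3) in auto)
  ultimately show ?thesis unfolding ze to_Pairs_def by (intro bexI[OF _ r]) simp
qed

lemma to_Pairs_nat_bij: "nat_bij Fib Pairs to_Pairs"
  by (rule nat_bijI[OF to_Pairs_natural to_Pairs_inj to_Pairs_surj])

lemma Rel_W_presheaf: "presheaf (Rel W J \<pi> (a + b) K)"
  by (rule Rel_presheaf[OF W J \<pi> K])

lemma snd_natural: "natural (Rel W J \<pi> (a + b) K) (yo C (omap J (a + b))) (\<lambda>Z. snd)"
  by (rule naturalI) (auto simp: Rel_def yo_def)

lemma Fib_presheaf: "presheaf Fib"
  by (rule fibre_presheaf[OF Rel_W_presheaf snd_natural \<iota>_in[OF ab]])

text \<open>A point of \<open>\<Gamma>\<^bsub>a,b\<^esub>\<close> is a simplex of the total object, which restricts to a family on \<open>K\<close>.\<close>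

definition \<Gamma>_pt :: "'a \<Rightarrow> 'b \<Rightarrow> (darr \<Rightarrow> 'b) \<times> 'b" where
  "\<Gamma>_pt Z g = rel_pt W \<pi> (a + b) K Z (inc (a, b) \<cdot> g)"

lemma \<Gamma>_pt_natural: "natural (yo C (omap \<Gamma> (a, b))) Fib \<Gamma>_pt"
proof (rule naturalI)
  note n = rel_pt_natural[OF W J \<pi> K ab]
  fix Z g assume Z: "Z \<in> Obj C" and "g \<in> elts (yo C (omap \<Gamma> (a, b))) Z"
  hence g: "g \<in> Hom C Z (omap \<Gamma> (a, b))" by (simp add: yo_def)
  have ig: "inc (a, b) \<cdot> g \<in> Hom C Z (omap W (a + b))" using Cmp_in[OF g inc_in[OF ab]] .
  have "rel_pt W \<pi> (a + b) K Z (inc (a, b) \<cdot> g) \<in> elts (Rel W J \<pi> (a + b) K) Z"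
    using naturalD(1)[OF n Z] ig by (simp add: yo_def)
  thus "\<Gamma>_pt Z g \<in> elts Fib Z"
    unfolding \<Gamma>_pt_def fibre_sel using \<pi>_inc_Cmp[OF ab g] by (simp add: rel_pt_def)
next
  note n = rel_pt_natural[OF W J \<pi> K ab]
  fix Z Z' h g assume h: "h \<in> Hom C Z' Z" and "g \<in> elts (yo C (omap \<Gamma> (a, b))) Z"
  hence g: "g \<in> Hom C Z (omap \<Gamma> (a, b))" by (simp add: yo_def)
  have ig: "inc (a, b) \<cdot> g \<in> elts (yo C (omap W (a + b))) Z"
    using Cmp_in[OF g inc_in[OF ab]] by (simp add: yo_def)
  show "\<Gamma>_pt Z' (restr (yo C (omap \<Gamma> (a, b))) h g) = restr Fib h (\<Gamma>_pt Z g)"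
    unfolding \<Gamma>_pt_def fibre_sel using naturalD(2)[OF n h ig] Cmp_assoc[OF h g inc_in[OF ab]]
    by (simp add: yo_def)
qed

lemma \<Gamma>_pt_nat_bij:
  assumes full: "{..<a + b} \<in> K"
  shows "nat_bij (yo C (omap \<Gamma> (a, b))) Fib \<Gamma>_pt"
proof (rule nat_bijI[OF \<Gamma>_pt_natural])
  note i = Idt_simplices[OF ab full]
  {
    fix Z x y assume "x \<in> elts (yo C (omap \<Gamma> (a, b))) Z" "y \<in> elts (yo C (omap \<Gamma> (a, b))) Z"
    hence x: "x \<in> Hom C Z (omap \<Gamma> (a, b))" and y: "y \<in> Hom C Z (omap \<Gamma> (a, b))" by (simp_all add: yo_def)
    assume "\<Gamma>_pt Z x = \<Gamma>_pt Z y"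
    hence e: "(\<lambda>\<theta>\<in>simplices (a + b) K. amap W \<theta> \<cdot> (inc (a, b) \<cdot> x)) =
        (\<lambda>\<theta>\<in>simplices (a + b) K. amap W \<theta> \<cdot> (inc (a, b) \<cdot> y))"
      unfolding \<Gamma>_pt_def rel_pt_def by simp
    have "inc (a, b) \<cdot> x = inc (a, b) \<cdot> y"
      using fun_cong[OF e, of "Idt Delta_plus (a + b)"] i sobj_Idt[OF W ab]
        Idt_Cmp[OF Cmp_in[OF x inc_in[OF ab]]] Idt_Cmp[OF Cmp_in[OF y inc_in[OF ab]]] by simp
    thus "x = y" by (rule inc_mono[OF ab x y])
  next
    fix Z z assume Z: "Z \<in> Obj C" and z: "z \<in> elts Fib Z"
    obtain \<rho> j where ze: "z = (\<rho>, j)" by (cases z)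
    have \<rho>: "\<rho> \<in> fam W (a + b) K Z" and j: "j \<in> Hom C Z (omap J (a + b))" "j = \<iota> (a + b) (cut a b) \<cdot> bang C one Z"
      and eq: "\<forall>\<theta> \<in> simplices (a + b) K. \<pi> (fst \<theta>) \<cdot> \<rho> \<theta> = amap J \<theta> \<cdot> j"
      using z[unfolded ze Fib_elts] by - (elim conjE, assumption)+
    let ?i = "Idt Delta_plus (a + b)"
    have fi: "fst ?i = a + b" using Hom_Delta_plusD[OF Idt_Delta_plus] by blast
    have "\<pi> (a + b) \<cdot> \<rho> ?i = \<iota> (a + b) (cut a b) \<cdot> bang C one Z"
      using bspec[OF eq i] fi sobj_Idt[OF J ab] Idt_Cmp[OF j(1)] j(2) by simp
    from inc_factor[OF ab famD(2)[OF \<rho> i, unfolded fi] this]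
    obtain g where g: "g \<in> Hom C Z (omap \<Gamma> (a, b))" "inc (a, b) \<cdot> g = \<rho> ?i" by blast
    have "(\<lambda>\<theta>\<in>simplices (a + b) K. amap W \<theta> \<cdot> \<rho> ?i) = \<rho>"
      by (rule extensionalityI[OF _ famD(1)[OF \<rho>]]) (use fam_Idt[OF \<rho> full ab] in auto)
    hence "\<Gamma>_pt Z g = z"
      unfolding ze \<Gamma>_pt_def rel_pt_def g(2) using \<pi>_inc_Cmp[OF ab g(1)] g(2) j(2) by simp
    thus "\<exists>x \<in> elts (yo C (omap \<Gamma> (a, b))) Z. \<Gamma>_pt Z x = z" using g(1) by (auto simp: yo_def)
  }
qed

end

context cograph_total begin

text \<open>The translation into pairs is used twice, for \<open>L\<close> and for the full simplex. In the second case the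
  families over \<open>cut a b\<close> are the points of \<open>\<Gamma>\<^bsub>a,b\<^esub>\<close>, and the translation commutes with restriction
  because it is performed simplex by simplex.\<close>

lemma fibre_cover:
  assumes ab: "0 < a + b" and L: "complex (a + b) L"
    and lift: "\<forall>n>0. cover_map (yo C (omap X n)) (Rel X Y f n {v. v \<subset> {..<n}})
      (rel_pt X f n {v. v \<subset> {..<n}})"
    and kan: "cover_map (yo C (omap Y (a + b))) (FamP Y (a + b) L)
      (\<lambda>Z g. \<lambda>\<theta>\<in>simplices (a + b) L. amap Y \<theta> \<cdot> g)"
  shows "cover_map (yo C (omap \<Gamma> (a, b)))
    (fibre (Rel W J \<pi> (a + b) L) (\<lambda>Z. snd) (\<iota> (a + b) (cut a b)))
    (\<lambda>Z g. rel_pt W \<pi> (a + b) L Z (inc (a, b) \<cdot> g))"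
proof -
  let ?F = "Pow {..<a + b}"
  interpret F: cograph_fibre C T one X Y W J f \<pi> \<Gamma> inc \<iota> p q a b ?F
    by unfold_locales (rule ab, rule complex_Pow)
  interpret L: cograph_fibre C T one X Y W J f \<pi> \<Gamma> inc \<iota> p q a b L
    by unfold_locales (rule ab, rule L)
  have LF: "L \<subseteq> ?F" by (rule complex_subset_Pow[OF L])
  have PA: "?F \<inter> Pow {..<a} = Pow {..<a}" by auto
  have c1: "cover_map (yo C (omap \<Gamma> (a, b))) F.Fib F.\<Gamma>_pt"
    using nat_bij_cover_map[OF F.\<Gamma>_pt_nat_bij yo_presheaf F.Fib_presheaf] yo_universal[OF \<Gamma>_obj]
    unfolding representable_def by blast
  have c3: "cover_map F.Pairs L.Pairs (Fam_res (a + b) L.front_face L)"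
    unfolding PA by (rule relative_horn_cover[OF X Y f lift ab L _ kan]) auto
  have c2: "cover_map F.Fib F.Pairs F.to_Pairs"
    using nat_bij_cover_map[OF F.to_Pairs_nat_bij F.Fib_presheaf cover_mapD(1)[OF c3]] cover_mapD(4)[OF c3]
    by blast
  note c = cover_map_comp[OF cover_map_comp[OF c1 c2] c3]
  have "cover_map (yo C (omap \<Gamma> (a, b))) L.Pairs (\<lambda>Z g. L.to_Pairs Z (L.\<Gamma>_pt Z g))"
  proof (rule cover_map_cong[OF c])
    fix Z g
    note sub = simplices_mono[OF LF, of "a + b"]
    have ff: "simplices (a + b) L.front_face \<subseteq> simplices (a + b) F.front_face"
      "simplices (a + b) L.front_face \<subseteq> simplices (a + b) L"
      by (rule simplices_mono; use LF in blast)+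
    have "F.component (\<lambda>\<theta>\<in>simplices (a + b) ?F. amap W \<theta> \<cdot> (inc (a, b) \<cdot> g)) Z \<theta> =
        L.component (\<lambda>\<theta>\<in>simplices (a + b) L. amap W \<theta> \<cdot> (inc (a, b) \<cdot> g)) Z \<theta>" if "\<theta> \<in> simplices (a + b) L" for \<theta>
      using that sub unfolding F.component_def L.component_def by auto
    hence e: "L.component (\<lambda>\<theta>\<in>simplices (a + b) L. amap W \<theta> \<cdot> (inc (a, b) \<cdot> g)) Z \<theta> =
        F.component (\<lambda>\<theta>\<in>simplices (a + b) ?F. amap W \<theta> \<cdot> (inc (a, b) \<cdot> g)) Z \<theta>" if "\<theta> \<in> simplices (a + b) L" for \<theta>
      using that by simp
    have in_F: "\<theta> \<in> simplices (a + b) ?F" if "\<theta> \<in> simplices (a + b) L" for \<theta>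
      using sub that by (rule subsetD)
    show "L.to_Pairs Z (L.\<Gamma>_pt Z g) =
        Fam_res (a + b) L.front_face L Z (F.to_Pairs Z (F.\<Gamma>_pt Z g))"
      unfolding L.to_Pairs_def F.to_Pairs_def L.\<Gamma>_pt_def F.\<Gamma>_pt_def rel_pt_def Fam_res_def prod.case
      by (intro arg_cong2[where f = Pair] restrict_ext)
        (simp_all add: e in_F subsetD[OF ff(1)] subsetD[OF ff(2)])
  qed
  from cover_map_nat_bij_cancel[OF this L.to_Pairs_nat_bij L.Fib_presheaf L.\<Gamma>_pt_natural]
  show ?thesis unfolding L.\<Gamma>_pt_def .
qed

end


section \<open>Horn filling in the total object\<close>

theorem proposition4p46:
  fixes C :: "('o, 'a) cat" and T :: "'a set" and one :: 'o
    and X Y W J :: "('o, 'a) sobj" and f \<pi> :: "nat \<Rightarrow> 'a"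
    and \<Gamma> :: "('o, 'a) bisobj"
    and inc :: "nat \<times> nat \<Rightarrow> 'a" and \<iota> :: "nat \<Rightarrow> darr \<Rightarrow> 'a"
  assumes "extensive_site C T one"
    and "higher_groupoid C T one X"
    and "higher_groupoid C T one Y"
    and "acyclic_fibration C T X Y f"
    and "is_cograph C one X Y f \<Gamma>"
    and "is_total C \<Gamma> W inc"
    and "is_j C one (simplex 1) J \<iota>"
    and "is_total_proj C one \<Gamma> W inc J \<iota> \<pi>"
  shows "Kan_fibration C T W J \<pi>"
proof -
  interpret extensive_site C T one by (rule assms(1))
  have X: "simplicial_object C X" and Y: "simplicial_object C Y"
    and KY: "Kan_fibration C T Y (const_fctr C one) (\<lambda>p. bang C one (omap Y p))"
    using assms(2,3) unfolding higher_groupoid_def n_groupoid_def by auto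
  have bY: "simplicial_map C Y (const_fctr C one) (\<lambda>p. bang C one (omap Y p))"
    and kanY: "\<And>m k. 1 \<le> m \<Longrightarrow> k \<le> m \<Longrightarrow>
      rel_cond C (\<lambda>c. c \<in> T) (horn m k) m Y (const_fctr C one) (\<lambda>p. bang C one (omap Y p))"
    using KY unfolding Kan_fibration_def Kan_def by auto
  have f: "simplicial_map C X Y f" and acyc: "\<And>m. rel_cond C (\<lambda>c. c \<in> T) (bdry m) m X Y f"
    using assms(4) unfolding acyclic_fibration_def by auto
  have W: "simplicial_object C W" and \<Gamma>: "aug_bisimplicial_object C \<Gamma>"
    using assms(6) unfolding is_total_def by auto
  have J: "simplicial_object C J" using assms(7) unfolding is_j_def by auto
  have \<pi>: "simplicial_map C W J \<pi>" using assms(8) unfolding is_total_proj_def by auto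
  obtain p q where
    pb: "\<And>a b. is_pullback C (augment_map C one f a) (amap (augment C one Y) (front a b))
      (omap \<Gamma> (a, b)) (p a b) (q a b)"
    and nat: "\<And>\<alpha> \<beta>. \<alpha> \<in> Arr Delta_plus \<Longrightarrow> \<beta> \<in> Arr Delta_plus \<Longrightarrow>
      p (fst \<alpha>) (fst \<beta>) \<cdot>\<^bsub>C\<^esub> amap \<Gamma> (\<alpha>, \<beta>) = amap (augment C one X) \<alpha> \<cdot>\<^bsub>C\<^esub> p (fst (snd \<alpha>)) (fst (snd \<beta>)) \<and>
      q (fst \<alpha>) (fst \<beta>) \<cdot>\<^bsub>C\<^esub> amap \<Gamma> (\<alpha>, \<beta>) =
        amap (augment C one Y) (join \<alpha> \<beta>) \<cdot>\<^bsub>C\<^esub> q (fst (snd \<alpha>)) (fst (snd \<beta>))"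
    using assms(5) unfolding is_cograph_def Let_def Delta_sel by blast
  interpret cograph_total C T one X Y W J f \<pi> \<Gamma> inc \<iota> p q
  proof (unfold_locales, goal_cases)
    case (9 \<alpha> a' a \<beta> b' b)
    thus ?case using nat[of \<alpha> \<beta>] unfolding Hom_def by auto
  next
    case (10 \<alpha> a' a \<beta> b' b)
    thus ?case using nat[of \<alpha> \<beta>] unfolding Hom_def by auto
  next
    case (11 n)
    thus ?case using assms(6) unfolding is_total_def by simp
  next
    case (12 \<alpha> a' a \<beta> b' b)
    have "join \<alpha> \<beta> \<in> Arr Delta" using Hom_DeltaD(6)[OF Hom_Delta_pos[OF join_Hom[OF 12(1,2)] 12(3)]] .
    thus ?case using assms(6) 12(1,2) unfolding is_total_def Hom_def by auto
  next
    case (13 n)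
    thus ?case using assms(7) unfolding is_j_def by simp
  next
    case (14 \<theta> k n s)
    have "\<forall>\<theta> \<in> Arr Delta. \<forall>s \<in> elts (simplex 1) (fst (snd \<theta>)).
        amap J \<theta> \<cdot>\<^bsub>C\<^esub> \<iota> (fst (snd \<theta>)) s = \<iota> (fst \<theta>) (Cmp Delta_plus s \<theta>)"
      using assms(7) unfolding is_j_def by (simp add: restr_simplex)
    from bspec[OF bspec[OF this Hom_DeltaD(6)[OF 14(1)]], of s] show ?case
      using 14 Hom_DeltaD(1,2)[OF 14(1)] by (simp add: elts_simplex numeral_2_eq_2)
  next
    case (15 a b)
    thus ?case using assms(8) unfolding is_total_proj_def by auto
  qed (rule X Y f W J \<pi> \<Gamma> pb)+
  have lift: "\<forall>n>0. cover_map (yo C (omap X n)) (Rel X Y f n {v. v \<subset> {..<n}})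
      (rel_pt X f n {v. v \<subset> {..<n}})"
  proof (intro allI impI)
    fix n :: nat assume "0 < n"
    then obtain m where n: "n = Suc m" by (cases n) auto
    show "cover_map (yo C (omap X n)) (Rel X Y f n {v. v \<subset> {..<n}}) (rel_pt X f n {v. v \<subset> {..<n}})"
      using acyc[of m] unfolding bdry_eq_subc rel_cond_iff_cover_map[OF X Y f complex_boundary]
      unfolding n lessThan_Suc_atMost .
  qed
  show ?thesis
    unfolding Kan_fibration_def Kan_def
  proof (intro conjI \<pi> allI impI)
    fix m k :: nat assume "1 \<le> m \<and> k \<le> m"
    hence mk: "1 \<le> m" "k \<le> m" by auto
    let ?L = "{v. v \<subseteq> {..m} \<and> insert k v \<noteq> {..m}}" and ?M = "Suc m"
    let ?I = "{(a, b). a + b = ?M}"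
    have M: "0 < ?M" by simp
    note L = complex_horn[OF mk]
    note kan = Kan_object_cover_map[OF Y L bY kanY[OF mk, unfolded horn_eq_subc]]
    show "rel_cond C (\<lambda>c. c \<in> T) (horn m k) m W J \<pi>"
      unfolding horn_eq_subc rel_cond_iff_cover_map[OF W J \<pi> L]
    proof (rule cover_map_glue[OF finite_pairs _ W_cop[OF M] J_cop_cut[OF M], where \<tau> = "\<lambda>Z. snd"])
      have "(0, ?M) \<in> ?I" by simp
      thus "?I \<noteq> {}" by blast
      show "presheaf (Rel W J \<pi> ?M ?L)" by (rule Rel_presheaf[OF W J \<pi> L])
      show "natural (yo C (omap W ?M)) (Rel W J \<pi> ?M ?L) (rel_pt W \<pi> ?M ?L)"
        by (rule rel_pt_natural[OF W J \<pi> L M])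
      show "natural (Rel W J \<pi> ?M ?L) (yo C (omap J ?M)) (\<lambda>Z. snd)"
        by (rule naturalI) (auto simp: Rel_def yo_def)
    next
      fix Q Z z x assume "is_coproduct C ?I Q Z z" "\<And>i. i \<in> ?I \<Longrightarrow> x i \<in> elts (Rel W J \<pi> ?M ?L) (Q i)"
      thus "\<exists>y \<in> elts (Rel W J \<pi> ?M ?L) Z. \<forall>i \<in> ?I. restr (Rel W J \<pi> ?M ?L) (z i) y = x i"
        by (rule Rel_glue[OF _ W J \<pi> L M])
    next
      fix Q Z z x y assume "is_coproduct C ?I Q Z z" "x \<in> elts (Rel W J \<pi> ?M ?L) Z"
        "y \<in> elts (Rel W J \<pi> ?M ?L) Z"
        "\<And>i. i \<in> ?I \<Longrightarrow> restr (Rel W J \<pi> ?M ?L) (z i) x = restr (Rel W J \<pi> ?M ?L) (z i) y"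
      thus "x = y" by (rule Rel_separated[OF _ W J])
    next
      fix i assume "i \<in> ?I"
      then obtain a b where i: "i = (a, b)" and ab: "?M = a + b" by auto
      have ab0: "0 < a + b" unfolding ab[symmetric] by (rule M)
      show "cover_map (yo C (omap \<Gamma> i))
          (fibre (Rel W J \<pi> ?M ?L) (\<lambda>Z. snd) (case i of (a, b) \<Rightarrow> \<iota> ?M (cut a b)))
          (\<lambda>Z g. rel_pt W \<pi> ?M ?L Z (inc i \<cdot>\<^bsub>C\<^esub> g))"
        unfolding i prod.case
        using fibre_cover[OF ab0 L[unfolded ab] lift kan[unfolded ab]] unfolding ab .
    qed
  qed
qed

end
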